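(* For $w\in\mathfrak{S}_n$ the following are equivalent: (1) the bipartite graphs $\Gamma_w$ and $\Gamma^w$ are isomorphic; (2) $w$ avoids the patterns $3412$, $4231$, $34521$, $45321$, $54123$, and $54312$; (3) $w$ is polished; (4) the interval $[e,w]$ in Bruhat order is self-dual.
   Context: $\mathfrak{S}_n$ is the symmetric group as a Coxeter group of type $A_{n-1}$ with simple generators $S=\{s_1,\dots,s_{n-1}\}$, $s_i=(i\ i+1)$; its Dynkin diagram is the path $s_1 - s_2 - \cdots - s_{n-1}$. $\ell(w)$ is the number of inversions of $w$. Bruhat order is the transitive closure of $w<wt$ for transpositions $t$ with $\ell(wt)>\ell(w)$; $[e,w]=\{u:u\le w\}$ and $P^w_k=\{u\le w:\ell(u)=k\}$. $\Gamma_w$ is the bipartite graph on vertex set $P^w_1\sqcup P^w_2$ whose edges are the cover relations of Bruhat order between these sets; $\Gamma^w$ is the bipartite graph on $P^w_{\ell(w)-1}\sqcup P^w_{\ell(w)-2}$ with edges the cover relations between them. For $\pi\in\mathfrak{S}_m$, $w$ avoids $\pi$ if there are no indices $i_1<\dots<i_m$ with $w(i_1),\dots,w(i_m)$ in the same relative order as $\pi(1),\dots,\pi(m)$. For $J\subseteq S$, $W_J$ is the subgroup generated by $J$ and $w_0(J)$ its unique longest element. An element $w$ of a finite Coxeter system $(W,S)$ is polished if there exist pairwise disjoint subsets $S_1,\dots,S_k\subseteq S$, each a connected subset of the Dynkin diagram, and coverings $S_i=J_i\cup J_i'$ with $J_i\cap J_i'$ totally disconnected (no two elements adjacent in the Dynkin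 diagram) such that $w=\prod_{i=1}^k w_0(J_i)\,w_0(J_i\cap J_i')\,w_0(J_i')$, the product taken left to right in the order $i=1,\dots,k$ (for some ordering of the $S_i$). A poset is self-dual if it is isomorphic to its order dual. *)

theory Defs
  imports "HOL-Algebra.Sym_Groups"
begin

text \<open>
  Elements of the symmetric group on n letters are functions on \<^typ>\<open>nat\<close> permuting
  \<^term>\<open>{1..n::nat}\<close>, as in \<^const>\<open>sym_group\<close>; products are composition of functions.
\<close>

section \<open>Length and Bruhat order\<close>

definition perm_length :: "nat \<Rightarrow> (nat \<Rightarrow> nat) \<Rightarrow> nat" where
  "perm_length n w = card {(i, j). 1 \<le> i \<and> i < j \<and> j \<le> n \<and> w j < w i}"

definition bruhat_step :: "nat \<Rightarrow> (nat \<Rightarrow> nat) \<Rightarrow> (nat \<Rightarrow> nat) \<Rightarrow> bool" where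
  "bruhat_step n u v \<longleftrightarrow>
     u \<in> carrier (sym_group n) \<and>
     (\<exists>i j. 1 \<le> i \<and> i < j \<and> j \<le> n \<and> v = u \<circ> transpose i j) \<and>
     perm_length n u < perm_length n v"

definition bruhat_less :: "nat \<Rightarrow> (nat \<Rightarrow> nat) \<Rightarrow> (nat \<Rightarrow> nat) \<Rightarrow> bool" where
  "bruhat_less n = (bruhat_step n)\<^sup>+\<^sup>+"

definition bruhat_le :: "nat \<Rightarrow> (nat \<Rightarrow> nat) \<Rightarrow> (nat \<Rightarrow> nat) \<Rightarrow> bool" where
  "bruhat_le n u v \<longleftrightarrow> bruhat_less n u v \<or> u = v"

definition bruhat_covers :: "nat \<Rightarrow> (nat \<Rightarrow> nat) \<Rightarrow> (nat \<Rightarrow> nat) \<Rightarrow> bool" where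
  "bruhat_covers n u v \<longleftrightarrow>
     bruhat_less n u v \<and> \<not> (\<exists>z. bruhat_less n u z \<and> bruhat_less n z v)"

definition lower_interval :: "nat \<Rightarrow> (nat \<Rightarrow> nat) \<Rightarrow> (nat \<Rightarrow> nat) set" where
  "lower_interval n w = {u \<in> carrier (sym_group n). bruhat_le n u w}"

text \<open>
  The rank is an integer, so that the levels below 0, which occur in the upper graph when
  w has length at most 1, are empty.
\<close>
definition rank_level :: "nat \<Rightarrow> (nat \<Rightarrow> nat) \<Rightarrow> int \<Rightarrow> (nat \<Rightarrow> nat) set" where
  "rank_level n w k = {u \<in> lower_interval n w. int (perm_length n u) = k}"


section \<open>The two bipartite graphs\<close>

text \<open>A simple graph is a pair of its vertex set and its set of edges (two-element sets).\<close>

definition graph_isomorphic :: "'a set \<times> 'a set set \<Rightarrow> 'b set \<times> 'b set set \<Rightarrow> bool" where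
  "graph_isomorphic G H \<longleftrightarrow>
     (\<exists>f. bij_betw f (fst G) (fst H) \<and>
          (\<forall>u\<in>fst G. \<forall>v\<in>fst G. {u, v} \<in> snd G \<longleftrightarrow> {f u, f v} \<in> snd H))"

definition cover_graph ::
    "nat \<Rightarrow> (nat \<Rightarrow> nat) set \<Rightarrow> (nat \<Rightarrow> nat) set \<Rightarrow> (nat \<Rightarrow> nat) set \<times> (nat \<Rightarrow> nat) set set" where
  "cover_graph n A B =
     (A \<union> B, {{u, v} | u v. u \<in> A \<and> v \<in> B \<and> (bruhat_covers n u v \<or> bruhat_covers n v u)})"

definition Gamma_lower :: "nat \<Rightarrow> (nat \<Rightarrow> nat) \<Rightarrow> (nat \<Rightarrow> nat) set \<times> (nat \<Rightarrow> nat) set set" where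
  "Gamma_lower n w = cover_graph n (rank_level n w 1) (rank_level n w 2)"

definition Gamma_upper :: "nat \<Rightarrow> (nat \<Rightarrow> nat) \<Rightarrow> (nat \<Rightarrow> nat) set \<times> (nat \<Rightarrow> nat) set set" where
  "Gamma_upper n w =
     cover_graph n (rank_level n w (int (perm_length n w) - 1))
                   (rank_level n w (int (perm_length n w) - 2))"


section \<open>Pattern avoidance\<close>

text \<open>A pattern is given in one-line notation.\<close>

definition avoids :: "nat \<Rightarrow> (nat \<Rightarrow> nat) \<Rightarrow> nat list \<Rightarrow> bool" where
  "avoids n w p \<longleftrightarrow>
     \<not> (\<exists>i :: nat \<Rightarrow> nat.
          strict_mono_on {..<length p} i \<and> i ` {..<length p} \<subseteq> {1..n} \<and>
          (\<forall>a<length p. \<forall>b<length p. w (i a) < w (i b) \<longleftrightarrow> p ! a < p ! b))"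


section \<open>Polished elements\<close>

text \<open>
  Subsets of the set S of simple generators are represented by the corresponding sets of
  indices, i.e. by subsets of \<^term>\<open>{1..<n::nat}\<close>.
\<close>

definition simple_refl :: "nat \<Rightarrow> nat \<Rightarrow> nat" where
  "simple_refl i = transpose i (i + 1)"

definition dynkin_adj :: "nat \<Rightarrow> nat \<Rightarrow> bool" where
  "dynkin_adj i j \<longleftrightarrow> j = i + 1 \<or> i = j + 1"

definition dynkin_connected :: "nat set \<Rightarrow> bool" where
  "dynkin_connected J \<longleftrightarrow>
     (\<forall>a\<in>J. \<forall>b\<in>J. (\<lambda>x y. x \<in> J \<and> y \<in> J \<and> dynkin_adj x y)\<^sup>*\<^sup>* a b)"

definition totally_disconnected :: "nat set \<Rightarrow> bool" where
  "totally_disconnected J \<longleftrightarrow> (\<forall>a\<in>J. \<forall>b\<in>J. \<not> dynkin_adj a b)"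

definition parabolic :: "nat \<Rightarrow> nat set \<Rightarrow> (nat \<Rightarrow> nat) set" where
  "parabolic n J = generate (sym_group n) (simple_refl ` J)"

definition longest :: "nat \<Rightarrow> nat set \<Rightarrow> nat \<Rightarrow> nat" where
  "longest n J =
     (THE u. u \<in> parabolic n J \<and> (\<forall>v\<in>parabolic n J. perm_length n v \<le> perm_length n u))"

text \<open>
  The list consists of the pairs \<open>(J\<^sub>i, J\<^sub>i')\<close>, in the order of the product, with
  \<open>S\<^sub>i = J\<^sub>i \<union> J\<^sub>i'\<close>. Allowing \<open>S\<^sub>i = {}\<close> only adds factors equal to the identity.
\<close>
definition polished :: "nat \<Rightarrow> (nat \<Rightarrow> nat) \<Rightarrow> bool" where
  "polished n w \<longleftrightarrow>
     (\<exists>Js :: (nat set \<times> nat set) list.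
        (\<forall>(J, J') \<in> set Js.
           J \<union> J' \<subseteq> {1..<n} \<and> dynkin_connected (J \<union> J') \<and> totally_disconnected (J \<inter> J')) \<and>
        (\<forall>a<length Js. \<forall>b<length Js. a \<noteq> b \<longrightarrow>
           (fst (Js ! a) \<union> snd (Js ! a)) \<inter> (fst (Js ! b) \<union> snd (Js ! b)) = {}) \<and>
        w = foldr (\<circ>)
              (map (\<lambda>(J, J'). longest n J \<circ> longest n (J \<inter> J') \<circ> longest n J') Js) id)"


section \<open>Self-duality\<close>

definition poset_isomorphic ::
    "'a set \<Rightarrow> ('a \<Rightarrow> 'a \<Rightarrow> bool) \<Rightarrow> 'b set \<Rightarrow> ('b \<Rightarrow> 'b \<Rightarrow> bool) \<Rightarrow> bool" where
  "poset_isomorphic A r B r' \<longleftrightarrow>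
     (\<exists>f. bij_betw f A B \<and> (\<forall>x\<in>A. \<forall>y\<in>A. r x y \<longleftrightarrow> r' (f x) (f y)))"

definition self_dual :: "'a set \<Rightarrow> ('a \<Rightarrow> 'a \<Rightarrow> bool) \<Rightarrow> bool" where
  "self_dual A r \<longleftrightarrow> poset_isomorphic A r A (\<lambda>x y. r y x)"

end

theory Submission
  imports Defs
begin

text \<open>
  (3) implies (4): for one factor, \<open>[e, w]\<close> is \<open>W\<^sub>J W\<^bsub>J'\<^esub>\<close>, and with \<open>K = J \<inter> J'\<close> the map
  \<open>x y \<mapsto> w\<^sub>0(J) x w\<^sub>0(K) y w\<^sub>0(J')\<close>, where \<open>x \<in> W\<^sub>J\<close> and
  \<open>y \<in> W\<^bsub>J'\<^esub>\<close>, is an order-reversing involution; it is well defined because \<open>W\<^sub>K\<close>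
  is abelian. Factors with disjoint supports can be treated independently.

  (1) implies (2): the coatoms of \<open>[e, w]\<close> are the edges of the Hasse diagram of the inversion
  order of \<open>w\<close>. Counting edges of the two graphs gives at most as many coatoms as atoms, so
  every edge of this diagram is a bridge. Pairs of vertices with two common neighbours form a linear
  forest on the atoms, whereas any two consecutive Hasse edges \<open>a \<rightarrow> b \<rightarrow> c\<close> form such a
  pair of coatoms. Each of the six patterns forces a cycle in the diagram, or a vertex of degree
  three or a 4-cycle in this relation.

  (2) implies (3): avoiding 3412 and 4231 implies, up to inversion, that the values
  \<open>w(1), \<dots>, 1\<close> occur in decreasing order. Either \<open>w\<close> is then a product of two elements
  with disjoint supports, or, with \<open>p + 1 = w(1)\<close>, it is \<open>w\<^sub>0({1..p}) s\<^sub>p y\<close> for a smaller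
  \<open>y\<close> to which induction applies.
\<close>

section \<open>Length and Bruhat order\<close>

text \<open>Three obstacles shape the development. Elements of W_J W_J' do not factor uniquely, so
  the order-reversing map is carried as a relation, which only has to answer one descending
  transposition by one ascending one. Next, an isomorphism of the two graphs need not respect the
  two sides of the bipartition, so only data independent of the sides can be transported: the
  numbers of vertices and edges, and the relation of having two common neighbours. The counts
  combine because 2 is a lower bound at the bottom (atoms below an element of length two) and an
  upper bound at the top (coatoms above an element of corank two). Finally, attaching w0({1..p}) s_p
  to a polished y works only if it can be moved past everything left of the factor of y that
  contains s_p. The induction therefore proves more for decreasing permutations whose first two
  values are consecutive: one factor has the first two generators in J and neither in J'. Attaching
  on the left needs them in J' instead, which is why the strong form is applied to the inverse of
  y.\<close>

abbreviation inversions :: "nat \<Rightarrow> (nat \<Rightarrow> nat) \<Rightarrow> (nat \<times> nat) set" where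
  "inversions n u \<equiv> {(i, j). 1 \<le> i \<and> i < j \<and> j \<le> n \<and> u j < u i}"

lemma finite_inversions: "finite (inversions n u)"
  by (rule finite_subset[of _ "{1..n} \<times> {1..n}"]) auto

lemma transpose_Suc_less:
  assumes "a < b" "\<not> (a = k \<and> b = Suc k)"
  shows "transpose k (Suc k) a < transpose k (Suc k) b"
  using assms by (auto simp: transpose_eq_iff Transposition.transpose_def)

text \<open>Relabelling positions by \<open>transpose k (Suc k)\<close> keeps the order of every
  pair except (k, k+1). It therefore matches the inversions of u with those of the product, and (k,
  k+1) is the one new inversion.\<close>

lemma perm_length_simple:
  assumes "1 \<le> k" "k < n" "u k < u (Suc k)"
  shows "perm_length n (u \<circ> transpose k (Suc k)) = Suc (perm_length n u)"
proof -
  let ?s = "transpose k (Suc k)"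
  have ran: "1 \<le> ?s a \<and> ?s a \<le> n \<longleftrightarrow> 1 \<le> a \<and> a \<le> n" for a
    using assms by (auto simp: Transposition.transpose_def)
  have "inversions n (u \<circ> ?s) = insert (k, Suc k) (map_prod ?s ?s ` inversions n u)"
  proof (intro equalityI subrelI)
    fix a b assume ab: "(a, b) \<in> inversions n (u \<circ> ?s)"
    show "(a, b) \<in> insert (k, Suc k) (map_prod ?s ?s ` inversions n u)"
    proof (cases "a = k \<and> b = Suc k")
      case False
      have "(?s a, ?s b) \<in> inversions n u"
        using ab ran[of a] ran[of b] transpose_Suc_less[of a b k] False by auto
      then have "map_prod ?s ?s (?s a, ?s b) \<in> map_prod ?s ?s ` inversions n u" by blast
      then show ?thesis by simp
    qed auto
  next
    fix a b assume "(a, b) \<in> insert (k, Suc k) (map_prod ?s ?s ` inversions n u)"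
    then consider "a = k \<and> b = Suc k" | c d where "(c, d) \<in> inversions n u" "a = ?s c" "b = ?s d"
      by auto
    then show "(a, b) \<in> inversions n (u \<circ> ?s)"
    proof cases
      case 1 then show ?thesis using assms by auto
    next
      case 2
      have "?s c < ?s d" using 2 assms by (intro transpose_Suc_less) auto
      then show ?thesis using 2 ran[of c] ran[of d] by auto
    qed
  qed
  moreover have "(k, Suc k) \<notin> map_prod ?s ?s ` inversions n u"
  proof
    assume "(k, Suc k) \<in> map_prod ?s ?s ` inversions n u"
    then obtain c d where cd: "c < d" "?s c = k" "?s d = Suc k" by auto
    have "?s (?s c) = Suc k" "?s (?s d) = k" unfolding cd(2,3) by simp_all
    then show False using cd(1) unfolding transpose_involutory by simp
  qed
  moreover have "inj_on (map_prod ?s ?s) (inversions n u)"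
    by (rule inj_on_subset[OF prod.inj_map]) auto
  ultimately show ?thesis
    unfolding perm_length_def using finite_inversions by (simp add: card_image)
qed

lemma perm_length_simple_down:
  assumes "1 \<le> k" "k < n" "u (Suc k) < u k"
  shows "perm_length n u = Suc (perm_length n (u \<circ> transpose k (Suc k)))"
  using perm_length_simple[of k n "u \<circ> transpose k (Suc k)"] assms by (simp add: comp_assoc)

text \<open>Induction on j - i through t_ij = s_i t_(i+1)j s_i. The effects of the two outer factors
  cancel unless u (i+1) lies between u i and u j; then both raise the length by one and account for
  the additional element i + 1 of the counted set.\<close>

lemma perm_length_transpose:
  assumes "1 \<le> i" "i < j" "j \<le> n" "u i < u j" "inj u"
  shows "perm_length n (u \<circ> transpose i j)
           = perm_length n u + 1 + 2 * card {k. i < k \<and> k < j \<and> u i < u k \<and> u k < u j}"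
  using assms
proof (induction "j - i" arbitrary: i u)
  case 0 then show ?case by simp
next
  case (Suc d)
  show ?case
  proof (cases "j = Suc i")
    case True
    have "{k. i < k \<and> k < Suc i \<and> u i < u k \<and> u k < u j} = {}" by auto
    then show ?thesis using True Suc.prems perm_length_simple[of i n u] by (auto simp only: card.empty)
  next
    case False
    let ?s = "transpose i (Suc i)"
    let ?u1 = "u \<circ> ?s" and ?u2 = "u \<circ> ?s \<circ> transpose (Suc i) j"
    have j: "Suc i < j" using False Suc.prems by simp
    let ?K = "{k. Suc i < k \<and> k < j \<and> u i < u k \<and> u k < u j}"
    have "{k. Suc i < k \<and> k < j \<and> ?u1 (Suc i) < ?u1 k \<and> ?u1 k < ?u1 j} = ?K"
      using j by (auto simp: Transposition.transpose_def)
    then have IH: "perm_length n ?u2 = perm_length n ?u1 + 1 + 2 * card ?K"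
      using Suc.hyps(1)[of "Suc i" ?u1] Suc.hyps(2) Suc.prems j
      by (simp add: inj_compose)
    have t: "transpose i j = ?s \<circ> transpose (Suc i) j \<circ> ?s"
      using j by (auto simp: fun_eq_iff Transposition.transpose_def)
    have v: "u \<circ> transpose i j = ?u2 \<circ> ?s" by (simp add: t comp_assoc)
    have u2: "?u2 i = u (Suc i)" "?u2 (Suc i) = u j" using j by auto
    have ne: "u (Suc i) \<noteq> u i" "u (Suc i) \<noteq> u j" using injD[OF Suc.prems(5), of "Suc i" i] injD[OF Suc.prems(5), of "Suc i" j] j by auto
    have fK: "finite ?K" by (rule finite_subset[of _ "{..j}"]) auto
    have i: "1 \<le> i" "i < n" using Suc.prems by auto
    consider "u (Suc i) < u i" | "u i < u (Suc i)" "u (Suc i) < u j" | "u j < u (Suc i)"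
      using ne by linarith
    then show ?thesis
    proof cases
      case 1
      have "{k. i < k \<and> k < j \<and> u i < u k \<and> u k < u j} = ?K"
        using 1 by (auto simp: less_Suc_eq order.order_iff_strict) (metis Suc_lessI less_asym)
      moreover have "perm_length n u = Suc (perm_length n ?u1)"
        using perm_length_simple_down[of i n u] i 1 by simp
      moreover have "perm_length n (?u2 \<circ> ?s) = Suc (perm_length n ?u2)"
        using i u2 1 Suc.prems(4) by (intro perm_length_simple) auto
      ultimately show ?thesis using IH v by simp
    next
      case 2
      have "{k. i < k \<and> k < j \<and> u i < u k \<and> u k < u j} = insert (Suc i) ?K"
        using 2 j by (auto simp: less_Suc_eq order.order_iff_strict intro: Suc_lessI)
      moreover have "perm_length n ?u1 = Suc (perm_length n u)"
        using perm_length_simple[of i n u] i 2 by simp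
      moreover have "perm_length n (?u2 \<circ> ?s) = Suc (perm_length n ?u2)"
        using i u2 2 by (intro perm_length_simple) auto
      ultimately show ?thesis using IH v fK by simp
    next
      case 3
      have "{k. i < k \<and> k < j \<and> u i < u k \<and> u k < u j} = ?K"
        using 3 by (auto simp: less_Suc_eq order.order_iff_strict) (metis Suc_lessI less_asym)
      moreover have "perm_length n ?u1 = Suc (perm_length n u)"
        using perm_length_simple[of i n u] i 3 Suc.prems(4) by simp
      moreover have "perm_length n ?u2 = Suc (perm_length n (?u2 \<circ> ?s))"
        using i u2 3 by (intro perm_length_simple_down) auto
      ultimately show ?thesis using IH v by simp
    qed
  qed
qed

lemma perm_length_transpose_less_iff:
  assumes "1 \<le> i" "i < j" "j \<le> n" "inj u"
  shows "perm_length n u < perm_length n (u \<circ> transpose i j) \<longleftrightarrow> u i < u j"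
proof (cases "u i < u j")
  case True then show ?thesis using perm_length_transpose[OF assms(1-3) True assms(4)] by simp
next
  case False
  then have "u j < u i" using assms injD[of u i j] by force
  then have A: "(u \<circ> transpose i j) i < (u \<circ> transpose i j) j" by simp
  have B: "inj (u \<circ> transpose i j)" using assms(4) by (intro inj_compose) auto
  have C: "u \<circ> transpose i j \<circ> transpose i j = u" by (simp add: comp_assoc)
  have "perm_length n (u \<circ> transpose i j) < perm_length n u"
    using perm_length_transpose[OF assms(1-3) A B, unfolded C] by linarith
  then show ?thesis using False by simp
qed

lemma permutes_transpose_interval:
  assumes "1 \<le> i" "i < j" "j \<le> n" "u permutes {1..n::nat}"
  shows "u \<circ> transpose i j permutes {1..n}"
  using assms by (intro permutes_compose[OF permutes_swap_id]) auto

lemma bruhat_step_iff: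
  "bruhat_step n u v \<longleftrightarrow> u permutes {1..n} \<and>
     (\<exists>i j. 1 \<le> i \<and> i < j \<and> j \<le> n \<and> u i < u j \<and> v = u \<circ> transpose i j)"
  unfolding bruhat_step_def sym_group_carrier
  using perm_length_transpose_less_iff permutes_inj by blast

lemma bruhat_step_down_iff:
  "bruhat_step n u v \<longleftrightarrow> v permutes {1..n} \<and>
     (\<exists>i j. 1 \<le> i \<and> i < j \<and> j \<le> n \<and> v j < v i \<and> u = v \<circ> transpose i j)" (is "?L \<longleftrightarrow> ?R")
proof
  assume ?L
  then obtain i j where *: "u permutes {1..n}" "1 \<le> i" "i < j" "j \<le> n" "u i < u j" "v = u \<circ> transpose i j"
    unfolding bruhat_step_iff by blast
  have "v permutes {1..n}" using permutes_transpose_interval * by simp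
  moreover have "v j < v i" "u = v \<circ> transpose i j" using * by (auto simp: comp_assoc)
  ultimately show ?R using * by blast
next
  assume ?R
  then obtain i j where *: "v permutes {1..n}" "1 \<le> i" "i < j" "j \<le> n" "v j < v i" "u = v \<circ> transpose i j"
    by blast
  have "u permutes {1..n}" using permutes_transpose_interval * by simp
  moreover have "u i < u j" "v = u \<circ> transpose i j" using * by (auto simp: comp_assoc)
  ultimately show ?L unfolding bruhat_step_iff using * by blast
qed

section \<open>Gradedness of Bruhat order by length\<close>

definition unit_step :: "nat \<Rightarrow> (nat \<Rightarrow> nat) \<Rightarrow> (nat \<Rightarrow> nat) \<Rightarrow> bool" where
  "unit_step n u v \<longleftrightarrow> bruhat_step n u v \<and> perm_length n v = Suc (perm_length n u)"

text \<open>If some \<open>k\<close> between \<open>i\<close> and \<open>j\<close> has an intermediate value, the three values are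
  reversed by \<open>abc \<rightarrow> bac \<rightarrow> bca \<rightarrow> cba\<close>, each time exchanging closer positions.\<close>
lemma unit_chain_transpose:
  assumes "u permutes {1..n}" "1 \<le> i" "i < j" "j \<le> n" "u i < u j"
  shows "(unit_step n)\<^sup>+\<^sup>+ u (u \<circ> transpose i j)"
  using assms
proof (induction "j - i" arbitrary: i j u rule: less_induct)
  case less
  let ?K = "{k. i < k \<and> k < j \<and> u i < u k \<and> u k < u j}"
  show ?case
  proof (cases "?K = {}")
    case True
    then have "perm_length n (u \<circ> transpose i j) = Suc (perm_length n u)"
      using perm_length_transpose[of i j n u] less.prems permutes_inj[OF less.prems(1)]
      by (metis card.empty Suc_eq_plus1 mult_0_right add_0_right)
    moreover have "bruhat_step n u (u \<circ> transpose i j)"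
      unfolding bruhat_step_iff using less.prems by blast
    ultimately show ?thesis unfolding unit_step_def by auto
  next
    case False
    then obtain k where k: "i < k" "k < j" "u i < u k" "u k < u j" by blast
    let ?u1 = "u \<circ> transpose i k" and ?u2 = "u \<circ> transpose i k \<circ> transpose k j"
    have p1: "?u1 permutes {1..n}" using permutes_transpose_interval[of i k n u] k less.prems by simp
    have p2: "?u2 permutes {1..n}" using permutes_transpose_interval[OF _ _ _ p1, of k j] k less.prems by simp
    have 1: "(unit_step n)\<^sup>+\<^sup>+ u ?u1" using k less.prems by (intro less.hyps) auto
    have 2: "(unit_step n)\<^sup>+\<^sup>+ ?u1 ?u2" using k less.prems p1 by (intro less.hyps) auto
    have 3: "(unit_step n)\<^sup>+\<^sup>+ ?u2 (?u2 \<circ> transpose i k)"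
      using k less.prems p2 by (intro less.hyps) auto
    have 4: "?u2 \<circ> transpose i k = u \<circ> transpose i j"
      using k by (auto simp: fun_eq_iff Transposition.transpose_def)
    show ?thesis using tranclp_trans[OF 1 tranclp_trans[OF 2 3]] unfolding 4 .
  qed
qed

text \<open>Each step refines into steps of length one by \<open>unit_chain_transpose\<close>. This
  is gradedness, and it makes covers recognisable by their lengths.\<close>

lemma bruhat_less_unit_chain: "bruhat_less n u v \<longleftrightarrow> (unit_step n)\<^sup>+\<^sup>+ u v"
proof
  assume "bruhat_less n u v"
  then show "(unit_step n)\<^sup>+\<^sup>+ u v" unfolding bruhat_less_def
  proof (induction rule: tranclp_induct)
    case (base v) then show ?case unfolding bruhat_step_iff using unit_chain_transpose by blast
  next
    case (step v z)
    then have "(unit_step n)\<^sup>+\<^sup>+ v z" unfolding bruhat_step_iff using unit_chain_transpose by blast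
    with step show ?case by (meson tranclp_trans)
  qed
next
  assume "(unit_step n)\<^sup>+\<^sup>+ u v"
  then show "bruhat_less n u v" unfolding bruhat_less_def
    by (induction rule: tranclp_induct) (auto simp: unit_step_def intro: tranclp.trancl_into_trancl)
qed

lemma bruhat_step_permutes:
  "bruhat_step n u v \<Longrightarrow> u permutes {1..n} \<and> v permutes {1..n}"
  using bruhat_step_down_iff bruhat_step_iff by blast

lemma bruhat_less_permutes:
  assumes "bruhat_less n u v" shows "u permutes {1..n}" "v permutes {1..n}"
  using assms unfolding bruhat_less_def
  by (induction rule: tranclp_induct) (auto dest: bruhat_step_permutes)

lemma bruhat_less_length: "bruhat_less n u v \<Longrightarrow> perm_length n u < perm_length n v"
  unfolding bruhat_less_def
  by (induction rule: tranclp_induct) (auto simp: bruhat_step_def)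

lemma bruhat_less_trans: "bruhat_less n u v \<Longrightarrow> bruhat_less n v z \<Longrightarrow> bruhat_less n u z"
  unfolding bruhat_less_def by (rule tranclp_trans)

lemma bruhat_step_less: "bruhat_step n u v \<Longrightarrow> bruhat_less n u v"
  unfolding bruhat_less_def by auto

lemma bruhat_less_unit_step:
  assumes "bruhat_less n u v" "perm_length n v \<le> Suc (perm_length n u)"
  shows "unit_step n u v"
proof -
  obtain z where z: "unit_step n u z" "(unit_step n)\<^sup>*\<^sup>* z v"
    using tranclpD[OF assms(1)[unfolded bruhat_less_unit_chain]] by blast
  have "z = v"
  proof (rule ccontr)
    assume "z \<noteq> v"
    then have "bruhat_less n z v" using z(2) unfolding bruhat_less_unit_chain by (metis rtranclpD)
    then show False using bruhat_less_length[of n z v] z(1) assms(2) unfolding unit_step_def by simp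
  qed
  then show ?thesis using z by simp
qed

lemma unit_step_less: "unit_step n u v \<Longrightarrow> bruhat_less n u v"
  unfolding unit_step_def by (simp add: bruhat_step_less)

lemma bruhat_covers_iff_unit_step: "bruhat_covers n u v \<longleftrightarrow> unit_step n u v"
proof
  assume c: "bruhat_covers n u v"
  then have "(unit_step n)\<^sup>+\<^sup>+ u v" unfolding bruhat_covers_def bruhat_less_unit_chain by blast
  from tranclpD[OF this] obtain z where z: "unit_step n u z" "(unit_step n)\<^sup>*\<^sup>* z v" by blast
  have "z = v"
  proof (rule ccontr)
    assume "z \<noteq> v"
    then have "bruhat_less n z v" using z(2) unfolding bruhat_less_unit_chain by (metis rtranclpD)
    then show False using c unit_step_less[OF z(1)] unfolding bruhat_covers_def by blast
  qed
  then show "unit_step n u v" using z by simp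
next
  assume u: "unit_step n u v"
  show "bruhat_covers n u v" unfolding bruhat_covers_def
  proof (intro conjI notI)
    show "bruhat_less n u v" using u by (rule unit_step_less)
    assume "\<exists>z. bruhat_less n u z \<and> bruhat_less n z v"
    then obtain z where "bruhat_less n u z" "bruhat_less n z v" by blast
    then show False using bruhat_less_length[of n u z] bruhat_less_length[of n z v] u
      unfolding unit_step_def by simp
  qed
qed

text \<open>The count in \<open>perm_length_transpose\<close> vanishes exactly when no position
  between i and j carries an intermediate value. In this form coatoms of [e, w] can be read off from
  the values of w.\<close>

lemma unit_step_iff:
  "unit_step n u v \<longleftrightarrow> v permutes {1..n} \<and>
     (\<exists>i j. 1 \<le> i \<and> i < j \<and> j \<le> n \<and> v j < v i \<and>
        \<not> (\<exists>k. i < k \<and> k < j \<and> v j < v k \<and> v k < v i) \<and> u = v \<circ> transpose i j)" (is "?L \<longleftrightarrow> ?R")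
proof -
  have *: "perm_length n v = Suc (perm_length n (v \<circ> transpose i j)) \<longleftrightarrow>
      \<not> (\<exists>k. i < k \<and> k < j \<and> v j < v k \<and> v k < v i)"
    if "v permutes {1..n}" "1 \<le> i" "i < j" "j \<le> n" "v j < v i" for i j
  proof -
    let ?u = "v \<circ> transpose i j"
    let ?K = "{k. i < k \<and> k < j \<and> ?u i < ?u k \<and> ?u k < ?u j}"
    have "?K = {k. i < k \<and> k < j \<and> v j < v k \<and> v k < v i}" by auto
    moreover have "perm_length n (?u \<circ> transpose i j) = perm_length n ?u + 1 + 2 * card ?K"
      using that permutes_inj[OF that(1)] by (intro perm_length_transpose) (auto simp: inj_compose)
    moreover have "finite {k. i < k \<and> k < j \<and> v j < v k \<and> v k < v i}"
      by (rule finite_subset[of _ "{..j}"]) auto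
    ultimately show ?thesis by (simp add: comp_assoc card_eq_0_iff)
  qed
  show ?thesis unfolding unit_step_def bruhat_step_down_iff using * by blast
qed

lemma perm_length_0_iff:
  assumes "u permutes {1..n}"
  shows "perm_length n u = 0 \<longleftrightarrow> u = id"
proof
  assume "perm_length n u = 0"
  then have "inversions n u = {}" unfolding perm_length_def using finite_inversions by simp
  then have "\<not> u j < u i" if "1 \<le> i" "i < j" "j \<le> n" for i j using that by blast
  moreover have "u i \<noteq> u j" if "i < j" for i j using that injD[OF permutes_inj[OF assms], of i j] by auto
  ultimately have sm: "u i < u j" if "1 \<le> i" "i < j" "j \<le> n" for i j
    using that by (meson linorder_neqE_nat)
  have ge: "i \<le> u i" if "1 \<le> i" "i \<le> n" for i using that
  proof (induction i)
    case (Suc i)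
    show ?case
    proof (cases "i = 0")
      case True then show ?thesis using permutes_in_image[OF assms, of 1] Suc.prems by auto
    next
      case False then show ?thesis using Suc sm[of i "Suc i"] by auto
    qed
  qed auto
  have le: "u i \<le> i" if "i \<in> {1..n}" for i using that
  proof (induction "n - i" arbitrary: i)
    case 0 then show ?case using permutes_in_image[OF assms, of i] by auto
  next
    case (Suc d)
    then have "u (Suc i) \<le> Suc i" "u i < u (Suc i)" using sm by auto
    then show ?case by simp
  qed
  show "u = id"
  proof
    fix i show "u i = id i"
      using ge[of i] le[of i] permutes_not_in[OF assms, of i] by (cases "i \<in> {1..n}") auto
  qed
next
  assume "u = id"
  then have "inversions n u = {}" by auto
  then show "perm_length n u = 0" unfolding perm_length_def by (simp only: card.empty)
qed

lemma exists_descent: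
  assumes "u permutes {1..n}" "u \<noteq> id"
  shows "\<exists>k. 1 \<le> k \<and> k < n \<and> u (Suc k) < u k"
proof (rule ccontr)
  assume neg: "\<not> ?thesis"
  have mono: "u i \<le> u j" if "1 \<le> i" "i \<le> j" "j \<le> n" for i j using that(2,1,3)
  proof (induction rule: dec_induct)
    case (step k) then show ?case using neg by (meson Suc_leD Suc_le_lessD leI le_trans not_less)
  qed simp
  have "inversions n u = {}"
  proof -
    have "\<not> u j < u i" if "1 \<le> i" "i < j" "j \<le> n" for i j
      using mono[of i j] that by simp
    then show ?thesis by blast
  qed
  then have "perm_length n u = 0" unfolding perm_length_def by (simp only: card.empty)
  then show False using assms perm_length_0_iff by simp
qed

lemma bruhat_less_id:
  assumes "u permutes {1..n}" "u \<noteq> id"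
  shows "bruhat_less n id u"
  using assms
proof (induction "perm_length n u" arbitrary: u rule: less_induct)
  case less
  obtain k where k: "1 \<le> k" "k < n" "u (Suc k) < u k" using exists_descent less.prems by blast
  let ?v = "u \<circ> transpose k (Suc k)"
  have s: "bruhat_step n ?v u" unfolding bruhat_step_down_iff using k less.prems
    by (metis Suc_leI lessI)
  show ?case
  proof (cases "?v = id")
    case True then show ?thesis using bruhat_step_less[OF s] by metis
  next
    case False
    then have "bruhat_less n id ?v"
      using s bruhat_step_permutes[OF s] bruhat_less_length[OF bruhat_step_less[OF s]]
      by (intro less.hyps) auto
    then show ?thesis using bruhat_step_less[OF s] bruhat_less_trans by blast
  qed
qed

lemma lower_interval_iff:
  assumes "w permutes {1..n}"
  shows "u \<in> lower_interval n w \<longleftrightarrow> (bruhat_step n)\<^sup>*\<^sup>* u w"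
proof -
  have "bruhat_le n u w \<longleftrightarrow> (bruhat_step n)\<^sup>*\<^sup>* u w"
    unfolding bruhat_le_def bruhat_less_def by (metis rtranclpD rtranclp.rtrancl_refl tranclp_into_rtranclp)
  moreover have "u permutes {1..n}" if "bruhat_le n u w"
    using that assms bruhat_less_permutes unfolding bruhat_le_def by blast
  ultimately show ?thesis unfolding lower_interval_def sym_group_carrier by blast
qed

lemma lower_interval_less:
  "u \<in> lower_interval n w \<longleftrightarrow> u permutes {1..n} \<and> (u = w \<or> bruhat_less n u w)"
  unfolding lower_interval_def bruhat_le_def sym_group_carrier by blast

section \<open>Parabolic subgroups\<close>

text \<open>The generator s_k links the points k and k + 1, so i and j are in one orbit of W_J
  exactly when J contains every k from the smaller point up to, but excluding, the larger
  one.\<close>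

definition same_block :: "nat set \<Rightarrow> nat \<Rightarrow> nat \<Rightarrow> bool" where
  "same_block J i j \<longleftrightarrow> {min i j..<max i j} \<subseteq> J"

lemma same_block_refl [simp]: "same_block J i i"
  by (simp add: same_block_def)

lemma same_block_sym: "same_block J i j \<longleftrightarrow> same_block J j i"
  by (simp add: same_block_def min.commute max.commute)

lemma same_block_less: "i < j \<Longrightarrow> same_block J i j \<longleftrightarrow> {i..<j} \<subseteq> J"
  by (simp add: same_block_def)

lemma same_block_trans:
  assumes "same_block J i j" "same_block J j k"
  shows "same_block J i k"
proof -
  have "{min i k..<max i k} \<subseteq> {min i j..<max i j} \<union> {min j k..<max j k}" by auto
  then show ?thesis using assms unfolding same_block_def by blast
qed

lemma same_block_mono: "J \<subseteq> J' \<Longrightarrow> same_block J i j \<Longrightarrow> same_block J' i j"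
  unfolding same_block_def by blast

lemma same_block_Int: "same_block (A \<inter> B) i j \<longleftrightarrow> same_block A i j \<and> same_block B i j"
  unfolding same_block_def by blast

lemma same_block_empty [simp]: "same_block {} i j \<longleftrightarrow> i = j"
  unfolding same_block_def by auto

lemma same_block_endpoint:
  assumes "same_block J i j" "i \<noteq> j"
  shows "i \<in> J \<or> (0 < i \<and> i - 1 \<in> J)"
proof (cases "i < j")
  case True then show ?thesis using assms by (auto simp: same_block_def)
next
  case False
  then have "i - 1 \<in> {min i j..<max i j}" "0 < i" using assms by auto
  then show ?thesis using assms(1) unfolding same_block_def by blast
qed

text \<open>This is W_J, described as the permutations that keep every point in its orbit. It does
  not mention n, so no range has to be carried through products;
  \<open>parabolic_eq_block_group\<close> makes the link.\<close>

definition block_group :: "nat set \<Rightarrow> (nat \<Rightarrow> nat) set" where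
  "block_group J = {u. bij u \<and> (\<forall>i. same_block J i (u i))}"

lemma block_groupD: "u \<in> block_group J \<Longrightarrow> bij u" "u \<in> block_group J \<Longrightarrow> same_block J i (u i)"
  unfolding block_group_def by auto

lemma block_group_id [simp]: "id \<in> block_group J"
  unfolding block_group_def by simp

lemma block_group_comp: "u \<in> block_group J \<Longrightarrow> v \<in> block_group J \<Longrightarrow> u \<circ> v \<in> block_group J"
  unfolding block_group_def by (auto intro: bij_comp) (metis same_block_trans)

lemma block_group_inv:
  assumes "u \<in> block_group J" shows "inv' u \<in> block_group J"
proof -
  have "same_block J i (inv' u i)" for i
  proof -
    have "u (inv' u i) = i" using block_groupD(1)[OF assms] by (simp add: bij_is_surj surj_f_inv_f)
    then show ?thesis using block_groupD(2)[OF assms, of "inv' u i"] same_block_sym by simp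
  qed
  then show ?thesis using assms unfolding block_group_def by (simp add: bij_imp_bij_inv)
qed

lemma block_group_mono: "J \<subseteq> J' \<Longrightarrow> block_group J \<subseteq> block_group J'"
  unfolding block_group_def using same_block_mono by blast

lemma block_group_Int: "u \<in> block_group A \<Longrightarrow> u \<in> block_group B \<Longrightarrow> u \<in> block_group (A \<inter> B)"
  unfolding block_group_def same_block_Int by blast

lemma block_group_empty: "u \<in> block_group {} \<Longrightarrow> u = id"
  unfolding block_group_def by (auto simp: fun_eq_iff)

lemma same_block_image_iff:
  assumes "u \<in> block_group J"
  shows "same_block J (u i) (u j) \<longleftrightarrow> same_block J i j"
  using block_groupD(2)[OF assms] same_block_trans same_block_sym by metis

text \<open>Points of different blocks are separated by some k outside J, and an element of W_J
  cannot carry a point across such a gap.\<close>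

lemma block_group_less_iff:
  assumes "u \<in> block_group J" "\<not> same_block J i j"
  shows "u i < u j \<longleftrightarrow> i < j"
proof -
  have *: "u i < u j" if ij: "i < j" "\<not> same_block J i j" for i j
  proof -
    obtain k where k: "i \<le> k" "k < j" "k \<notin> J"
      using ij(2) unfolding same_block_less[OF ij(1)] by (meson atLeastLessThan_iff subsetI)
    have "u i \<le> k"
      using block_groupD(2)[OF assms(1), of i] k by (cases "k < u i") (auto simp: same_block_def)
    moreover have "k < u j"
      using block_groupD(2)[OF assms(1), of j] k by (cases "u j \<le> k") (auto simp: same_block_def)
    ultimately show ?thesis by simp
  qed
  show ?thesis using *[of i j] *[of j i] assms(2) same_block_sym by (metis less_asym linorder_neqE_nat same_block_refl)
qed

lemma transpose_block_group:
  assumes "same_block J i j" shows "transpose i j \<in> block_group J"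
proof -
  have "same_block J k (transpose i j k)" for k
    using assms same_block_sym by (cases "k = i"; cases "k = j") auto
  then show ?thesis unfolding block_group_def by simp
qed

lemma same_block_range:
  assumes "J \<subseteq> {1..<n}" "same_block J i j" "i \<noteq> j" shows "i \<in> {1..n}"
  using same_block_endpoint[OF assms(2,3)]
proof
  assume "0 < i \<and> i - 1 \<in> J"
  then have "0 < i" "i - 1 \<in> {1..<n}" using assms(1) by blast+
  then show ?thesis by auto
qed (use assms(1) in auto)

lemma block_group_permutes:
  assumes "J \<subseteq> {1..<n}" "u \<in> block_group J" shows "u permutes {1..n}"
  unfolding permutes_def
proof (intro conjI allI impI)
  fix i assume "i \<notin> {1..n}"
  then show "u i = i" using same_block_range[OF assms(1), of i "u i"] block_groupD(2)[OF assms(2)] by metis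
next
  fix j show "\<exists>!i. u i = j" using block_groupD(1)[OF assms(2)] by (metis bij_pointE)
qed

text \<open>Generators keep points in their blocks. Conversely, elements are stripped of descents: a
  descent k must occur inside one block by \<open>block_group_less_iff\<close>, so k is in J and s_k
  may be split off.\<close>

lemma parabolic_eq_block_group:
  assumes "J \<subseteq> {1..<n}" shows "parabolic n J = block_group J"
proof (intro equalityI subsetI)
  fix u assume "u \<in> parabolic n J"
  then have "u \<in> generate (sym_group n) (simple_refl ` J)" unfolding parabolic_def .
  moreover have r: "simple_refl j \<in> block_group J" if "j \<in> J" for j
    unfolding simple_refl_def using that by (intro transpose_block_group) (auto simp: same_block_less)
  ultimately show "u \<in> block_group J"
  proof (induction rule: generate.induct)
    case one then show ?case by (simp only: sym_group_one block_group_id)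
  next
    case (incl h) then show ?case using r by auto
  next
    case (inv h)
    then have h: "h \<in> block_group J" using r by auto
    have "h \<otimes>\<^bsub>sym_group n\<^esub> inv' h = \<one>\<^bsub>sym_group n\<^esub>"
      using block_groupD(1)[OF h] by (simp add: sym_group_mult sym_group_one bij_is_surj surj_iff[symmetric])
    moreover have "h \<in> carrier (sym_group n)" "inv' h \<in> carrier (sym_group n)"
      using block_group_permutes[OF assms] h block_group_inv[OF h] by (auto simp: sym_group_carrier)
    ultimately have "inv\<^bsub>sym_group n\<^esub> h = inv' h"
      using group.inv_equality[OF sym_group_is_group] group.inv_comm[OF sym_group_is_group] by metis
    then show ?case using block_group_inv[OF h] by simp
  next
    case (eng h1 h2) then show ?case unfolding sym_group_mult by (intro block_group_comp) simp_all
  qed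
next
  fix u assume "u \<in> block_group J"
  then show "u \<in> parabolic n J"
  proof (induction "perm_length n u" arbitrary: u rule: less_induct)
    case less
    have p: "u permutes {1..n}" using block_group_permutes[OF assms less.prems] .
    show ?case
    proof (cases "u = id")
      case True then show ?thesis unfolding parabolic_def using generate.one[of "sym_group n"] by (simp add: sym_group_one)
    next
      case False
      then obtain k where k: "1 \<le> k" "k < n" "u (Suc k) < u k" using exists_descent p by blast
      have "same_block J k (Suc k)"
        using block_group_less_iff[OF less.prems, of k "Suc k"] k by auto
      then have kJ: "k \<in> J" by (auto simp: same_block_less)
      let ?s = "transpose k (Suc k)"
      have "u \<circ> ?s \<in> block_group J"
        using less.prems kJ by (intro block_group_comp transpose_block_group) (auto simp: same_block_less)
      then have "u \<circ> ?s \<in> parabolic n J" using perm_length_simple_down[OF k] by (intro less.hyps) auto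
      moreover have "simple_refl k \<in> parabolic n J"
        unfolding parabolic_def using kJ by (auto intro: generate.incl)
      ultimately have "(u \<circ> ?s) \<circ> ?s \<in> parabolic n J"
        unfolding parabolic_def simple_refl_def sym_group_mult[symmetric, of n] by (auto intro: generate.eng)
      then show ?thesis by (simp add: comp_assoc)
    qed
  qed
qed

subsection \<open>Longest elements\<close>

text \<open>Longest elements are handled through the reversal of every block. Maximality of the
  length depends on n and on counting, whereas this form is local and passes directly to products
  over separated sets of generators.\<close>

definition is_longest :: "nat set \<Rightarrow> (nat \<Rightarrow> nat) \<Rightarrow> bool" where
  "is_longest J u \<longleftrightarrow> u \<in> block_group J \<and> (\<forall>i j. i < j \<longrightarrow> same_block J i j \<longrightarrow> u j < u i)"

lemma is_longest_less_iff:
  assumes "is_longest J u" "same_block J i j"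
  shows "u i < u j \<longleftrightarrow> j < i"
  using assms same_block_sym unfolding is_longest_def by (metis less_asym less_irrefl linorder_neqE_nat)

lemma bij_strict_mono_nat_id:
  fixes z :: "nat \<Rightarrow> nat"
  assumes "bij z" "\<And>a b. a < b \<Longrightarrow> z a < z b"
  shows "z = id"
proof
  fix i
  have "strict_mono z" using assms(2) by (simp add: strict_mono_def)
  then have le: "k \<le> z k" for k by (rule strict_mono_imp_increasing)
  have "strict_mono (inv' z)"
    unfolding strict_mono_def using assms
    by (metis bij_inv_eq_iff linorder_neqE_nat order_less_asym)
  then have "z i \<le> inv' z (z i)" by (rule strict_mono_imp_increasing)
  also have "inv' z (z i) = i" using assms(1) by (simp add: bij_is_inj)
  finally show "z i = id i" using le[of i] by simp
qed

text \<open>Inside a block both u and v reverse the order, across blocks neither changes it; hence u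
  times the inverse of v is an increasing bijection of the naturals.\<close>

lemma is_longest_unique:
  assumes u: "is_longest J u" and v: "is_longest J v"
  shows "u = v"
proof -
  have uv: "u \<in> block_group J" "v \<in> block_group J" using u v unfolding is_longest_def by auto
  let ?z = "u \<circ> inv' v"
  have z: "?z \<in> block_group J" using uv by (intro block_group_comp block_group_inv)
  have "?z a < ?z b" if "a < b" for a b
  proof (cases "same_block J a b")
    case False then show ?thesis using block_group_less_iff[OF z] that by blast
  next
    case True
    let ?i = "inv' v a" and ?j = "inv' v b"
    have ij: "v ?i = a" "v ?j = b" using block_groupD(1)[OF uv(2)] by (auto simp: bij_is_surj surj_f_inv_f)
    have s: "same_block J ?i ?j" using True same_block_image_iff[OF uv(2), of ?i ?j] ij by simp
    then have "?j < ?i" using is_longest_less_iff[OF v s] ij that by simp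
    then show ?thesis using is_longest_less_iff[OF u s] by simp
  qed
  then have "?z = id" using bij_strict_mono_nat_id block_groupD(1)[OF z] by blast
  then have "?z \<circ> v = v" by simp
  moreover have "?z \<circ> v = u" using block_groupD(1)[OF uv(2)] by (simp add: comp_assoc bij_is_inj)
  ultimately show ?thesis by simp
qed

lemma is_longest_involution:
  assumes u: "is_longest J u" shows "u \<circ> u = id"
proof -
  have b: "u \<in> block_group J" using u unfolding is_longest_def by auto
  have "inv' u j < inv' u i" if "i < j" "same_block J i j" for i j
  proof -
    have ij: "u (inv' u i) = i" "u (inv' u j) = j" using block_groupD(1)[OF b] by (auto simp: bij_is_surj surj_f_inv_f)
    have "same_block J (inv' u i) (inv' u j)" using same_block_image_iff[OF b] ij that(2) by metis
    from is_longest_less_iff[OF u this] show ?thesis using ij that by simp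
  qed
  then have "is_longest J (inv' u)" unfolding is_longest_def using block_group_inv[OF b] by blast
  then have "inv' u = u" using is_longest_unique u by blast
  then show ?thesis using block_groupD(1)[OF b] by (metis bij_is_surj surj_iff)
qed

text \<open>If a pair in one block were not inverted, composing with its transposition would stay in
  the group and increase the length.\<close>

lemma max_length_is_longest:
  assumes J: "J \<subseteq> {1..<n}" and u: "u \<in> block_group J"
    and max: "\<And>v. v \<in> block_group J \<Longrightarrow> perm_length n v \<le> perm_length n u"
  shows "is_longest J u"
  unfolding is_longest_def
proof (intro conjI allI impI)
  fix i j assume ij: "i < j" "same_block J i j"
  have r: "1 \<le> i" "j \<le> n"
    using same_block_range[OF J ij(2)] same_block_range[OF J, of j i] ij same_block_sym[of J i j] by auto
  have "u \<circ> transpose i j \<in> block_group J" using u ij by (intro block_group_comp transpose_block_group)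
  then have "\<not> u i < u j"
    using max perm_length_transpose_less_iff[OF r(1) ij(1) r(2) bij_is_inj[OF block_groupD(1)[OF u]]]
    by (meson leD)
  moreover have "u i \<noteq> u j" using ij bij_is_inj[OF block_groupD(1)[OF u]] by (auto dest: injD)
  ultimately show "u j < u i" by simp
qed (rule u)

lemma longest_is_longest:
  assumes J: "J \<subseteq> {1..<n}" shows "is_longest J (longest n J)"
proof -
  let ?P = "\<lambda>u. u \<in> parabolic n J \<and> (\<forall>v\<in>parabolic n J. perm_length n v \<le> perm_length n u)"
  have fin: "finite (block_group J)"
    using block_group_permutes[OF J]
    by (intro finite_subset[OF _ finite_permutations[of "{1..n}"]]) auto
  have "\<exists>u\<in>block_group J. \<forall>v\<in>block_group J. perm_length n v \<le> perm_length n u"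
  proof -
    have f: "finite (perm_length n ` block_group J)" "perm_length n ` block_group J \<noteq> {}"
      using fin block_group_id by blast+
    from Max_in[OF f] obtain u where "Max (perm_length n ` block_group J) = perm_length n u" "u \<in> block_group J"
      by (rule imageE)
    then show ?thesis using f by (metis Max_ge imageI)
  qed
  then obtain u where u: "?P u" using parabolic_eq_block_group[OF J] by blast
  have "v = u" if "?P v" for v
    by (rule is_longest_unique; rule max_length_is_longest[OF J])
      (use that u in \<open>unfold parabolic_eq_block_group[OF J], blast+\<close>)
  then have "?P (longest n J)" unfolding longest_def by (rule theI[of ?P, OF u])
  then show ?thesis using max_length_is_longest[OF J] unfolding parabolic_eq_block_group[OF J] by blast
qed

lemma longest_eqI: "J \<subseteq> {1..<n} \<Longrightarrow> is_longest J u \<Longrightarrow> longest n J = u"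
  using longest_is_longest is_longest_unique by blast

lemma longest_block_group: "J \<subseteq> {1..<n} \<Longrightarrow> longest n J \<in> block_group J"
  using longest_is_longest is_longest_def by blast

lemma longest_involution: "J \<subseteq> {1..<n} \<Longrightarrow> longest n J \<circ> longest n J = id"
  using longest_is_longest is_longest_involution by blast

lemma is_longest_empty: "is_longest {} id"
  unfolding is_longest_def by simp

subsection \<open>Commuting elements\<close>

text \<open>The condition under which W_A and W_B commute and the longest element for the union is
  the product of the two longest elements.\<close>

definition far :: "nat set \<Rightarrow> nat set \<Rightarrow> bool" where
  "far A B \<longleftrightarrow> (\<forall>a\<in>A. \<forall>b\<in>B. a \<noteq> b \<and> \<not> dynkin_adj a b)"

lemma far_same_block:
  assumes "far A B" "same_block A i j" "i \<noteq> j" "same_block B i k"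
  shows "k = i"
proof (rule ccontr)
  assume "k \<noteq> i"
  then show False
    using same_block_endpoint[OF assms(2,3)] same_block_endpoint[OF assms(4)] assms(1)
    unfolding far_def dynkin_adj_def by (metis Suc_pred' Suc_eq_plus1)
qed

lemma far_commute:
  assumes "far A B" "u \<in> block_group A" "v \<in> block_group B"
  shows "u \<circ> v = v \<circ> u"
proof
  fix i
  have v: "v k = k" if "same_block A k l" "k \<noteq> l" for k l
    using far_same_block[OF assms(1) that block_groupD(2)[OF assms(3)]] .
  have u: "u k = k" if "same_block B k l" "k \<noteq> l" for k l
    using far_same_block[OF assms(1) block_groupD(2)[OF assms(2)] _ that(1)] that(2) by metis
  have sv: "same_block B i (v i)" and su: "same_block A i (u i)" using assms block_groupD by auto
  show "(u \<circ> v) i = (v \<circ> u) i"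
  proof (cases "v i = i")
    case False
    then have "u i = i" "u (v i) = v i" using u[of i "v i"] u[of "v i" i] sv same_block_sym by auto
    then show ?thesis by simp
  next
    case True
    have "v (u i) = u i" using v[of "u i" i] su same_block_sym True by (cases "u i = i") auto
    then show ?thesis using True by simp
  qed
qed

text \<open>Without adjacent generators a block has at most two points.\<close>

lemma totally_disconnected_block:
  assumes "totally_disconnected K" "same_block K i j" "same_block K i k" "j \<noteq> i" "k \<noteq> i"
  shows "j = k"
proof -
  have *: "j = Suc i \<and> i \<in> K" if "same_block K i j" "i < j" for i j
  proof -
    have "{i..<j} \<subseteq> K" using that by (simp add: same_block_less)
    moreover have "\<not> (Suc i \<in> K \<and> i \<in> K)"
      using assms(1) unfolding totally_disconnected_def dynkin_adj_def by auto
    ultimately show ?thesis using that(2) by (metis Suc_lessI atLeastLessThan_iff le_eq_less_or_eq less_Suc_eq subsetD)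
  qed
  have no: "\<not> (Suc i \<in> K \<and> i \<in> K)" for i
    using assms(1) unfolding totally_disconnected_def dynkin_adj_def by auto
  consider "i < j" "i < k" | "j < i" "k < i" | "i < j" "k < i" | "j < i" "i < k" using assms by linarith
  then show ?thesis
  proof cases
    case 1 then show ?thesis using *[of i j] *[of i k] assms by simp
  next
    case 2 then show ?thesis using *[of j i] *[of k i] assms same_block_sym by (metis Suc_inject)
  next
    case 3 then show ?thesis using *[of i j] *[of k i] assms no same_block_sym by metis
  next
    case 4 then show ?thesis using *[of i k] *[of j i] assms no same_block_sym by metis
  qed
qed

text \<open>W_K is a product of groups of order two acting on disjoint pairs: where both elements
  move a point, they move it to the same partner.\<close>

lemma totally_disconnected_commute:
  assumes K: "totally_disconnected K" and u: "u \<in> block_group K" and v: "v \<in> block_group K"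
  shows "u \<circ> v = v \<circ> u"
proof
  fix i
  note bd = totally_disconnected_block[OF K]
  have inj: "inj u" "inj v" using u v block_groupD(1) bij_is_inj by auto
  have s: "same_block K k (u k)" "same_block K k (v k)" for k using u v block_groupD by auto
  have flip: "f (f i) = i" if "f \<in> block_group K" "f i \<noteq> i" for f
  proof (rule ccontr)
    assume ne: "f (f i) \<noteq> i"
    have "f (f i) \<noteq> f i" using that bij_is_inj[OF block_groupD(1)[OF that(1)]] by (auto dest: injD)
    then show False
      using bd[of "f i" "f (f i)" i] block_groupD(2)[OF that(1)] same_block_sym that(2) ne by metis
  qed
  show "(u \<circ> v) i = (v \<circ> u) i"
  proof (cases "u i = i \<or> v i = i")
    case False
    then have "u i = v i" using bd[of i "u i" "v i"] s by simp
    then show ?thesis using flip[OF u] flip[OF v] False by simp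
  next
    case True
    have *: "f (g i) = g (f i)" if "f \<in> block_group K" "g \<in> block_group K" "f i = i" for f g
    proof (cases "g i = i")
      case False
      have "f (g i) \<noteq> i" using bij_is_inj[OF block_groupD(1)[OF that(1)]] that(3) False by (metis injD)
      then have "f (g i) = g i"
        using bd[of "g i" "f (g i)" i] block_groupD(2)[OF that(1)] block_groupD(2)[OF that(2)] same_block_sym False by metis
      then show ?thesis using that by simp
    qed (use that in simp)
    show ?thesis using True *[OF u v] *[OF v u] by auto
  qed
qed

text \<open>A run of generators inside A \<union> B cannot change from A to B, since that would need
  adjacent generators. So a nontrivial block belongs to one of the two factors, and the other factor
  fixes it pointwise.\<close>

lemma is_longest_Un_far:
  assumes far: "far A B" and u: "is_longest A u" and v: "is_longest B v"
  shows "is_longest (A \<union> B) (u \<circ> v)"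
proof -
  have b: "u \<in> block_group A" "v \<in> block_group B" using u v unfolding is_longest_def by auto
  have comm: "u \<circ> v = v \<circ> u" by (rule far_commute[OF far b])
  have far': "far B A" using far unfolding far_def dynkin_adj_def by auto
  have one_side: "{i..<j} \<subseteq> A" if "far A B" "{i..<j} \<subseteq> A \<union> B" "i \<in> A" for i j A B
  proof
    fix k assume k: "k \<in> {i..<j}"
    then have "i \<le> k" by simp
    then show "k \<in> A" using k
    proof (induction rule: dec_induct)
      case base then show ?case using that by simp
    next
      case (step m)
      then have "m \<in> A" "Suc m \<in> {i..<j}" by auto
      then have "m \<in> A" "Suc m \<in> A \<union> B" using that(2) by blast+
      then show ?case using that(1) unfolding far_def dynkin_adj_def by auto
    qed
  qed
  show ?thesis unfolding is_longest_def
  proof (intro conjI allI impI)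
    show "u \<circ> v \<in> block_group (A \<union> B)"
      using b block_group_mono[of A "A \<union> B"] block_group_mono[of B "A \<union> B"] by (intro block_group_comp) auto
  next
    fix i j assume ij: "i < j" "same_block (A \<union> B) i j"
    then have sub: "{i..<j} \<subseteq> A \<union> B" by (simp add: same_block_less)
    then consider "i \<in> A" | "i \<in> B" using ij by auto
    then show "(u \<circ> v) j < (u \<circ> v) i"
    proof cases
      case 1
      then have s: "same_block A i j" using one_side[OF far sub] ij by (simp add: same_block_less)
      then have "v i = i" "v j = j"
        using far_same_block[OF far s _ block_groupD(2)[OF b(2)]] far_same_block[OF far _ _ block_groupD(2)[OF b(2)], of j i] ij
          same_block_sym by auto
      then show ?thesis using u s ij unfolding is_longest_def by simp
    next
      case 2
      then have s: "same_block B i j" using one_side[OF far', of i j] sub ij by (simp add: same_block_less Un_commute)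
      then have "u i = i" "u j = j"
        using far_same_block[OF far' s _ block_groupD(2)[OF b(1)]] far_same_block[OF far' _ _ block_groupD(2)[OF b(1)], of j i] ij
          same_block_sym by auto
      then show ?thesis unfolding comm using v s ij unfolding is_longest_def by simp
    qed
  qed
qed

section \<open>Polished elements have self-dual intervals\<close>

text \<open>A duality is the graph of a partial involution that turns each descending step of its
  first argument into an ascending step of the second; its domain is then a lower interval.\<close>
definition duality :: "nat set \<Rightarrow> ((nat \<Rightarrow> nat) \<Rightarrow> (nat \<Rightarrow> nat) \<Rightarrow> bool) \<Rightarrow> bool" where
  "duality S R \<longleftrightarrow>
     (\<forall>v v'. R v v' \<longrightarrow> v \<in> block_group S \<and> R v' v) \<and>
     (\<forall>v v1 v2. R v v1 \<longrightarrow> R v v2 \<longrightarrow> v1 = v2) \<and>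
     (\<forall>v v' i j. R v v' \<longrightarrow> i < j \<longrightarrow> v j < v i \<longrightarrow>
        (\<exists>i' j'. i' < j' \<and> v' i' < v' j' \<and> R (v \<circ> transpose i j) (v' \<circ> transpose i' j')))"

lemma dualityD:
  assumes "duality S R"
  shows "R v v' \<Longrightarrow> v \<in> block_group S" "R v v' \<Longrightarrow> R v' v" "R v v1 \<Longrightarrow> R v v2 \<Longrightarrow> v1 = v2"
    "R v v' \<Longrightarrow> i < j \<Longrightarrow> v j < v i \<Longrightarrow>
       \<exists>i' j'. i' < j' \<and> v' i' < v' j' \<and> R (v \<circ> transpose i j) (v' \<circ> transpose i' j')"
  using assms unfolding duality_def by simp_all

definition block_prod :: "nat \<Rightarrow> nat set \<Rightarrow> nat set \<Rightarrow> nat \<Rightarrow> nat" where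
  "block_prod n J J' = longest n J \<circ> longest n (J \<inter> J') \<circ> longest n J'"

text \<open>A descending transposition of v = x y is absorbed by y if its positions share a
  J'-block, and otherwise by x, where it acts on the points y i and y j. Either way it turns into a
  transposition of the partner of v, and \<open>key\<close> shows that this one ascends.\<close>

lemma duality_block:
  assumes J: "J \<subseteq> {1..<n}" and J': "J' \<subseteq> {1..<n}" and K: "totally_disconnected (J \<inter> J')"
  shows "\<exists>R. duality (J \<union> J') R \<and> R id (block_prod n J J')"
proof -
  define a where "a = longest n J"
  define k where "k = longest n (J \<inter> J')"
  define b where "b = longest n J'"
  have K': "J \<inter> J' \<subseteq> {1..<n}" using J by blast
  have la: "is_longest J a" and lk: "is_longest (J \<inter> J') k" and lb: "is_longest J' b"
    unfolding a_def b_def k_def using J J' K' longest_is_longest by blast+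
  have ba: "a \<in> block_group J" and bk: "k \<in> block_group (J \<inter> J')" and bb: "b \<in> block_group J'"
    using la lk lb unfolding is_longest_def by auto
  have aa: "a (a i) = i" and kk: "k (k i) = i" and bb2: "b (b i) = i" for i
    using is_longest_involution[OF la] is_longest_involution[OF lk] is_longest_involution[OF lb]
    by (auto simp: fun_eq_iff)
  \<comment> \<open>Used for x with c = w0(J) and, with J and J' exchanged, for the inverse of y
    with c = w0(J'). If p and q share an A-block, they form a block of K; then k interchanges them
    and c reverses once more. If not, x, k and c all preserve the order between the blocks.\<close>
  have key: "x p < x q \<longleftrightarrow> c (x (k p)) < c (x (k q))"
    if x: "x \<in> block_group A" and c: "is_longest A c" and pq: "same_block B p q" "p \<noteq> q" and AB: "A \<inter> B = J \<inter> J'"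
    for x c A B p q
  proof (cases "same_block A p q")
    case True
    then have s: "same_block (J \<inter> J') p q" using pq AB same_block_Int by metis
    have sk: "same_block (J \<inter> J') p (k p)" "same_block (J \<inter> J') q (k q)" using block_groupD(2)[OF bk] by auto
    have nk: "k p \<noteq> p" "k q \<noteq> q"
      using s pq is_longest_less_iff[OF lk] totally_disconnected_block[OF K] kk
      by (metis linorder_neqE_nat same_block_sym less_asym sk)+
    have "k p = q"
      using totally_disconnected_block[OF K s sk(1)] nk pq(2) by auto
    moreover then have "k q = p" using kk by metis
    moreover have "same_block A (x q) (x p)" using True same_block_image_iff[OF x] same_block_sym by metis
    ultimately show ?thesis using is_longest_less_iff[OF c] by simp
  next
    case False
    have "same_block A p (k p)" "same_block A q (k q)"
      using block_groupD(2)[OF bk] AB same_block_Int by metis+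
    then have f: "\<not> same_block A (k p) (k q)" using False same_block_trans same_block_sym by metis
    have kA: "k \<in> block_group A" using bk AB block_group_mono[of "J \<inter> J'" A] by blast
    have cA: "c \<circ> x \<circ> k \<in> block_group A" using c x kA unfolding is_longest_def by (intro block_group_comp) auto
    show ?thesis using block_group_less_iff[OF x False] block_group_less_iff[OF cA False] by simp
  qed
  \<comment> \<open>A relation and not a function, because v determines x and y only up to an
    element of W_K.\<close>
  define R where "R v v' \<longleftrightarrow> (\<exists>x\<in>block_group J. \<exists>y\<in>block_group J'. v = x \<circ> y \<and> v' = a \<circ> x \<circ> k \<circ> y \<circ> b)" for v v'
  have kJ: "k \<in> block_group J" "k \<in> block_group J'" using bk block_group_mono[of "J \<inter> J'"] by blast+
  have sym: "R v' v" if R: "R v v'" for v v'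
  proof -
    obtain x y where xy: "x \<in> block_group J" "y \<in> block_group J'" "v = x \<circ> y" "v' = a \<circ> x \<circ> k \<circ> y \<circ> b"
      using R unfolding R_def by blast
    have "a \<circ> x \<in> block_group J" "k \<circ> y \<circ> b \<in> block_group J'" using xy ba bb kJ by (auto intro!: block_group_comp)
    moreover have "v' = (a \<circ> x) \<circ> (k \<circ> y \<circ> b)" using xy by (simp add: comp_assoc)
    moreover have "v = a \<circ> (a \<circ> x) \<circ> k \<circ> (k \<circ> y \<circ> b) \<circ> b" using xy aa kk bb2 by (simp add: fun_eq_iff)
    ultimately show ?thesis unfolding R_def by blast
  qed
  have mem: "v \<in> block_group (J \<union> J')" if "R v v'" for v v'
    using that block_group_mono[of J "J \<union> J'"] block_group_mono[of J' "J \<union> J'"] unfolding R_def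
    by (auto intro!: block_group_comp)
  have func: "v1 = v2" if R: "R v v1" "R v v2" for v v1 v2
  proof -
    obtain x y where xy: "x \<in> block_group J" "y \<in> block_group J'" "v = x \<circ> y" "v1 = a \<circ> x \<circ> k \<circ> y \<circ> b"
      using R unfolding R_def by blast
    obtain x' y' where xy': "x' \<in> block_group J" "y' \<in> block_group J'" "v = x' \<circ> y'" "v2 = a \<circ> x' \<circ> k \<circ> y' \<circ> b"
      using R unfolding R_def by blast
    \<comment> \<open>The two factorisations differ by m, which lies in W_J and in W_J', hence in
      the abelian group W_K. It can therefore be moved across k.\<close>
    let ?m = "inv' x \<circ> x'"
    have bij: "bij x" "bij y" "bij x'" "bij y'" using xy xy' block_groupD by auto
    have xm: "x \<circ> ?m = x'" using bij by (auto simp: fun_eq_iff bij_is_surj surj_f_inv_f)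
    have e: "x \<circ> y = x' \<circ> y'" using xy xy' by simp
    have my: "?m \<circ> y' = y"
    proof -
      have "?m \<circ> y' = inv' x \<circ> (x \<circ> y)" using e by (simp add: comp_assoc)
      then show ?thesis using bij by (simp add: fun_eq_iff bij_is_inj)
    qed
    have "?m = y \<circ> inv' y'" using my bij by (metis comp_assoc comp_id bij_is_surj surj_iff)
    then have "?m \<in> block_group J'" using xy xy' by (simp add: block_group_comp block_group_inv)
    moreover have "?m \<in> block_group J" using xy xy' by (intro block_group_comp block_group_inv)
    ultimately have "?m \<circ> k = k \<circ> ?m" by (intro totally_disconnected_commute[OF K _ bk] block_group_Int)
    then have "x \<circ> k \<circ> (?m \<circ> y') = (x \<circ> ?m) \<circ> k \<circ> y'" by (simp add: fun_eq_iff)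
    then have "x \<circ> k \<circ> y = x' \<circ> k \<circ> y'" using xm my by simp
    then show ?thesis using xy xy' by (simp add: comp_assoc)
  qed
  have step: "\<exists>i' j'. i' < j' \<and> v' i' < v' j' \<and> R (v \<circ> transpose i j) (v' \<circ> transpose i' j')"
    if R: "R v v'" and ij: "i < j" "v j < v i" for v v' i j
  proof -
    obtain x y where xy: "x \<in> block_group J" "y \<in> block_group J'" "v = x \<circ> y" "v' = a \<circ> x \<circ> k \<circ> y \<circ> b"
      using R unfolding R_def by blast
    have bij: "bij x" "bij y" "bij k" "bij b" using xy block_groupD bk bb by auto
    have ib: "inv' b = b" using bb2 by (metis bij(4) bij_inv_eq_iff ext)
    have ik: "inv' k = k" using kk by (metis bij(3) bij_inv_eq_iff ext)
    show ?thesis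
    proof (cases "same_block J' i j")
      case True
      have s: "same_block J' (y i) (y j)" using True same_block_image_iff[OF xy(2)] by blast
      have "y i \<noteq> y j" using ij bij by (metis bij_is_inj injD less_irrefl)
      moreover have "x (y j) < x (y i)" using ij xy by simp
      ultimately have lt: "a (x (k (y j))) < a (x (k (y i)))"
        using key[OF xy(1) la, of J' "y j" "y i"] s same_block_sym by auto
      \<comment> \<open>Moving the transposition to the right past b replaces i and j by b i and b
        j, and b reverses their block, so b j is now the left position.\<close>
      have "b j < b i" using is_longest_less_iff[OF lb, of j i] True same_block_sym ij by auto
      moreover have "v' (b j) < v' (b i)" using lt xy bb2 by simp
      moreover have "R (v \<circ> transpose i j) (v' \<circ> transpose (b j) (b i))"
      proof -
        have "y \<circ> transpose i j \<in> block_group J'" using xy True by (intro block_group_comp transpose_block_group)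
        moreover have "v \<circ> transpose i j = x \<circ> (y \<circ> transpose i j)" using xy by (simp add: comp_assoc)
        moreover have "transpose i j \<circ> b = b \<circ> transpose (b j) (b i)"
          using transpose_comp_eq[OF bij(4), of i j] ib by (simp add: transpose_commute)
        then have "v' \<circ> transpose (b j) (b i) = a \<circ> x \<circ> k \<circ> (y \<circ> transpose i j) \<circ> b"
          using xy by (simp add: comp_assoc)
        ultimately show ?thesis using xy unfolding R_def by blast
      qed
      ultimately show ?thesis by blast
    next
      case False
      let ?p = "y i" and ?q = "y j"
      have pq: "?p < ?q" using block_group_less_iff[OF xy(2) False] ij by blast
      have xpq: "x ?q < x ?p" using ij xy by simp
      have s: "same_block J ?p ?q" using block_group_less_iff[OF xy(1), of ?p ?q] pq xpq by fastforce
      \<comment> \<open>The transposition of p and q, placed directly after x in the product,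
        becomes the transposition of their preimages once it is moved right past k, y and b.\<close>
      let ?P = "b (inv' y (k ?p))" and ?Q = "b (inv' y (k ?q))"
      have "inv' y ?p < inv' y ?q" using ij bij by (simp add: bij_is_inj)
      then have PQ: "?P < ?Q"
        using key[OF block_group_inv[OF xy(2)] lb s, of ] pq by (simp add: Int_commute)
      have "same_block J (x ?p) (x ?q)" using s same_block_image_iff[OF xy(1)] by blast
      then have "a (x ?p) < a (x ?q)" using is_longest_less_iff[OF la] xpq by simp
      moreover have "v' ?P = a (x ?p)" "v' ?Q = a (x ?q)"
        using xy bij bb2 kk by (simp_all add: bij_is_surj surj_f_inv_f)
      moreover have "R (v \<circ> transpose i j) (v' \<circ> transpose ?P ?Q)"
      proof -
        have "x \<circ> transpose ?p ?q \<in> block_group J" using xy s by (intro block_group_comp transpose_block_group)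
        moreover have "transpose ?p ?q \<circ> y = y \<circ> transpose i j"
          using transpose_comp_eq[OF bij(2), of ?p ?q] bij by (simp add: bij_is_inj)
        then have "v \<circ> transpose i j = x \<circ> transpose ?p ?q \<circ> y" using xy by (simp add: comp_assoc)
        moreover have "transpose ?p ?q \<circ> (k \<circ> y \<circ> b) = (k \<circ> y \<circ> b) \<circ> transpose ?P ?Q"
        proof -
          have "bij (k \<circ> y \<circ> b)" using bij by (intro bij_comp)
          moreover have "inv' (k \<circ> y \<circ> b) r = b (inv' y (k r))" for r
            using bij by (simp add: o_inv_distrib bij_comp ib ik)
          ultimately show ?thesis using transpose_comp_eq by metis
        qed
        then have "v' \<circ> transpose ?P ?Q = a \<circ> (x \<circ> transpose ?p ?q) \<circ> k \<circ> y \<circ> b"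
          using xy by (simp add: comp_assoc)
        ultimately show ?thesis using xy unfolding R_def by blast
      qed
      ultimately show ?thesis using PQ by metis
    qed
  qed
  have "duality (J \<union> J') R" unfolding duality_def using sym mem func step by blast
  moreover have "R id (block_prod n J J')"
    unfolding R_def block_prod_def a_def[symmetric] b_def[symmetric] k_def[symmetric]
    by (intro bexI[of _ id]) (auto simp: fun_eq_iff)
  ultimately show ?thesis by blast
qed

text \<open>Disjoint supports make the factorisation v = x y unique. No two distinct points share a
  block of both S1 and S2, so a transposition answered inside one factor keeps its direction when it
  is seen through the other.\<close>

lemma duality_comp:
  assumes R1: "duality S1 R1" and R2: "duality S2 R2" and disj: "S1 \<inter> S2 = {}"
  shows "duality (S1 \<union> S2) (\<lambda>v v'. \<exists>x x' y y'. R1 x x' \<and> R2 y y' \<and> v = x \<circ> y \<and> v' = x' \<circ> y')"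
    (is "duality _ ?R")
proof -
  have m1: "x \<in> block_group S1" "x' \<in> block_group S1" "R1 x' x" if "R1 x x'" for x x'
    using dualityD(1)[OF R1, OF that] dualityD(1)[OF R1, OF dualityD(2)[OF R1, OF that]] dualityD(2)[OF R1, OF that] .
  have m2: "y \<in> block_group S2" "y' \<in> block_group S2" "R2 y' y" if "R2 y y'" for y y'
    using dualityD(1)[OF R2, OF that] dualityD(1)[OF R2, OF dualityD(2)[OF R2, OF that]] dualityD(2)[OF R2, OF that] .
  have uniq: "x = x1 \<and> y = y1" if "x \<in> block_group S1" "x1 \<in> block_group S1" "y \<in> block_group S2" "y1 \<in> block_group S2"
    "x \<circ> y = x1 \<circ> y1" for x x1 y y1
  proof -
    have bij: "bij x" "bij x1" "bij y" "bij y1" using that block_groupD by auto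
    have "inv' x1 \<circ> x = y1 \<circ> inv' y"
    proof -
      have "inv' x1 \<circ> (x \<circ> y) \<circ> inv' y = inv' x1 \<circ> (x1 \<circ> y1) \<circ> inv' y" using that(5) by simp
      then show ?thesis using bij by (simp add: fun_eq_iff bij_is_inj bij_is_surj surj_f_inv_f)
    qed
    moreover have "inv' x1 \<circ> x \<in> block_group S1" "y1 \<circ> inv' y \<in> block_group S2"
      using that by (auto intro!: block_group_comp block_group_inv)
    ultimately have "inv' x1 \<circ> x = id"
      using block_group_Int[of "inv' x1 \<circ> x" S1 S2] disj block_group_empty by metis
    then have "x1 \<circ> (inv' x1 \<circ> x) = x1" by simp
    then have "x = x1" using bij by (simp add: fun_eq_iff bij_is_surj surj_f_inv_f)
    moreover have "y = y1" using that(5) bij \<open>x = x1\<close> by (auto simp: fun_eq_iff dest: bij_is_inj injD)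
    ultimately show ?thesis by blast
  qed
  have not_both: "\<not> same_block S1 i j" if "same_block S2 i j" "i \<noteq> j" for i j
    using that same_block_Int[of S1 S2 i j] disj by auto
  have step: "\<exists>i' j'. i' < j' \<and> v' i' < v' j' \<and> ?R (v \<circ> transpose i j) (v' \<circ> transpose i' j')"
    if R: "?R v v'" and ij: "i < j" "v j < v i" for v v' i j
  proof -
    obtain x x' y y' where xy: "R1 x x'" "R2 y y'" "v = x \<circ> y" "v' = x' \<circ> y'" using R by blast
    note x = m1[OF xy(1)] and y = m2[OF xy(2)]
    show ?thesis
    proof (cases "y j < y i")
      case True
      then obtain i' j' where s: "i' < j'" "y' i' < y' j'" "R2 (y \<circ> transpose i j) (y' \<circ> transpose i' j')"
        using dualityD(4)[OF R2, OF xy(2) ij(1)] by blast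
      have ne: "i' \<noteq> j'" "y' i' \<noteq> y' j'" using s by auto
      \<comment> \<open>\<open>duality\<close> does not locate i' and j'. But y' and its product
        with the transposition both lie in W_S2, hence so does the transposition, and i' and j'
        share an S2-block.\<close>
      have "x' (y' i') < x' (y' j')"
      proof -
        have "inv' y' \<circ> (y' \<circ> transpose i' j') \<in> block_group S2"
          using block_group_comp[OF block_group_inv[OF y(2)] m2(2)[OF s(3)]] .
        moreover have "inv' y' \<circ> (y' \<circ> transpose i' j') = transpose i' j'"
          using block_groupD(1)[OF y(2)] by (simp add: fun_eq_iff bij_is_inj)
        ultimately have "transpose i' j' \<in> block_group S2" by (simp only:)
        then have "same_block S2 i' j'" using block_groupD(2)[of _ S2 i'] by force
        then have "same_block S2 (y' i') (y' j')" using same_block_image_iff[OF y(2)] by blast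
        then show ?thesis using not_both[OF _ ne(2)] block_group_less_iff[OF x(2)] s by blast
      qed
      then have "v' i' < v' j'" using xy(4) by simp
      moreover have "?R (v \<circ> transpose i j) (v' \<circ> transpose i' j')"
        using xy s(3) by (intro exI[of _ x] exI[of _ x'] exI[of _ "y \<circ> transpose i j"] exI[of _ "y' \<circ> transpose i' j'"])
          (auto simp: comp_assoc)
      ultimately show ?thesis using s(1) by blast
    next
      case False
      let ?p = "y i" and ?q = "y j"
      have bij: "bij y" "bij y'" using y block_groupD by auto
      have pq: "?p < ?q" using False ij bij by (metis bij_is_inj injD less_irrefl linorder_neqE_nat)
      have "x ?q < x ?p" using ij xy by simp
      then obtain p' q' where s: "p' < q'" "x' p' < x' q'" "R1 (x \<circ> transpose ?p ?q) (x' \<circ> transpose p' q')"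
        using dualityD(4)[OF R1, OF xy(1) pq] by blast
      let ?P = "inv' y' p'" and ?Q = "inv' y' q'"
      have yP: "y' ?P = p'" "y' ?Q = q'" using bij by (simp_all add: bij_is_surj surj_f_inv_f)
      have "inv' x' \<circ> (x' \<circ> transpose p' q') \<in> block_group S1"
        using block_group_comp[OF block_group_inv[OF x(2)] m1(2)[OF s(3)]] .
      moreover have "inv' x' \<circ> (x' \<circ> transpose p' q') = transpose p' q'"
        using block_groupD(1)[OF x(2)] by (simp add: fun_eq_iff bij_is_inj)
      ultimately have "transpose p' q' \<in> block_group S1" by (simp only:)
      then have "same_block S1 p' q'" using block_groupD(2)[of _ S1 p'] by force
      then have "\<not> same_block S2 p' q'" using not_both s by blast
      then have "?P < ?Q" using block_group_less_iff[OF block_group_inv[OF y(2)]] s by blast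
      moreover have "v' ?P < v' ?Q" using s yP xy by simp
      moreover have "?R (v \<circ> transpose i j) (v' \<circ> transpose ?P ?Q)"
      proof -
        have "transpose ?p ?q \<circ> y = y \<circ> transpose i j"
          using transpose_comp_eq[OF bij(1), of ?p ?q] bij by (simp add: bij_is_inj)
        then have "v \<circ> transpose i j = (x \<circ> transpose ?p ?q) \<circ> y" using xy by (simp add: comp_assoc)
        moreover have "transpose p' q' \<circ> y' = y' \<circ> transpose ?P ?Q"
          using transpose_comp_eq[OF bij(2), of p' q'] .
        then have "v' \<circ> transpose ?P ?Q = (x' \<circ> transpose p' q') \<circ> y'" using xy by (simp add: comp_assoc)
        ultimately show ?thesis using s(3) xy(2) by blast
      qed
      ultimately show ?thesis by blast
    qed
  qed
  have sym: "?R v' v" if "?R v v'" for v v' using that m1(3) m2(3) by blast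
  have mem: "v \<in> block_group (S1 \<union> S2)" if "?R v v'" for v v'
    using that m1(1) m2(1) block_group_mono[of S1 "S1 \<union> S2"] block_group_mono[of S2 "S1 \<union> S2"]
    by (auto intro!: block_group_comp)
  have func: "v1 = v2" if a: "?R v v1" "?R v v2" for v v1 v2
  proof -
    obtain x x1 y y1 where 1: "R1 x x1" "R2 y y1" "v = x \<circ> y" "v1 = x1 \<circ> y1" using a by blast
    obtain z z1 u u1 where 2: "R1 z z1" "R2 u u1" "v = z \<circ> u" "v2 = z1 \<circ> u1" using a by blast
    have "x = z \<and> y = u" using uniq m1(1) m2(1) 1 2 by metis
    then have "x1 = z1" "y1 = u1" using 1 2 dualityD(3)[OF R1] dualityD(3)[OF R2] by simp_all
    then show ?thesis using 1 2 by simp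
  qed
  show ?thesis unfolding duality_def using sym mem func step by blast
qed

lemma duality_id: "duality {} (\<lambda>v v'. v = id \<and> v' = id)"
  unfolding duality_def by auto

definition polished_list :: "(nat set \<times> nat set) list \<Rightarrow> bool" where
  "polished_list Js \<longleftrightarrow>
     (\<forall>(J, J') \<in> set Js. dynkin_connected (J \<union> J') \<and> totally_disconnected (J \<inter> J')) \<and>
     (\<forall>a<length Js. \<forall>b<length Js. a \<noteq> b \<longrightarrow>
        (fst (Js ! a) \<union> snd (Js ! a)) \<inter> (fst (Js ! b) \<union> snd (Js ! b)) = {})"

definition support :: "(nat set \<times> nat set) list \<Rightarrow> nat set" where
  "support Js = (\<Union>(J, J')\<in>set Js. J \<union> J')"

definition list_prod :: "nat \<Rightarrow> (nat set \<times> nat set) list \<Rightarrow> nat \<Rightarrow> nat" where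
  "list_prod n Js = foldr (\<circ>) (map (\<lambda>(J, J'). block_prod n J J') Js) id"

lemma polished_iff:
  "polished n w \<longleftrightarrow> (\<exists>Js. polished_list Js \<and> support Js \<subseteq> {1..<n} \<and> w = list_prod n Js)"
proof -
  have *: "(\<forall>(J, J') \<in> set Js. J \<union> J' \<subseteq> {1..<n} \<and> dynkin_connected (J \<union> J') \<and> totally_disconnected (J \<inter> J')) \<longleftrightarrow>
    (\<forall>(J, J') \<in> set Js. dynkin_connected (J \<union> J') \<and> totally_disconnected (J \<inter> J')) \<and> support Js \<subseteq> {1..<n}" for Js
    unfolding support_def by fast
  show ?thesis unfolding polished_def polished_list_def list_prod_def block_prod_def * by (simp only: conj_ac)
qed

lemma support_simps [simp]:
  "support [] = {}" "support ((J, J') # Js) = J \<union> J' \<union> support Js" "support (Js @ Js') = support Js \<union> support Js'"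
  unfolding support_def by auto

lemma list_prod_simps [simp]:
  "list_prod n [] = id" "list_prod n ((J, J') # Js) = block_prod n J J' \<circ> list_prod n Js"
  unfolding list_prod_def by auto

lemma list_prod_append: "list_prod n (Js @ Js') = list_prod n Js \<circ> list_prod n Js'"
  by (induction Js) (auto simp: comp_assoc)

lemma polished_list_Nil [simp]: "polished_list []"
  unfolding polished_list_def by simp

text \<open>Disjointness over pairs of distinct indices is rewritten as a \<open>sorted_wrt\<close>
  condition, which splits along an append into a condition on the two supports.\<close>

lemma polished_list_append:
  "polished_list (Js @ Js') \<longleftrightarrow> polished_list Js \<and> polished_list Js' \<and> support Js \<inter> support Js' = {}"
  (is "?L \<longleftrightarrow> ?R")
proof -
  let ?S = "\<lambda>(J, J'). J \<union> J'"
  have fs: "fst p \<union> snd p = ?S p" for p :: "nat set \<times> nat set" by (cases p) simp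
  have "(\<forall>a<length Js. \<forall>b<length Js. a \<noteq> b \<longrightarrow> ?S (Js ! a) \<inter> ?S (Js ! b) = {}) \<longleftrightarrow>
    sorted_wrt (\<lambda>p q. ?S p \<inter> ?S q = {}) Js" for Js :: "(nat set \<times> nat set) list"
  proof (intro iffI allI impI)
    assume "sorted_wrt (\<lambda>p q. ?S p \<inter> ?S q = {}) Js"
    then have s: "?S (Js ! a) \<inter> ?S (Js ! b) = {}" if "a < b" "b < length Js" for a b
      using that unfolding sorted_wrt_iff_nth_less by simp
    fix a b assume "a < length Js" "b < length Js" "a \<noteq> b"
    then show "?S (Js ! a) \<inter> ?S (Js ! b) = {}" using s[of a b] s[of b a] by (cases "a < b") auto
  qed (simp add: sorted_wrt_iff_nth_less)
  then have pl: "polished_list Js \<longleftrightarrow> (\<forall>(J, J') \<in> set Js. dynkin_connected (J \<union> J') \<and> totally_disconnected (J \<inter> J')) \<and>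
    sorted_wrt (\<lambda>p q. ?S p \<inter> ?S q = {}) Js" for Js
    unfolding polished_list_def fs by simp
  have "(\<forall>p\<in>set Js. \<forall>q\<in>set Js'. ?S p \<inter> ?S q = {}) \<longleftrightarrow> support Js \<inter> support Js' = {}"
    unfolding support_def by fast
  then show ?thesis unfolding pl sorted_wrt_append by auto
qed

lemma polished_list_single [simp]:
  "polished_list [(J, J')] \<longleftrightarrow> dynkin_connected (J \<union> J') \<and> totally_disconnected (J \<inter> J')"
  unfolding polished_list_def by auto

lemma polished_list_Cons:
  "polished_list ((J, J') # Js) \<longleftrightarrow> dynkin_connected (J \<union> J') \<and> totally_disconnected (J \<inter> J') \<and>
     polished_list Js \<and> (J \<union> J') \<inter> support Js = {}"
  using polished_list_append[of "[(J, J')]" Js] by auto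

lemma duality_list:
  assumes "polished_list Js" "support Js \<subseteq> {1..<n}"
  shows "\<exists>R. duality (support Js) R \<and> R id (list_prod n Js)"
  using assms
proof (induction Js)
  case Nil then show ?case using duality_id by (intro exI[of _ "\<lambda>v v'. v = id \<and> v' = id"]) auto
next
  case (Cons p Js)
  obtain J J' where p: "p = (J, J')" by fastforce
  have J: "J \<subseteq> {1..<n}" "J' \<subseteq> {1..<n}" "totally_disconnected (J \<inter> J')" "(J \<union> J') \<inter> support Js = {}"
    using Cons.prems unfolding p polished_list_Cons by auto
  obtain R1 where R1: "duality (J \<union> J') R1" "R1 id (block_prod n J J')" using duality_block J by blast
  have "polished_list Js" "support Js \<subseteq> {1..<n}" using Cons.prems unfolding p polished_list_Cons by auto
  from Cons.IH[OF this] obtain R2 where R2: "duality (support Js) R2" "R2 id (list_prod n Js)" by blast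
  let ?R = "\<lambda>v v'. \<exists>x x' y y'. R1 x x' \<and> R2 y y' \<and> v = x \<circ> y \<and> v' = x' \<circ> y'"
  have "duality (support (p # Js)) ?R" using duality_comp[OF R1(1) R2(1) J(4)] unfolding p by simp
  moreover have "?R id (list_prod n (p # Js))"
    using R1(2) R2(2) unfolding p by (intro exI[of _ id] exI[of _ "block_prod n J J'"] exI[of _ "list_prod n Js"]) auto
  ultimately show ?case by (intro exI[of _ ?R]) blast
qed

text \<open>A descending chain from v is mirrored by an ascending chain from its partner. Started at
  w, this puts [e, w] into the domain of R. Started at the partner of u and run down to the
  identity, its mirror image climbs from u to the partner of the identity, which is w.\<close>

lemma duality_self_dual:
  assumes R: "duality S R" and S: "S \<subseteq> {1..<n}" and w: "R id w"
  shows "self_dual (lower_interval n w) (bruhat_le n)"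
proof -
  let ?Q = "{v. \<exists>v'. R v v'}"
  have sym: "R v' v" if "R v v'" for v v' using dualityD(2)[OF R, OF that] .
  have mem: "v \<in> block_group S" if "R v v'" for v v' using dualityD(1)[OF R, OF that] .
  have func: "v1 = v2" if "R v v1" "R v v2" for v v1 v2 using dualityD(3)[OF R, OF that] .
  have perm: "v permutes {1..n}" if "R v v'" for v v' using block_group_permutes[OF S mem[OF that]] .
  have one_step: "\<exists>u'. R u u' \<and> bruhat_step n v' u'" if Rv: "R v v'" and uv: "bruhat_step n u v" for u v v'
  proof -
    obtain i j where ij: "1 \<le> i" "i < j" "j \<le> n" "v j < v i" "u = v \<circ> transpose i j"
      using uv unfolding bruhat_step_down_iff by blast
    then obtain i' j' where *: "i' < j'" "v' i' < v' j'" "R u (v' \<circ> transpose i' j')"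
      using dualityD(4)[OF R, OF Rv ij(2,4)] by blast
    have v': "v' permutes {1..n}" and u': "v' \<circ> transpose i' j' permutes {1..n}"
      using sym perm Rv *(3) by blast+
    \<comment> \<open>The positions i' and j' come without bounds; two permutations of {1..n} differ
      there, so both lie in the range.\<close>
    have "v' i' \<noteq> (v' \<circ> transpose i' j') i'" "v' j' \<noteq> (v' \<circ> transpose i' j') j'" using * by auto
    then have "i' \<in> {1..n}" "j' \<in> {1..n}"
      using v' u' unfolding permutes_def by metis+
    then have "bruhat_step n v' (v' \<circ> transpose i' j')"
      unfolding bruhat_step_iff using v' * by auto
    then show ?thesis using * by blast
  qed
  have steps: "\<exists>u'. R u u' \<and> (bruhat_step n)\<^sup>*\<^sup>* v' u'" if "(bruhat_step n)\<^sup>*\<^sup>* u v" "R v v'" for u v v'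
    using that
  proof (induction rule: converse_rtranclp_induct)
    case base then show ?case by blast
  next
    case (step x y)
    then obtain y' where y': "R y y'" "(bruhat_step n)\<^sup>*\<^sup>* v' y'" by blast
    then obtain x' where "R x x'" "bruhat_step n y' x'" using one_step[OF y'(1) step(1)] by blast
    then show ?case using y' by (meson rtranclp.rtrancl_into_rtrancl)
  qed
  have le: "bruhat_le n u v \<longleftrightarrow> (bruhat_step n)\<^sup>*\<^sup>* u v" for u v
    unfolding bruhat_le_def bruhat_less_def by (metis rtranclpD rtranclp.rtrancl_refl tranclp_into_rtranclp)
  have wp: "w permutes {1..n}" using perm sym w by blast
  have Q: "lower_interval n w = ?Q"
  proof (intro equalityI subsetI)
    fix u assume "u \<in> lower_interval n w"
    then show "u \<in> ?Q" unfolding lower_interval_iff[OF wp] using steps sym[OF w] by blast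
  next
    fix u assume "u \<in> ?Q"
    then obtain u' where u': "R u u'" by blast
    have "bruhat_le n id u'" using bruhat_less_id perm sym u' unfolding bruhat_le_def by blast
    then obtain z where "R id z" "(bruhat_step n)\<^sup>*\<^sup>* u z" unfolding le using steps sym[OF u'] by blast
    then show "u \<in> lower_interval n w" unfolding lower_interval_iff[OF wp] using func w by blast
  qed
  define f where "f v = (THE v'. R v v')" for v
  have f: "f v = v'" if "R v v'" for v v' unfolding f_def using that func by blast
  have ff: "R v (f v)" if "v \<in> ?Q" for v using that f by blast
  have "bij_betw f ?Q ?Q"
  proof (rule bij_betw_byWitness[where f' = f])
    show "\<forall>v\<in>?Q. f (f v) = v" using f sym ff by blast
    show "f ` ?Q \<subseteq> ?Q" using sym ff by blast
    then show "f ` ?Q \<subseteq> ?Q" .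
  qed (use f sym ff in blast)
  moreover have "bruhat_le n u v \<longleftrightarrow> bruhat_le n (f v) (f u)" if "u \<in> ?Q" "v \<in> ?Q" for u v
  proof
    assume "bruhat_le n u v"
    then show "bruhat_le n (f v) (f u)" unfolding le using steps[OF _ ff[OF that(2)]] f by blast
  next
    assume "bruhat_le n (f v) (f u)"
    then show "bruhat_le n u v" unfolding le using steps[OF _ sym[OF ff[OF that(1)]]] sym[OF ff[OF that(2)]] func by blast
  qed
  ultimately show ?thesis unfolding self_dual_def poset_isomorphic_def Q by blast
qed

lemma polished_self_dual:
  assumes "polished n w" shows "self_dual (lower_interval n w) (bruhat_le n)"
  using assms duality_list duality_self_dual unfolding polished_iff by blast

section \<open>Pattern avoidance\<close>

text \<open>The six patterns in the order of the theorem, as forbidden chains of values over an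
  arbitrary interval of positions, so that the induction can pass to subintervals.\<close>

definition good :: "nat \<Rightarrow> nat \<Rightarrow> (nat \<Rightarrow> nat) \<Rightarrow> bool" where
  "good a b w \<longleftrightarrow>
     (\<forall>i j k l. a \<le> i \<and> i < j \<and> j < k \<and> k < l \<and> l \<le> b \<longrightarrow>
        \<not> (w k < w l \<and> w l < w i \<and> w i < w j) \<and>
        \<not> (w l < w j \<and> w j < w k \<and> w k < w i)) \<and>
     (\<forall>i j k l m. a \<le> i \<and> i < j \<and> j < k \<and> k < l \<and> l < m \<and> m \<le> b \<longrightarrow>
        \<not> (w m < w l \<and> w l < w i \<and> w i < w j \<and> w j < w k) \<and>
        \<not> (w m < w l \<and> w l < w k \<and> w k < w i \<and> w i < w j) \<and>
        \<not> (w k < w l \<and> w l < w m \<and> w m < w j \<and> w j < w i) \<and>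
        \<not> (w l < w m \<and> w m < w k \<and> w k < w j \<and> w j < w i))"

lemma goodD:
  assumes "good a b w"
  shows no_3412: "a \<le> i \<Longrightarrow> i < j \<Longrightarrow> j < k \<Longrightarrow> k < l \<Longrightarrow> l \<le> b \<Longrightarrow> \<not> (w k < w l \<and> w l < w i \<and> w i < w j)"
    and no_4231: "a \<le> i \<Longrightarrow> i < j \<Longrightarrow> j < k \<Longrightarrow> k < l \<Longrightarrow> l \<le> b \<Longrightarrow> \<not> (w l < w j \<and> w j < w k \<and> w k < w i)"
    and no_34521: "a \<le> i \<Longrightarrow> i < j \<Longrightarrow> j < k \<Longrightarrow> k < l \<Longrightarrow> l < m \<Longrightarrow> m \<le> b \<Longrightarrow>
      \<not> (w m < w l \<and> w l < w i \<and> w i < w j \<and> w j < w k)"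
    and no_45321: "a \<le> i \<Longrightarrow> i < j \<Longrightarrow> j < k \<Longrightarrow> k < l \<Longrightarrow> l < m \<Longrightarrow> m \<le> b \<Longrightarrow>
      \<not> (w m < w l \<and> w l < w k \<and> w k < w i \<and> w i < w j)"
    and no_54123: "a \<le> i \<Longrightarrow> i < j \<Longrightarrow> j < k \<Longrightarrow> k < l \<Longrightarrow> l < m \<Longrightarrow> m \<le> b \<Longrightarrow>
      \<not> (w k < w l \<and> w l < w m \<and> w m < w j \<and> w j < w i)"
    and no_54312: "a \<le> i \<Longrightarrow> i < j \<Longrightarrow> j < k \<Longrightarrow> k < l \<Longrightarrow> l < m \<Longrightarrow> m \<le> b \<Longrightarrow>
      \<not> (w l < w m \<and> w m < w k \<and> w k < w j \<and> w j < w i)"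
  using assms unfolding good_def by blast+

text \<open>Only finitely many values of the index function matter. A list of known length in its
  place turns each pattern condition into a finite conjunction that simplification
  evaluates.\<close>

lemma avoids_list:
  "avoids n w p \<longleftrightarrow> \<not> (\<exists>xs. length xs = length p \<and> sorted_wrt (<) xs \<and> set xs \<subseteq> {1..n} \<and>
     (\<forall>a<length p. \<forall>b<length p. w (xs ! a) < w (xs ! b) \<longleftrightarrow> p ! a < p ! b))"
proof -
  have "(\<exists>i. strict_mono_on {..<length p} i \<and> i ` {..<length p} \<subseteq> {1..n} \<and>
          (\<forall>a<length p. \<forall>b<length p. w (i a) < w (i b) \<longleftrightarrow> p ! a < p ! b)) \<longleftrightarrow>
        (\<exists>xs. length xs = length p \<and> sorted_wrt (<) xs \<and> set xs \<subseteq> {1..n} \<and>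
     (\<forall>a<length p. \<forall>b<length p. w (xs ! a) < w (xs ! b) \<longleftrightarrow> p ! a < p ! b))" (is "?L \<longleftrightarrow> ?R")
  proof
    assume ?L
    then obtain i where i: "strict_mono_on {..<length p} i" "i ` {..<length p} \<subseteq> {1..n}"
      "\<forall>a<length p. \<forall>b<length p. w (i a) < w (i b) \<longleftrightarrow> p ! a < p ! b" by blast
    have "sorted_wrt (<) (map i [0..<length p])"
      using i(1) unfolding sorted_wrt_iff_nth_less strict_mono_on_def by simp
    then show ?R using i by (intro exI[of _ "map i [0..<length p]"]) (auto simp: atLeast0LessThan)
  next
    assume ?R
    then obtain xs where xs: "length xs = length p" "sorted_wrt (<) xs" "set xs \<subseteq> {1..n}"
      "\<forall>a<length p. \<forall>b<length p. w (xs ! a) < w (xs ! b) \<longleftrightarrow> p ! a < p ! b" by blast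
    have "strict_mono_on {..<length p} ((!) xs)"
      using xs(1,2) unfolding sorted_wrt_iff_nth_less strict_mono_on_def by simp
    moreover have "(!) xs ` {..<length p} \<subseteq> {1..n}"
      using xs(1,3) nth_mem[of _ xs] by (intro image_subsetI) (metis lessThan_iff subsetD)
    ultimately show ?L using xs(4) by blast
  qed
  then show ?thesis unfolding avoids_def by blast
qed

lemma all_length_Suc: "(\<forall>xs. length xs = Suc k \<longrightarrow> P xs) \<longleftrightarrow> (\<forall>x xs. length xs = k \<longrightarrow> P (x # xs))"
  by (auto simp: length_Suc_conv)

lemma avoids_all:
  "avoids n w p \<longleftrightarrow> (\<forall>xs. length xs = length p \<longrightarrow> sorted_wrt (<) xs \<and> set xs \<subseteq> {1..n} \<longrightarrow>
     \<not> (\<forall>a<length p. \<forall>b<length p. w (xs ! a) < w (xs ! b) \<longleftrightarrow> p ! a < p ! b))"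
  unfolding avoids_list by blast

lemma all_increasing_lists_4:
  "(\<forall>xs. length xs = length [p, q, r, s] \<longrightarrow> sorted_wrt (<) xs \<and> set xs \<subseteq> {1..n} \<longrightarrow> \<not> Q xs) \<longleftrightarrow>
   (\<forall>i j k l. 1 \<le> i \<and> i < j \<and> j < k \<and> k < l \<and> l \<le> n \<longrightarrow> \<not> Q [i, j, k, l :: nat])"
  by (simp add: all_length_Suc) auto

lemma all_increasing_lists_5:
  "(\<forall>xs. length xs = length [p, q, r, s, t] \<longrightarrow> sorted_wrt (<) xs \<and> set xs \<subseteq> {1..n} \<longrightarrow> \<not> Q xs) \<longleftrightarrow>
   (\<forall>i j k l m. 1 \<le> i \<and> i < j \<and> j < k \<and> k < l \<and> l < m \<and> m \<le> n \<longrightarrow> \<not> Q [i, j, k, l, m :: nat])"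
  by (simp add: all_length_Suc) auto

lemma avoids_3412:
  "avoids n w [3, 4, 1, 2] \<longleftrightarrow> (\<forall>i j k l. 1 \<le> i \<and> i < j \<and> j < k \<and> k < l \<and> l \<le> n \<longrightarrow>
     \<not> (w k < w l \<and> w l < w i \<and> w i < w j))"
proof -
  have "(\<forall>a<length ([3, 4, 1, 2] :: nat list). \<forall>b<length ([3, 4, 1, 2] :: nat list). w ([i, j, k, l] ! a) < w ([i, j, k, l] ! b) \<longleftrightarrow> [3, 4, 1, 2] ! a < ([3, 4, 1, 2] ! b :: nat))
    \<longleftrightarrow> w k < w l \<and> w l < w i \<and> w i < w j" for i j k l
    by (rule iffI, simp_all add: All_less_Suc)
  then show ?thesis unfolding avoids_all all_increasing_lists_4 by (simp only:)
qed

lemma avoids_4231: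
  "avoids n w [4, 2, 3, 1] \<longleftrightarrow> (\<forall>i j k l. 1 \<le> i \<and> i < j \<and> j < k \<and> k < l \<and> l \<le> n \<longrightarrow>
     \<not> (w l < w j \<and> w j < w k \<and> w k < w i))"
proof -
  have "(\<forall>a<length ([4, 2, 3, 1] :: nat list). \<forall>b<length ([4, 2, 3, 1] :: nat list). w ([i, j, k, l] ! a) < w ([i, j, k, l] ! b) \<longleftrightarrow> [4, 2, 3, 1] ! a < ([4, 2, 3, 1] ! b :: nat))
    \<longleftrightarrow> w l < w j \<and> w j < w k \<and> w k < w i" for i j k l
    by (rule iffI, simp_all add: All_less_Suc)
  then show ?thesis unfolding avoids_all all_increasing_lists_4 by (simp only:)
qed

lemma avoids_34521:
  "avoids n w [3, 4, 5, 2, 1] \<longleftrightarrow> (\<forall>i j k l m. 1 \<le> i \<and> i < j \<and> j < k \<and> k < l \<and> l < m \<and> m \<le> n \<longrightarrow>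
     \<not> (w m < w l \<and> w l < w i \<and> w i < w j \<and> w j < w k))"
proof -
  have "(\<forall>a<length ([3, 4, 5, 2, 1] :: nat list). \<forall>b<length ([3, 4, 5, 2, 1] :: nat list). w ([i, j, k, l, m] ! a) < w ([i, j, k, l, m] ! b) \<longleftrightarrow> [3, 4, 5, 2, 1] ! a < ([3, 4, 5, 2, 1] ! b :: nat))
    \<longleftrightarrow> w m < w l \<and> w l < w i \<and> w i < w j \<and> w j < w k" for i j k l m
    by (rule iffI, simp_all add: All_less_Suc)
  then show ?thesis unfolding avoids_all all_increasing_lists_5 by (simp only:)
qed

lemma avoids_45321:
  "avoids n w [4, 5, 3, 2, 1] \<longleftrightarrow> (\<forall>i j k l m. 1 \<le> i \<and> i < j \<and> j < k \<and> k < l \<and> l < m \<and> m \<le> n \<longrightarrow>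
     \<not> (w m < w l \<and> w l < w k \<and> w k < w i \<and> w i < w j))"
proof -
  have "(\<forall>a<length ([4, 5, 3, 2, 1] :: nat list). \<forall>b<length ([4, 5, 3, 2, 1] :: nat list). w ([i, j, k, l, m] ! a) < w ([i, j, k, l, m] ! b) \<longleftrightarrow> [4, 5, 3, 2, 1] ! a < ([4, 5, 3, 2, 1] ! b :: nat))
    \<longleftrightarrow> w m < w l \<and> w l < w k \<and> w k < w i \<and> w i < w j" for i j k l m
    by (rule iffI, simp_all add: All_less_Suc)
  then show ?thesis unfolding avoids_all all_increasing_lists_5 by (simp only:)
qed

lemma avoids_54123:
  "avoids n w [5, 4, 1, 2, 3] \<longleftrightarrow> (\<forall>i j k l m. 1 \<le> i \<and> i < j \<and> j < k \<and> k < l \<and> l < m \<and> m \<le> n \<longrightarrow>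
     \<not> (w k < w l \<and> w l < w m \<and> w m < w j \<and> w j < w i))"
proof -
  have "(\<forall>a<length ([5, 4, 1, 2, 3] :: nat list). \<forall>b<length ([5, 4, 1, 2, 3] :: nat list). w ([i, j, k, l, m] ! a) < w ([i, j, k, l, m] ! b) \<longleftrightarrow> [5, 4, 1, 2, 3] ! a < ([5, 4, 1, 2, 3] ! b :: nat))
    \<longleftrightarrow> w k < w l \<and> w l < w m \<and> w m < w j \<and> w j < w i" for i j k l m
    by (rule iffI, simp_all add: All_less_Suc)
  then show ?thesis unfolding avoids_all all_increasing_lists_5 by (simp only:)
qed

lemma avoids_54312:
  "avoids n w [5, 4, 3, 1, 2] \<longleftrightarrow> (\<forall>i j k l m. 1 \<le> i \<and> i < j \<and> j < k \<and> k < l \<and> l < m \<and> m \<le> n \<longrightarrow>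
     \<not> (w l < w m \<and> w m < w k \<and> w k < w j \<and> w j < w i))"
proof -
  have "(\<forall>a<length ([5, 4, 3, 1, 2] :: nat list). \<forall>b<length ([5, 4, 3, 1, 2] :: nat list). w ([i, j, k, l, m] ! a) < w ([i, j, k, l, m] ! b) \<longleftrightarrow> [5, 4, 3, 1, 2] ! a < ([5, 4, 3, 1, 2] ! b :: nat))
    \<longleftrightarrow> w l < w m \<and> w m < w k \<and> w k < w j \<and> w j < w i" for i j k l m
    by (rule iffI, simp_all add: All_less_Suc)
  then show ?thesis unfolding avoids_all all_increasing_lists_5 by (simp only:)
qed

lemma good_iff_avoids:
  "good 1 n w \<longleftrightarrow> (\<forall>p \<in> {[3,4,1,2], [4,2,3,1], [3,4,5,2,1], [4,5,3,2,1], [5,4,1,2,3], [5,4,3,1,2]}. avoids n w p)"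
  unfolding good_def ball_simps avoids_3412 avoids_4231 avoids_34521 avoids_45321 avoids_54123 avoids_54312
  by (simp only: imp_conjR all_conj_distrib simp_thms conj_assoc)

text \<open>A forbidden chain in x is carried by h to the same chain in w. One implication between
  comparisons suffices, since patterns are stated as chains of strict inequalities.\<close>

lemma good_transfer:
  assumes good: "good a b w" and h: "\<And>i. a' \<le> i \<Longrightarrow> i \<le> b' \<Longrightarrow> a \<le> h i \<and> h i \<le> b"
    "\<And>i j. a' \<le> i \<Longrightarrow> i < j \<Longrightarrow> j \<le> b' \<Longrightarrow> h i < h j"
    and x: "\<And>i j. a' \<le> i \<Longrightarrow> i \<le> b' \<Longrightarrow> a' \<le> j \<Longrightarrow> j \<le> b' \<Longrightarrow> x i < x j \<Longrightarrow> w (h i) < w (h j)"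
  shows "good a' b' x"
  unfolding good_def
proof (intro conjI allI impI)
  fix i j k l assume c: "a' \<le> i \<and> i < j \<and> j < k \<and> k < l \<and> l \<le> b'"
  have r: "a \<le> h i" "h i < h j" "h j < h k" "h k < h l" "h l \<le> b" using c h by simp_all
  show "\<not> (x k < x l \<and> x l < x i \<and> x i < x j)" using no_3412[OF good r] x c by auto
  show "\<not> (x l < x j \<and> x j < x k \<and> x k < x i)" using no_4231[OF good r] x c by auto
next
  fix i j k l m assume c: "a' \<le> i \<and> i < j \<and> j < k \<and> k < l \<and> l < m \<and> m \<le> b'"
  have r: "a \<le> h i" "h i < h j" "h j < h k" "h k < h l" "h l < h m" "h m \<le> b" using c h by simp_all
  show "\<not> (x m < x l \<and> x l < x i \<and> x i < x j \<and> x j < x k)" using no_34521[OF good r] x c by auto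
  show "\<not> (x m < x l \<and> x l < x k \<and> x k < x i \<and> x i < x j)" using no_45321[OF good r] x c by auto
  show "\<not> (x k < x l \<and> x l < x m \<and> x m < x j \<and> x j < x i)" using no_54123[OF good r] x c by auto
  show "\<not> (x l < x m \<and> x m < x k \<and> x k < x j \<and> x j < x i)" using no_54312[OF good r] x c by auto
qed

text \<open>Inversion exchanges positions and values: 3412 and 4231 are involutions, 34521 is
  exchanged with 54123, and 45321 with 54312.\<close>

lemma good_inv:
  assumes w: "w permutes {a..b}" and good: "good a b w"
  shows "good a b (inv' w)"
proof -
  let ?v = "inv' w"
  have wv: "w (?v i) = i" for i using permutes_inverses(1)[OF w] .
  have r: "a \<le> ?v i" "?v i \<le> b" if "a \<le> i" "i \<le> b" for i
    using permutes_in_image[OF permutes_inv[OF w], of i] that by auto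
  show ?thesis unfolding good_def
  proof (intro conjI allI impI)
    fix i j k l assume c: "a \<le> i \<and> i < j \<and> j < k \<and> k < l \<and> l \<le> b"
    show "\<not> (?v k < ?v l \<and> ?v l < ?v i \<and> ?v i < ?v j)"
      using no_3412[OF good, of "?v k" "?v l" "?v i" "?v j"] r[of k] r[of j] c by (auto simp: wv)
    show "\<not> (?v l < ?v j \<and> ?v j < ?v k \<and> ?v k < ?v i)"
      using no_4231[OF good, of "?v l" "?v j" "?v k" "?v i"] r[of l] r[of i] c by (auto simp: wv)
  next
    fix i j k l m assume c: "a \<le> i \<and> i < j \<and> j < k \<and> k < l \<and> l < m \<and> m \<le> b"
    show "\<not> (?v m < ?v l \<and> ?v l < ?v i \<and> ?v i < ?v j \<and> ?v j < ?v k)"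
      using no_54123[OF good, of "?v m" "?v l" "?v i" "?v j" "?v k"] r[of m] r[of k] c by (auto simp: wv)
    show "\<not> (?v m < ?v l \<and> ?v l < ?v k \<and> ?v k < ?v i \<and> ?v i < ?v j)"
      using no_54312[OF good, of "?v m" "?v l" "?v k" "?v i" "?v j"] r[of m] r[of j] c by (auto simp: wv)
    show "\<not> (?v k < ?v l \<and> ?v l < ?v m \<and> ?v m < ?v j \<and> ?v j < ?v i)"
      using no_34521[OF good, of "?v k" "?v l" "?v m" "?v j" "?v i"] r[of k] r[of i] c by (auto simp: wv)
    show "\<not> (?v l < ?v m \<and> ?v m < ?v k \<and> ?v k < ?v j \<and> ?v j < ?v i)"
      using no_45321[OF good, of "?v l" "?v m" "?v k" "?v j" "?v i"] r[of l] r[of i] c by (auto simp: wv)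
  qed
qed

section \<open>Pattern-avoiding permutations are polished\<close>

text \<open>The values on {a..k} miss exactly one element c of {a..k+1}. Putting c at position k + 1
  gives x; the remaining y arranges the later positions like w, with k + 1 in the role of c. The two
  factors use the disjoint sets of generators {a..k} and {k+1..b-1}, and h tells from which position
  of w each entry of x is taken.\<close>

lemma permutes_split:
  assumes w: "w permutes {a..b}" and k: "a \<le> k" "k < b" and sub: "w ` {a..k} \<subseteq> {a..Suc k}"
  obtains x y h where "x permutes {a..Suc k}" "y permutes {Suc k..b}" "w = x \<circ> y"
    "\<And>i. a \<le> i \<Longrightarrow> i \<le> k \<Longrightarrow> x i = w i \<and> h i = i"
    "k < h (Suc k)" "h (Suc k) \<le> b" "x (Suc k) = w (h (Suc k))"
    "\<And>i j. Suc k \<le> i \<Longrightarrow> i \<le> b \<Longrightarrow> Suc k \<le> j \<Longrightarrow> j \<le> b \<Longrightarrow> y i < y j \<longleftrightarrow> w i < w j"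
proof -
  have inj: "inj w" using w by (rule permutes_inj)
  have "card (w ` {a..k}) = Suc k - a" using inj by (simp add: card_image inj_on_subset)
  then have "card ({a..Suc k} - w ` {a..k}) = 1" using k sub by (simp add: card_Diff_subset)
  then obtain c where c: "{a..Suc k} - w ` {a..k} = {c}" by (auto simp: card_Suc_eq)
  then have cr: "a \<le> c" "c \<le> Suc k" "c \<notin> w ` {a..k}" by auto
  define d where "d = inv' w c"
  have wd: "w d = c" unfolding d_def using permutes_inverses(1)[OF w] .
  have d: "d \<in> {a..b}" using permutes_in_image[OF w, of d] wd cr k by auto
  then have kd: "k < d" using cr wd by (metis atLeastAtMost_iff imageI leI)
  define x where "x i = (if i \<in> {a..k} then w i else if i = Suc k then c else i)" for i
  have ins: "{a..Suc k} = insert (Suc k) {a..k}" using k by auto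
  have xk: "x ` {a..k} = w ` {a..k}" unfolding x_def by auto
  have ximg: "x ` {a..Suc k} = {a..Suc k}"
  proof -
    have "insert c (w ` {a..k}) = {a..Suc k}" using c sub by blast
    moreover have "x (Suc k) = c" by (simp add: x_def)
    ultimately show ?thesis by (metis image_insert ins xk)
  qed
  then have "inj_on x {a..Suc k}" by (simp add: eq_card_imp_inj_on)
  then have "x permutes {a..Suc k}"
    using ximg k by (intro bij_imp_permutes) (auto simp: bij_betw_def x_def)
  note xp = this
  define y where "y = inv' x \<circ> w"
  have xy: "w = x \<circ> y" unfolding y_def using permutes_inverses(1)[OF xp] by (auto simp: fun_eq_iff)
  \<comment> \<open>Apart from c, every value after position k exceeds k + 1, so replacing c by k +
    1 changes no comparison.\<close>
  have wbig: "Suc k < w i" if "k < i" "i \<le> b" "i \<noteq> d" for i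
  proof (rule ccontr)
    assume "\<not> Suc k < w i"
    moreover have "a \<le> w i" using permutes_in_image[OF w, of i] that k by auto
    moreover have "w i \<noteq> c" using wd inj that by (metis injD)
    moreover have "w i \<notin> w ` {a..k}" using that by (simp add: inj_image_mem_iff[OF inj])
    ultimately show False using c by auto
  qed
  have yfix: "y i = i" if "i \<notin> {Suc k..b}" for i
  proof -
    have "x i = w i"
    proof (cases "i \<in> {a..k}")
      case False
      then have "i \<notin> {a..b}" "i \<noteq> Suc k" using that k by auto
      then show ?thesis using permutes_not_in[OF w] False unfolding x_def by auto
    qed (simp add: x_def)
    then show ?thesis unfolding y_def using permutes_inverses(2)[OF xp, of i] by simp
  qed
  have "bij y" unfolding y_def by (intro bij_comp permutes_bij[OF w] permutes_bij[OF permutes_inv[OF xp]])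
  then have yp: "y permutes {Suc k..b}" unfolding permutes_def using yfix by (metis bij_pointE)
  have yval: "y i = (if i = d then Suc k else w i)" if "Suc k \<le> i" "i \<le> b" for i
  proof -
    have "x (if i = d then Suc k else w i) = w i"
      using wbig[of i] that wd unfolding x_def by auto
    then show ?thesis unfolding y_def comp_def by (metis permutes_inverses(2)[OF xp])
  qed
  have "y i < y j \<longleftrightarrow> w i < w j" if "Suc k \<le> i" "i \<le> b" "Suc k \<le> j" "j \<le> b" for i j
    using yval[of i] yval[of j] wbig[of i] wbig[of j] that wd cr by auto
  then show ?thesis
    using that[of x y "\<lambda>i. if i = Suc k then d else i"] xp yp xy kd d wd by (auto simp: x_def)
qed

definition decreasing_below :: "nat \<Rightarrow> nat \<Rightarrow> (nat \<Rightarrow> nat) \<Rightarrow> bool" where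
  "decreasing_below a b w \<longleftrightarrow>
     (\<forall>i j. a \<le> i \<longrightarrow> i < j \<longrightarrow> j \<le> b \<longrightarrow> w i \<le> w a \<longrightarrow> w j \<le> w a \<longrightarrow> w j < w i)"

text \<open>If both fail, there are positions i < j with increasing values below w a, and positions
  p < q with increasing values in front of the position d of the smallest value a. Avoiding 4231
  between positions a and d forces j beyond d and the value at q above w a; then a, q, d, j form
  3412.\<close>

lemma decreasing_below_or_inv:
  assumes w: "w permutes {a..b}" and good: "good a b w"
  shows "decreasing_below a b w \<or> decreasing_below a b (inv' w)"
proof (rule ccontr)
  let ?v = "inv' w"
  define d where "d = ?v a"
  assume "\<not> ?thesis"
  then obtain i j k l where ij: "a \<le> i" "i < j" "j \<le> b" "w i \<le> w a" "w j \<le> w a" "\<not> w j < w i"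
    and kl: "a \<le> k" "k < l" "l \<le> b" "?v k \<le> d" "?v l \<le> d" "\<not> ?v l < ?v k"
    unfolding decreasing_below_def d_def by blast
  have inj: "w p = w q \<Longrightarrow> p = q" for p q using permutes_inj[OF w] by (simp add: inj_eq)
  have wv: "w (?v i) = i" for i using permutes_inverses(1)[OF w] .
  have wd: "w d = a" unfolding d_def by (rule wv)
  define p q where "p = ?v k" and "q = ?v l"
  have pq: "w p = k" "w q = l" unfolding p_def q_def by (rule wv)+
  have "p < q" using kl(2,6) pq unfolding p_def[symmetric] q_def[symmetric] by (metis linorder_neqE_nat nat_less_le)
  have pr: "a \<le> p" using permutes_in_image[OF w, of p] pq kl by auto
  have q: "q < d" using kl(1,2,5) wd pq unfolding q_def[symmetric] by (metis leD le_neq_implies_less)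
  have db: "d \<le> b" using permutes_in_image[OF w, of d] wd ij by auto
  have ne: "w i \<noteq> w j" "w j \<noteq> w a" using inj[of i j] inj[of j a] ij by auto
  then have "w i < w a" using ij by linarith
  then have ij': "a < i" "w i < w j" "w j < w a" using ne ij by (cases "i = a"; simp)+
  have wr: "a \<le> w i" using permutes_in_image[OF w, of i] ij by auto
  have no: "\<not> (w r < w s \<and> w s < w a)" if "a < r" "r < s" "s < d" for r s
    using no_4231[OF good, of a r s d] that db wd permutes_in_image[OF w, of r] inj[of r d] by (auto simp: le_less)
  have "d < j" using no[OF ij'(1) ij(2)] ij' inj[of j d] wd wr by (metis leD le_trans less_imp_le linorder_neqE_nat)
  moreover have "w a < w q"
  proof (cases "p = a")
    case True then show ?thesis using pq kl by simp
  next
    case False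
    then have "\<not> w q < w a" using no[of p q] pr \<open>p < q\<close> q pq kl by simp
    then show ?thesis using inj[of q a] pr \<open>p < q\<close> by (auto simp: not_less le_less)
  qed
  ultimately show False
    using no_3412[OF good, of a q d j] pr \<open>p < q\<close> q ij ij' wd wr by auto
qed

section \<open>Products of factors over an interval of generators\<close>

lemma dynkin_connected_Un:
  assumes A: "dynkin_connected A" and B: "dynkin_connected B" and x: "x \<in> A" "x \<in> B"
  shows "dynkin_connected (A \<union> B)"
proof -
  let ?r = "\<lambda>C x y. x \<in> C \<and> y \<in> C \<and> dynkin_adj x y"
  have mono: "(?r (A \<union> B))\<^sup>*\<^sup>* a b" if "(?r C)\<^sup>*\<^sup>* a b" "C \<subseteq> A \<union> B" for a b C
    using that(1) by (rule rtranclp_mono[THEN predicate2D, rotated]) (use that(2) in auto)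
  have "(?r (A \<union> B))\<^sup>*\<^sup>* a x" "(?r (A \<union> B))\<^sup>*\<^sup>* x a" if "a \<in> A \<union> B" for a
    using that mono[of A a x] mono[of B a x] mono[of A x a] mono[of B x a] A B x
    unfolding dynkin_connected_def by auto
  then show ?thesis unfolding dynkin_connected_def by (meson rtranclp_trans)
qed

lemma dynkin_connected_interval: "dynkin_connected {a..<b}"
proof -
  define r where "r x y \<longleftrightarrow> x \<in> {a..<b} \<and> y \<in> {a..<b} \<and> dynkin_adj x y" for x y
  have up: "r\<^sup>*\<^sup>* a i \<and> r\<^sup>*\<^sup>* i a" if "a \<le> i" "i < b" for i using that
  proof (induction rule: dec_induct)
    case (step m)
    then have "r m (Suc m)" "r (Suc m) m" by (auto simp: dynkin_adj_def r_def)
    moreover have "r\<^sup>*\<^sup>* a m" "r\<^sup>*\<^sup>* m a" using step by auto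
    ultimately show ?case by (meson converse_rtranclp_into_rtranclp rtranclp.rtrancl_into_rtrancl)
  qed simp
  have "r = (\<lambda>x y. x \<in> {a..<b} \<and> y \<in> {a..<b} \<and> dynkin_adj x y)" by (auto simp: r_def fun_eq_iff)
  moreover have "r\<^sup>*\<^sup>* i j" if "i \<in> {a..<b}" "j \<in> {a..<b}" for i j
    using up[of i] up[of j] that by (auto intro: rtranclp_trans)
  ultimately show ?thesis unfolding dynkin_connected_def by simp
qed

text \<open>The list of the inverse element: each factor is a product of three involutions, so
  inversion reverses the list and exchanges J and J' in every pair.\<close>

definition rev_list :: "(nat set \<times> nat set) list \<Rightarrow> (nat set \<times> nat set) list" where
  "rev_list Js = rev (map (\<lambda>(J, J'). (J', J)) Js)"

lemma rev_list_simps [simp]: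
  "rev_list [] = []" "rev_list ((J, J') # Js) = rev_list Js @ [(J', J)]"
  "rev_list (Js @ Js') = rev_list Js' @ rev_list Js" "support (rev_list Js) = support Js"
  unfolding rev_list_def support_def by auto

lemma rev_list_rev_list [simp]: "rev_list (rev_list Js) = Js"
  by (induction Js) auto

lemma polished_list_rev_list: "polished_list Js \<Longrightarrow> polished_list (rev_list Js)"
  by (induction Js) (auto simp: polished_list_append polished_list_Cons Un_commute Int_commute)

lemma block_prod_inverse:
  assumes "J \<subseteq> {1..<n}" "J' \<subseteq> {1..<n}"
  shows "block_prod n J J' \<circ> block_prod n J' J = id"
proof -
  have "J \<inter> J' \<subseteq> {1..<n}" using assms by blast
  then show ?thesis
    using longest_involution[OF assms(1)] longest_involution[OF assms(2)] longest_involution[of "J \<inter> J'" n]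
    unfolding block_prod_def Int_commute[of J' J] by (simp add: fun_eq_iff)
qed

lemma list_prod_rev_list_inverse:
  assumes "support Js \<subseteq> {1..<n}"
  shows "list_prod n Js \<circ> list_prod n (rev_list Js) = id"
  using assms
proof (induction Js)
  case (Cons p Js)
  obtain J J' where p: "p = (J, J')" by fastforce
  have J: "J \<subseteq> {1..<n}" "J' \<subseteq> {1..<n}" "support Js \<subseteq> {1..<n}" using Cons.prems unfolding p by auto
  have "list_prod n (p # Js) \<circ> list_prod n (rev_list (p # Js))
      = block_prod n J J' \<circ> (list_prod n Js \<circ> list_prod n (rev_list Js)) \<circ> block_prod n J' J"
    unfolding p by (simp add: list_prod_append comp_assoc)
  then show ?case using Cons.IH[OF J(3)] block_prod_inverse[OF J(1,2)] by (simp only: comp_id)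
qed simp

lemma list_prod_rev_list:
  assumes "support Js \<subseteq> {1..<n}"
  shows "list_prod n (rev_list Js) = inv' (list_prod n Js)"
  using list_prod_rev_list_inverse[of Js n] list_prod_rev_list_inverse[of "rev_list Js" n] assms
  by (intro inv_unique_comp[symmetric]) simp_all

lemma list_prod_block_group:
  assumes "support Js \<subseteq> {1..<n}" shows "list_prod n Js \<in> block_group (support Js)"
  using assms
proof (induction Js)
  case Nil then show ?case by (simp only: list_prod_simps block_group_id)
next
  case (Cons p Js)
  obtain J J' where p: "p = (J, J')" by fastforce
  let ?S = "support (p # Js)"
  have J: "J \<subseteq> {1..<n}" "J' \<subseteq> {1..<n}" "J \<inter> J' \<subseteq> {1..<n}" "support Js \<subseteq> {1..<n}" using Cons.prems unfolding p by auto
  have S: "J \<subseteq> ?S" "J' \<subseteq> ?S" "J \<inter> J' \<subseteq> ?S" "support Js \<subseteq> ?S" unfolding p by auto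
  have "longest n J \<in> block_group ?S" "longest n (J \<inter> J') \<in> block_group ?S" "longest n J' \<in> block_group ?S"
    "list_prod n Js \<in> block_group ?S"
    using J longest_block_group block_group_mono[OF S(1)] block_group_mono[OF S(2)] block_group_mono[OF S(3)]
      block_group_mono[OF S(4)] Cons.IH by blast+
  then show ?case unfolding p list_prod_simps block_prod_def by (intro block_group_comp)
qed

lemma is_longest_transpose: "is_longest {p} (transpose p (Suc p))"
  unfolding is_longest_def
proof (intro conjI allI impI)
  show "transpose p (Suc p) \<in> block_group {p}" by (intro transpose_block_group) (auto simp: same_block_less)
next
  fix i j assume ij: "i < j" "same_block {p} i j"
  then have s: "{i..<j} \<subseteq> {p}" by (simp add: same_block_less)
  then have "i = p" using ij by auto
  moreover have "j = Suc p" using s ij by (metis Suc_lessI \<open>i = p\<close> atLeastLessThan_iff lessI less_imp_le n_not_Suc_n singletonD subsetD)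
  ultimately show "transpose p (Suc p) j < transpose p (Suc p) i" by simp
qed

definition interval_rev :: "nat \<Rightarrow> nat \<Rightarrow> nat \<Rightarrow> nat" where
  "interval_rev a c i = (if a \<le> i \<and> i \<le> c then a + c - i else i)"

lemma interval_rev_involution: "interval_rev a c (interval_rev a c i) = i"
  unfolding interval_rev_def by auto

lemma is_longest_interval_rev:
  assumes "a \<le> c" shows "is_longest {a..<c} (interval_rev a c)"
  unfolding is_longest_def
proof (intro conjI allI impI)
  have "bij (interval_rev a c)" by (rule involuntory_imp_bij) (rule interval_rev_involution)
  moreover have "same_block {a..<c} i (interval_rev a c i)" for i
    unfolding interval_rev_def same_block_def by auto
  ultimately show "interval_rev a c \<in> block_group {a..<c}" unfolding block_group_def by blast
next
  fix i j assume ij: "i < j" "same_block {a..<c} i j"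
  then have "{i..<j} \<subseteq> {a..<c}" by (simp add: same_block_less)
  then have "a \<le> i \<and> j \<le> c" using ij by auto
  then show "interval_rev a c j < interval_rev a c i" using ij unfolding interval_rev_def by auto
qed

text \<open>The strong form records where the factor containing the first generator \<open>a\<close> comes from,
  which is what allows another factor to be attached to it on the left.\<close>
definition polished_on :: "nat \<Rightarrow> nat \<Rightarrow> nat \<Rightarrow> (nat \<Rightarrow> nat) \<Rightarrow> bool" where
  "polished_on n a b w \<longleftrightarrow> (\<exists>Js. polished_list Js \<and> support Js \<subseteq> {a..<b} \<and> w = list_prod n Js)"

definition strongly_polished_on :: "nat \<Rightarrow> nat \<Rightarrow> nat \<Rightarrow> (nat \<Rightarrow> nat) \<Rightarrow> bool" where
  "strongly_polished_on n a b w \<longleftrightarrow> (\<exists>Js J J' Js'. polished_list (Js @ (J, J') # Js') \<and>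
     support (Js @ (J, J') # Js') \<subseteq> {a..<b} \<and> w = list_prod n (Js @ (J, J') # Js') \<and>
     a \<in> J \<and> Suc a \<in> J \<and> a \<notin> J' \<and> Suc a \<notin> J')"

lemma strongly_polished_imp: "strongly_polished_on n a b w \<Longrightarrow> polished_on n a b w"
  unfolding strongly_polished_on_def polished_on_def by blast

lemma polished_on_comp:
  assumes "polished_on n a k x" "polished_on n k b y" "a \<le> k" "k \<le> b"
  shows "polished_on n a b (x \<circ> y)"
proof -
  obtain Js Js' where *: "polished_list Js" "support Js \<subseteq> {a..<k}" "x = list_prod n Js"
    "polished_list Js'" "support Js' \<subseteq> {k..<b}" "y = list_prod n Js'"
    using assms unfolding polished_on_def by blast
  have "{a..<k} \<inter> {k..<b} = {}" by auto
  then have "polished_list (Js @ Js')" using * unfolding polished_list_append by blast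
  moreover have "support (Js @ Js') \<subseteq> {a..<b}" using * assms(3,4) by fastforce
  moreover have "x \<circ> y = list_prod n (Js @ Js')" using * by (simp add: list_prod_append)
  ultimately show ?thesis unfolding polished_on_def by blast
qed

lemma strongly_polished_on_comp:
  assumes "strongly_polished_on n a k x" "polished_on n k b y" "a \<le> k" "k \<le> b"
  shows "strongly_polished_on n a b (x \<circ> y)"
proof -
  obtain Js J J' Js2 Js' where *: "polished_list (Js @ (J, J') # Js2)" "support (Js @ (J, J') # Js2) \<subseteq> {a..<k}"
    "x = list_prod n (Js @ (J, J') # Js2)" "a \<in> J \<and> Suc a \<in> J \<and> a \<notin> J' \<and> Suc a \<notin> J'"
    "polished_list Js'" "support Js' \<subseteq> {k..<b}" "y = list_prod n Js'"
    using assms unfolding polished_on_def strongly_polished_on_def by blast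
  let ?L = "(Js @ (J, J') # Js2) @ Js'"
  have "{a..<k} \<inter> {k..<b} = {}" by auto
  then have "polished_list ?L"
    using *(1,2,5,6) unfolding polished_list_append[of "Js @ (J, J') # Js2"] by blast
  moreover have "{a..<k} \<subseteq> {a..<b}" "{k..<b} \<subseteq> {a..<b}" using assms(3,4) by auto
  then have "support ?L \<subseteq> {a..<b}"
    using *(2,6) unfolding support_simps(3)[of "Js @ (J, J') # Js2"] by blast
  moreover have "x \<circ> y = list_prod n ?L" using * list_prod_append[of n "Js @ (J, J') # Js2"] by simp
  moreover have "?L = Js @ (J, J') # (Js2 @ Js')" by simp
  ultimately show ?thesis using *(4) unfolding strongly_polished_on_def by metis
qed

lemma polished_on_inv:
  assumes "polished_on n a b w" "1 \<le> a" "b \<le> n"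
  shows "polished_on n a b (inv' w)"
proof -
  obtain Js where Js: "polished_list Js" "support Js \<subseteq> {a..<b}" "w = list_prod n Js"
    using assms unfolding polished_on_def by blast
  have "support Js \<subseteq> {1..<n}" using Js(2) assms by (force dest: subsetD)
  then have "inv' w = list_prod n (rev_list Js)" using list_prod_rev_list Js by simp
  then show ?thesis unfolding polished_on_def using Js polished_list_rev_list
    by (intro exI[of _ "rev_list Js"]) simp
qed

text \<open>The point is that everything to the left of \<open>w\<^sub>0(J')\<close> in \<open>y\<close> commutes with \<open>w\<^sub>0({a..p}) s\<^sub>p\<close>.\<close>
lemma attach_interval:
  assumes y: "strongly_polished_on n p b (inv' y)" and bij: "bij y" and r: "1 \<le> a" "a < p" "p < b" "b \<le> n"
  obtains Js J J' Js' where "polished_list (Js @ (J, J') # Js')" "support (Js @ (J, J') # Js') \<subseteq> {a..<b}"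
    "interval_rev a (Suc p) \<circ> transpose p (Suc p) \<circ> y = list_prod n (Js @ (J, J') # Js')"
    "{a..p} \<subseteq> J" "J' \<subseteq> {p..}"
proof -
  obtain L0 A B R0 where *: "polished_list (L0 @ (A, B) # R0)" "support (L0 @ (A, B) # R0) \<subseteq> {p..<b}"
    "inv' y = list_prod n (L0 @ (A, B) # R0)" "p \<in> A" "Suc p \<in> A" "p \<notin> B" "Suc p \<notin> B"
    using y unfolding strongly_polished_on_def by blast
  define L R where "L = rev_list R0" and "R = rev_list L0"
  have S: "{p..<b} \<subseteq> {1..<n}" using r by auto
  have "y = inv' (inv' y)" using bij by (simp add: inv_inv_eq)
  also have "\<dots> = list_prod n (rev_list (L0 @ (A, B) # R0))"
    using *(2,3) S list_prod_rev_list by (metis subset_trans)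
  finally have yL: "y = list_prod n (L @ (B, A) # R)" by (simp add: L_def R_def)
  have pl: "polished_list (L @ (B, A) # R)"
    using polished_list_rev_list[OF *(1)] by (simp add: L_def R_def)
  have sup: "support L \<subseteq> {p..<b}" "support R \<subseteq> {p..<b}" "A \<subseteq> {p..<b}" "B \<subseteq> {p..<b}"
    using *(2) by (auto simp: L_def R_def)
  have dj: "support L \<inter> (A \<union> B) = {}" "support R \<inter> (A \<union> B) = {}" "support L \<inter> support R = {}"
    and con: "dynkin_connected (B \<union> A)" and tot: "totally_disconnected (B \<inter> A)"
    and plL: "polished_list L" and plR: "polished_list R"
    using pl unfolding polished_list_append polished_list_Cons by auto
  have Ln: "support L \<subseteq> {1..<n}" "A \<subseteq> {1..<n}" "B \<subseteq> {1..<n}" "B \<inter> A \<subseteq> {1..<n}" using sup S by blast+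
  \<comment> \<open>The generators p and p + 1 lie in A, but neither in B nor in the support of L,
    so these two start at p + 2. This gap makes them commute with s_p and with w0({a..p}).\<close>
  have ge: "p + 2 \<le> i" if "i \<in> support L \<or> i \<in> B" for i
  proof -
    have "i \<noteq> p" "i \<noteq> Suc p" using that dj(1) *(4-7) by auto
    moreover have "p \<le> i" using that sup by auto
    ultimately show ?thesis by simp
  qed
  have far1: "far {a..<Suc p} (support L)" "far {a..<Suc p} B" "far {p} (support L)" "far {p} B"
    unfolding far_def dynkin_adj_def using ge by force+
  have far2: "far {p} (B \<inter> A)" using far1(4) unfolding far_def by blast
  let ?x = "interval_rev a (Suc p)" and ?s = "transpose p (Suc p)"
  have lx: "is_longest {a..<Suc p} ?x" using r by (intro is_longest_interval_rev) simp
  have bx: "?x \<in> block_group {a..<Suc p}" and bs: "?s \<in> block_group {p}"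
    using lx is_longest_transpose unfolding is_longest_def by auto
  have bL: "list_prod n L \<in> block_group (support L)" using list_prod_block_group[OF Ln(1)] .
  \<comment> \<open>The factor (B, A) of y absorbs the new elements: B grows to T, while the
    intersection with A grows by p alone, so that s_p becomes part of the middle term.\<close>
  let ?T = "{a..<Suc p} \<union> B"
  have TA: "?T \<inter> A = {p} \<union> (B \<inter> A)" using sup *(4) r by auto
  have T: "?T \<subseteq> {1..<n}" using Ln r by auto
  have lT: "longest n ?T = ?x \<circ> longest n B"
    using T Ln by (intro longest_eqI is_longest_Un_far[OF far1(2) lx] longest_is_longest)
  have lK: "longest n (?T \<inter> A) = ?s \<circ> longest n (B \<inter> A)"
    unfolding TA using T Ln r
    by (intro longest_eqI is_longest_Un_far[OF far2 is_longest_transpose] longest_is_longest) auto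
  have "?x \<circ> ?s \<circ> y = (?x \<circ> ?s \<circ> list_prod n L) \<circ> (block_prod n B A \<circ> list_prod n R)"
    unfolding yL by (simp add: list_prod_append comp_assoc)
  also have "?x \<circ> ?s \<circ> list_prod n L = list_prod n L \<circ> ?x \<circ> ?s"
    unfolding comp_assoc far_commute[OF far1(3) bs bL]
    unfolding comp_assoc[symmetric] far_commute[OF far1(1) bx bL] ..
  also have "(list_prod n L \<circ> ?x \<circ> ?s) \<circ> (block_prod n B A \<circ> list_prod n R)
      = list_prod n L \<circ> (?x \<circ> (?s \<circ> longest n B) \<circ> longest n (B \<inter> A) \<circ> longest n A \<circ> list_prod n R)"
    unfolding block_prod_def by (simp add: comp_assoc)
  also have "?s \<circ> longest n B = longest n B \<circ> ?s"
    using far_commute[OF far1(4) bs longest_block_group[OF Ln(3)]] .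
  also have "list_prod n L \<circ> (?x \<circ> (longest n B \<circ> ?s) \<circ> longest n (B \<inter> A) \<circ> longest n A \<circ> list_prod n R)
      = list_prod n (L @ (?T, A) # R)"
    by (simp add: list_prod_append block_prod_def lT lK comp_assoc)
  finally have eq: "?x \<circ> ?s \<circ> y = list_prod n (L @ (?T, A) # R)" .
  have "dynkin_connected (?T \<union> A)"
    using dynkin_connected_Un[OF dynkin_connected_interval con, of p a "Suc p"] *(4) r by (simp add: Un_assoc)
  moreover have "totally_disconnected (?T \<inter> A)"
    unfolding TA using tot far2 unfolding totally_disconnected_def far_def dynkin_adj_def by auto
  moreover have "support L \<inter> (?T \<union> A) = {}" "support R \<inter> (?T \<union> A) = {}"
  proof -
    have "p \<notin> support L" "p \<notin> support R" using dj *(4) by auto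
    moreover have "p \<le> i" if "i \<in> support L \<or> i \<in> support R" for i using that sup(1,2) by auto
    ultimately have "Suc p \<le> i" if "i \<in> support L \<or> i \<in> support R" for i
      using that by (metis Suc_leI le_neq_implies_less)
    then have "support L \<inter> {a..<Suc p} = {}" "support R \<inter> {a..<Suc p} = {}" by force+
    then show "support L \<inter> (?T \<union> A) = {}" "support R \<inter> (?T \<union> A) = {}"
      using dj(1,2) by blast+
  qed
  ultimately have "polished_list (L @ (?T, A) # R)"
    using plL plR dj(3) unfolding polished_list_append polished_list_Cons by auto
  moreover have "{p..<b} \<subseteq> {a..<b}" "{a..<Suc p} \<subseteq> {a..<b}" using r by auto
  then have "support (L @ (?T, A) # R) \<subseteq> {a..<b}" using sup unfolding support_simps by blast
  ultimately show ?thesis using eq sup by (intro that[of L ?T A R]) auto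
qed

lemma decreasing_belowD:
  "decreasing_below a b w \<Longrightarrow> a \<le> i \<Longrightarrow> i < j \<Longrightarrow> j \<le> b \<Longrightarrow> w i \<le> w a \<Longrightarrow> w j \<le> w a \<Longrightarrow> w j < w i"
  unfolding decreasing_below_def by blast

lemma good_mono:
  assumes "good a b w" "a \<le> a'" "\<And>i j. a' \<le> i \<Longrightarrow> i \<le> b \<Longrightarrow> a' \<le> j \<Longrightarrow> j \<le> b \<Longrightarrow> y i < y j \<Longrightarrow> w i < w j"
  shows "good a' b y"
  using assms by (intro good_transfer[OF assms(1), where h = "\<lambda>i. i"]) auto

lemma split_good:
  assumes w: "w permutes {a..b}" and good: "good a b w" and k: "a \<le> k" "k < b" and sub: "w ` {a..k} \<subseteq> {a..Suc k}"
  obtains x y where "x permutes {a..Suc k}" "good a (Suc k) x" "y permutes {Suc k..b}" "good (Suc k) b y" "w = x \<circ> y"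
    "\<And>i. a \<le> i \<Longrightarrow> i \<le> k \<Longrightarrow> x i = w i" "decreasing_below a b w \<longrightarrow> decreasing_below a (Suc k) x"
proof (rule permutes_split[OF w k sub])
  fix x y h
  assume x: "x permutes {a..Suc k}" and y: "y permutes {Suc k..b}" and wxy: "w = x \<circ> y"
    and h: "\<And>i. a \<le> i \<Longrightarrow> i \<le> k \<Longrightarrow> x i = w i \<and> h i = i" "k < h (Suc k)" "h (Suc k) \<le> b" "x (Suc k) = w (h (Suc k))"
    and yw: "\<And>i j. Suc k \<le> i \<Longrightarrow> i \<le> b \<Longrightarrow> Suc k \<le> j \<Longrightarrow> j \<le> b \<Longrightarrow> y i < y j \<longleftrightarrow> w i < w j"
  have xh: "x i = w (h i)" and hr: "a \<le> h i \<and> h i \<le> b" if "a \<le> i" "i \<le> Suc k" for i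
    using h(1)[of i] h(2-4) that k by (cases "i = Suc k"; auto)+
  have hs: "h i < h j" if "a \<le> i" "i < j" "j \<le> Suc k" for i j
    using h(1)[of i] h(1)[of j] h(2) that by (cases "j = Suc k") auto
  have "good a (Suc k) x" using xh hr hs by (intro good_transfer[OF good, of a "Suc k" h x]) auto
  moreover have "good (Suc k) b y" using yw k by (intro good_mono[OF good]) auto
  moreover have "decreasing_below a (Suc k) x" if "decreasing_below a b w"
    unfolding decreasing_below_def
  proof (intro allI impI)
    fix i j assume "a \<le> i" "i < j" "j \<le> Suc k" "x i \<le> x a" "x j \<le> x a"
    then show "x j < x i"
      using that hs[of i j] hr[of i] hr[of j] xh[of i] xh[of j] h(1)[of a] k unfolding decreasing_below_def by auto
  qed
  ultimately show ?thesis using that x y wxy h(1) by blast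
qed

lemma polished_on_refl: "polished_on n a b id"
  unfolding polished_on_def by (intro exI[of _ "[]"]) simp

text \<open>The reversal comes from the pair ({a..<c}, {}), and a + 2 \<le> c puts both a and a + 1
  into its first component.\<close>

lemma strongly_polished_interval_rev:
  assumes "1 \<le> a" "a + 2 \<le> c" "c \<le> b" "b \<le> n" "polished_on n c b y"
  shows "strongly_polished_on n a b (interval_rev a c \<circ> y)"
proof -
  have "longest n {a..<c} = interval_rev a c"
    using assms by (intro longest_eqI is_longest_interval_rev) auto
  moreover have "longest n {} = id" by (intro longest_eqI is_longest_empty) simp
  ultimately have "interval_rev a c = list_prod n ([] @ ({a..<c}, {}) # [])"
    by (simp add: block_prod_def fun_eq_iff)
  moreover have "polished_list ([] @ ({a..<c}, {}) # [])"
    using dynkin_connected_interval by (simp add: totally_disconnected_def)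
  moreover have "support ([] @ ({a..<c}, {}) # []) \<subseteq> {a..<c}" by simp
  moreover have "a \<in> {a..<c}" "Suc a \<in> {a..<c}" using assms by auto
  ultimately have "strongly_polished_on n a c (interval_rev a c)"
    unfolding strongly_polished_on_def by blast
  then show ?thesis using strongly_polished_on_comp assms by auto
qed

text \<open>The values from w a down to a occur in decreasing order, so only larger values could
  intrude between them. None does before the position of a + 2: together with the first entry and
  the values a + 2, a + 1, a it would form 45321. Hence the values from w a down to a + 2 fill the
  first positions without gaps.\<close>

lemma decreasing_prefix:
  assumes w: "w permutes {a..b}" and good: "good a b w" and dec: "decreasing_below a b w" and c: "a + 2 \<le> w a"
    and i: "a \<le> i" "i + 2 \<le> w a"
  shows "w i = a + w a - i"
proof -
  let ?c = "w a"
  let ?P = "inv' w"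
  have wP: "w (?P v) = v" for v using permutes_inverses(1)[OF w] .
  have inj: "w p = w q \<Longrightarrow> p = q" for p q using permutes_inj[OF w] by (simp add: inj_eq)
  have cb: "?c \<le> b" using permutes_in_image[OF w, of a] permutes_not_in[OF w, of a] c by (cases "a \<in> {a..b}") auto
  have Pr: "a \<le> ?P v \<and> ?P v \<le> b" if "a \<le> v" "v \<le> b" for v
    using permutes_in_image[OF permutes_inv[OF w], of v] that by auto
  have Pdec: "?P v < ?P u" if "a \<le> u" "u < v" "v \<le> ?c" for u v
  proof (rule ccontr)
    assume "\<not> ?P v < ?P u"
    moreover have "?P v \<noteq> ?P u" using wP that by (metis less_irrefl)
    ultimately have "?P u < ?P v" by simp
    then have "w (?P v) < w (?P u)"
      using decreasing_belowD[OF dec, of "?P u" "?P v"] Pr[of u] Pr[of v] that cb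
      by (simp add: wP)
    then show False using wP that by simp
  qed
  have small: "w j \<le> ?c" if j: "a \<le> j" "j \<le> ?P (a + 2)" for j
  proof (rule ccontr)
    assume n: "\<not> w j \<le> ?c"
    then have "j \<noteq> a" by auto
    moreover have "j \<noteq> ?P (a + 2)" using n wP[of "a + 2"] c by auto
    ultimately have *: "a < j" "j < ?P (a + 2)" using j by auto
    have "?c \<noteq> a + 2" using * permutes_inverses(2)[OF w, of a] by auto
    then have "a + 2 < ?c" using c by simp
    moreover have "?P (a + 2) < ?P (a + 1)" "?P (a + 1) < ?P a" "?P a \<le> b"
      using Pdec[of "a + 1" "a + 2"] Pdec[of a "a + 1"] c Pr[of a] cb by auto
    ultimately show False
      using no_45321[OF good, of a j "?P (a + 2)" "?P (a + 1)" "?P a"] * n wP by simp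
  qed
  \<comment> \<open>Induction from w a downwards: if v did not directly follow v + 1, the entry
    after v + 1 would be small as well and have a value strictly between v and v + 1.\<close>
  have up: "?P v = a + ?c - v" if "v \<le> ?c" "a + 2 \<le> v" for v using that
  proof (induction rule: inc_induct)
    case base then show ?case using permutes_inverses(2)[OF w, of a] by simp
  next
    case (step v)
    then have IH: "?P (Suc v) = a + ?c - Suc v" by simp
    let ?q = "Suc (a + ?c - Suc v)"
    have v: "a + 2 \<le> v" "Suc v \<le> ?c" using step by auto
    have "?P (Suc v) < ?P v" using Pdec[of v "Suc v"] v by simp
    moreover have "\<not> ?q < ?P v"
    proof
      assume l: "?q < ?P v"
      moreover have "?P v \<le> ?P (a + 2)" using Pdec[of "a + 2" v] v by (cases "v = a + 2") auto
      moreover have "?P (Suc v) < ?q" using IH by simp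
      moreover have "a \<le> ?q" using v by simp
      ultimately have s: "w ?q \<le> ?c" using small[of ?q] by simp
      have vb: "?P v \<le> b" using Pr[of v] v cb by simp
      have "w ?q < w (?P (Suc v))"
        using decreasing_belowD[OF dec, of "?P (Suc v)" ?q] s Pr[of "Suc v"] v cb vb l \<open>?P (Suc v) < ?q\<close> wP[of "Suc v"] by auto
      moreover have "w (?P v) < w ?q"
        using decreasing_belowD[OF dec, of ?q "?P v"] s v l vb \<open>a \<le> ?q\<close> wP[of v] by auto
      ultimately show False using wP by simp
    qed
    ultimately show ?case using IH v by simp
  qed
  have "?P (a + ?c - i) = i" using up[of "a + ?c - i"] i by simp
  then show ?thesis using wP by metis
qed

text \<open>With c = w a and p = c - 1, the entries at the positions from a to p - 1 are c, c - 1,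
  ..., a + 2. The positions P2 of a + 1 and P1 of a decide the rest. If P2 = p, or if a does not
  directly follow a + 1, then w is a full reversal or splits at P2. If P2 > p and a follows
  directly, w0({a..p}) s_p is removed from the left. The case w a \<le> a + 1 splits at the first
  position.\<close>

lemma polished_step:
  assumes IH: "\<And>a' b' w'. b' - a' < b - a \<Longrightarrow> 1 \<le> a' \<Longrightarrow> b' \<le> n \<Longrightarrow> w' permutes {a'..b'} \<Longrightarrow> good a' b' w' \<Longrightarrow>
      polished_on n a' b' w'"
    and IH': "\<And>a' b' w'. b' - a' < b - a \<Longrightarrow> 1 \<le> a' \<Longrightarrow> b' \<le> n \<Longrightarrow> w' permutes {a'..b'} \<Longrightarrow> good a' b' w' \<Longrightarrow>
      decreasing_below a' b' w' \<Longrightarrow> a' + 2 \<le> w' a' \<Longrightarrow> w' (Suc a') + 1 = w' a' \<Longrightarrow> strongly_polished_on n a' b' w'"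
    and r: "1 \<le> a" "b \<le> n" and w: "w permutes {a..b}" and good: "good a b w" and dec: "decreasing_below a b w"
  shows "polished_on n a b w \<and> (a + 2 \<le> w a \<and> w (Suc a) + 1 = w a \<longrightarrow> strongly_polished_on n a b w)"
proof -
  let ?c = "w a"
  let ?P = "inv' w"
  have wP: "w (?P v) = v" and Pw: "?P (w v) = v" for v using permutes_inverses[OF w] .
  have inj: "w p = w q \<Longrightarrow> p = q" for p q using permutes_inj[OF w] by (simp add: inj_eq)
  have wr: "a \<le> w i \<and> w i \<le> b" if "a \<le> i" "i \<le> b" for i
    using permutes_in_image[OF w, of i] that by auto
  have Pr: "a \<le> ?P v \<and> ?P v \<le> b" if "a \<le> v" "v \<le> b" for v
    using permutes_in_image[OF permutes_inv[OF w], of v] that by auto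
  consider "b \<le> a" | "b = Suc a" | "a + 2 \<le> b" "?c \<le> a + 1" | "a + 2 \<le> b" "a + 2 \<le> ?c" by linarith
  then show ?thesis
  proof cases
    case 1
    then have "{a..b} = {} \<or> {a..b} = {a}" by auto
    then have "w = id" using w permutes_empty permutes_sing by metis
    then show ?thesis using polished_on_refl by auto
  next
    case 2
    then have ab: "w a = a \<and> w b = b \<or> w a = b \<and> w b = a"
    proof -
      have "w a \<noteq> w b" using inj[of a b] 2 by auto
      moreover have "w a = a \<or> w a = b" "w b = a \<or> w b = b" using wr[of a] wr[of b] 2 by linarith+
      ultimately show ?thesis by auto
    qed
    have out: "w i = i" if "i \<notin> {a, b}" for i using permutes_not_in[OF w, of i] that 2 by auto
    have "?c < a + 2" using ab 2 by auto
    moreover have "polished_on n a b w"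
    proof (cases "w a = a")
      case True
      then have "w i = i" for i using ab out[of i] 2 by (cases "i \<in> {a, b}") auto
      then have "w = id" by (simp add: fun_eq_iff)
      then show ?thesis using polished_on_refl by simp
    next
      case False
      then have eq: "w = transpose a (Suc a)" 
      proof (intro ext)
        fix i show "w i = transpose a (Suc a) i" using False ab out[of i] 2 by (cases "i \<in> {a, b}") auto
      qed
      have "longest n {a} = transpose a (Suc a)" using r 2 by (intro longest_eqI is_longest_transpose) auto
      moreover have "longest n {} = id" by (intro longest_eqI is_longest_empty) simp
      ultimately have "w = list_prod n [({a}, {})]" unfolding eq by (simp add: block_prod_def fun_eq_iff)
      moreover have "polished_list [({a}, {})]"
        using dynkin_connected_interval[of a "Suc a"] by (simp add: totally_disconnected_def)
      ultimately show ?thesis unfolding polished_on_def using 2 by (intro exI[of _ "[({a}, {})]"]) auto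
    qed
    ultimately show ?thesis by simp
  next
    case 3
    then have "w ` {a..a} \<subseteq> {a..Suc a}" using wr[of a] by auto
    then obtain x y where xy: "x permutes {a..Suc a}" "good a (Suc a) x" "y permutes {Suc a..b}" "good (Suc a) b y" "w = x \<circ> y"
      using split_good[OF w good, of a] 3 by (metis le_refl Suc_le_lessD add_2_eq_Suc' less_or_eq_imp_le Suc_leD)
    have "polished_on n a (Suc a) x" using xy r 3 by (intro IH) auto
    moreover have "polished_on n (Suc a) b y" using xy r 3 by (intro IH) auto
    ultimately have "polished_on n a b w" unfolding xy(5) by (rule polished_on_comp) (use 3 in auto)
    then show ?thesis using 3 by simp
  next
    case 4
    define P1 P2 where "P1 = ?P a" and "P2 = ?P (Suc a)"
    have w12: "w P1 = a" "w P2 = Suc a" unfolding P1_def P2_def by (rule wP)+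
    have cb: "?c \<le> b" using wr[of a] 4 by simp
    have pre: "w i = a + ?c - i" if "a \<le> i" "i + 2 \<le> ?c" for i
      using decreasing_prefix[OF w good dec 4(2) that] .
    have P12r: "a \<le> P1" "P1 \<le> b" "a \<le> P2" "P2 \<le> b"
      using Pr[of a] Pr[of "Suc a"] 4 unfolding P1_def P2_def by auto
    define p where "p = ?c - 1"
    have p: "Suc p = ?c" "a < p" using 4 unfolding p_def by auto
    have pP: "p \<le> P2" "p \<le> P1"
      using pre[of P2] pre[of P1] w12 P12r p by (cases "P2 + 2 \<le> ?c"; cases "P1 + 2 \<le> ?c"; simp)+
    have small: "i + 2 \<le> ?c \<or> i = P2 \<or> i = P1" if "a \<le> i" "w i \<le> ?c" "i \<le> b" for i
    proof (cases "a + 2 \<le> w i")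
      case True
      have "w (a + ?c - w i) = w i" using pre[of "a + ?c - w i"] True that by simp
      then have "a + ?c - w i = i" by (rule inj)
      then show ?thesis using True that by auto
    next
      case False
      then have "w i = a \<or> w i = Suc a" using wr[of i] that by auto
      then show ?thesis using w12 inj by metis
    qed
    have P21: "P2 < P1"
    proof (rule ccontr)
      assume "\<not> P2 < P1"
      moreover have "P1 \<noteq> P2" using w12 by auto
      ultimately show False using dec P12r w12 4 unfolding decreasing_below_def
        by (metis Suc_leD add_2_eq_Suc' le_SucI le_trans lessI less_SucI less_imp_not_less linorder_neqE_nat nat_le_linear)
    qed
    have large: "?c < w i" if "p \<le> i" "i \<le> b" "i \<noteq> P2" "i \<noteq> P1" for i
      using small[of i] that p by (cases "w i \<le> ?c") auto
    show ?thesis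
    proof (cases "P2 = p")
      case True
      have "w ` {a..p} \<subseteq> {a..Suc p}"
      proof
        fix v assume "v \<in> w ` {a..p}"
        then obtain i where i: "a \<le> i" "i \<le> p" "v = w i" by auto
        show "v \<in> {a..Suc p}" using pre[of i] i True w12 p by (cases "i = p") auto
      qed
      show ?thesis
      proof (cases "?c = b")
        case True
        have P1b: "P1 = b" using pP P21 P12r p True \<open>P2 = p\<close> by simp
        have "w i = interval_rev a b i" for i
        proof -
          consider "i \<notin> {a..b}" | "a \<le> i" "i + 2 \<le> b" | "i = p" | "i = b" using p True by force
          then show ?thesis
          proof cases
            case 1 then show ?thesis using permutes_not_in[OF w, of i] by (auto simp: interval_rev_def)
          next
            case 2 then show ?thesis using pre[of i] True by (auto simp: interval_rev_def)
          next
            case 3 then show ?thesis using w12 \<open>P2 = p\<close> p True by (auto simp: interval_rev_def)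
          next
            case 4 then show ?thesis using w12 P1b P12r by (auto simp: interval_rev_def)
          qed
        qed
        then have "w = interval_rev a b \<circ> id" by auto
        then have "strongly_polished_on n a b w"
          using strongly_polished_interval_rev[OF r(1), of b b n id] 4 r polished_on_refl by simp
        then show ?thesis using strongly_polished_imp by blast
      next
        case False
        then have k: "a \<le> p" "p < b" using p cb by auto
        obtain x y where xy: "x permutes {a..Suc p}" "good a (Suc p) x" "y permutes {Suc p..b}" "good (Suc p) b y" "w = x \<circ> y"
          "decreasing_below a b w \<longrightarrow> decreasing_below a (Suc p) x" "\<And>i. a \<le> i \<Longrightarrow> i \<le> p \<Longrightarrow> x i = w i"
          using split_good[OF w good k \<open>w ` {a..p} \<subseteq> {a..Suc p}\<close>] by metis
        have yp: "polished_on n (Suc p) b y" by (rule IH) (use xy(3,4) r p k in auto)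
        have "x a = ?c" "x p = Suc a" using xy(7)[of a] xy(7)[of p] k w12 True by auto
        moreover have "x (Suc a) + 1 = ?c"
        proof (cases "Suc a = p")
          case True then show ?thesis using \<open>x p = Suc a\<close> p by simp
        next
          case False then show ?thesis using xy(7)[of "Suc a"] pre[of "Suc a"] p k by simp
        qed
        ultimately have xs: "a + 2 \<le> x a" "x (Suc a) + 1 = x a" using 4 by auto
        have xd: "decreasing_below a (Suc p) x" using xy(6) dec by blast
        have lt: "Suc p - a < b - a" "Suc p \<le> n" using False p cb k r by linarith+
        have "strongly_polished_on n a (Suc p) x"
          by (rule IH'[OF lt(1) r(1) lt(2) xy(1,2) xd xs])
        then have "strongly_polished_on n a b w"
          unfolding xy(5) by (rule strongly_polished_on_comp[OF _ yp]) (use k in auto)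
        then show ?thesis using strongly_polished_imp by blast
      qed
    next
      case P2p: False
      then have pP2: "p < P2" using pP by simp
      let ?y = "w p"
      have yc: "?c < ?y" using large[of p] pP2 P21 P12r by simp
      show ?thesis
      proof (cases "P1 = Suc P2")
        case False
        define z where "z = Suc P2"
        have z: "P2 < z" "z < P1" using False P21 unfolding z_def by auto
        define k where "k = P2"
        \<comment> \<open>Avoiding 34521 keeps the entries before P2 at most w p, avoiding 4231
          makes those between P2 and P1 larger than w p, and avoiding 3412 brings every value above
          a and up to w p to a position not after P2. Counting these values gives w p \<le> P2 + 1,
          so w maps {a..P2} into {a..P2+1} and splits there.\<close>
        have wbelow: "w i \<le> ?y" if "p \<le> i" "i < P2" for i
        proof (rule ccontr)
          assume n: "\<not> w i \<le> ?y"
          then have "p < i" using that by (cases "i = p") auto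
          then show False using no_34521[OF good, of a p i P2 P1] n that p yc P21 P12r w12 4 by auto
        qed
        have zy: "?y < w z'" if "P2 < z'" "z' < P1" for z'
        proof (rule ccontr)
          assume "\<not> ?y < w z'"
          then have "w z' < ?y" using inj[of z' p] that pP2 by (metis less_asym linorder_neqE_nat)
          moreover have "?c < w z'" using large[of z'] that pP2 P12r by simp
          ultimately show False using no_4231[OF good, of p P2 z' P1] that pP2 p P12r w12 4 by auto
        qed
        have pos: "?P v \<le> P2" if v: "a < v" "v \<le> ?y" for v
        proof (rule ccontr)
          assume n: "\<not> ?P v \<le> P2"
          have vb: "v \<le> b" using v wr[of p] p pP2 P12r by simp
          have "?P v \<noteq> P1" using w12 wP v by (metis less_irrefl)
          moreover have "\<not> ?P v < P1" using zy[of "?P v"] n wP v by auto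
          ultimately have "P1 < ?P v" by simp
          moreover have "v \<noteq> ?y" using n pP2 Pw by auto
          ultimately show False
            using no_3412[OF good, of p z P1 "?P v"] z pP2 p zy[of z] wP w12 v Pr[of v] vb by auto
        qed
        have "{Suc a..?y} \<subseteq> w ` {a..P2}"
        proof
          fix v assume "v \<in> {Suc a..?y}"
          then have v: "a < v" "v \<le> ?y" by auto
          then have "v \<le> b" using wr[of p] p pP2 P12r by simp
          then have "?P v \<in> {a..P2}" using pos v Pr[of v] by auto
          then show "v \<in> w ` {a..P2}" using wP by (metis imageI)
        qed
        then have "card {Suc a..?y} \<le> card (w ` {a..P2})" by (intro card_mono) auto
        also have "\<dots> \<le> Suc P2 - a" using card_image_le[of "{a..P2}" w] by simp
        finally have yP: "?y \<le> Suc P2" using P12r yc p by simp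
        have sub: "w ` {a..P2} \<subseteq> {a..Suc P2}"
        proof
          fix v assume "v \<in> w ` {a..P2}"
          then obtain i where i: "a \<le> i" "i \<le> P2" "v = w i" by auto
          have "w i \<le> ?y"
          proof (cases "i < p")
            case True then show ?thesis using pre[of i] i p yc by simp
          next
            case False then show ?thesis using wbelow[of i] i w12 yc 4 by (cases "i = P2") auto
          qed
          then show "v \<in> {a..Suc P2}" using i yP wr[of i] P12r by auto
        qed
        have k: "a \<le> P2" "P2 < b" "Suc P2 < b" using P12r z by auto
        obtain x y where xy: "x permutes {a..Suc P2}" "good a (Suc P2) x" "y permutes {Suc P2..b}" "good (Suc P2) b y" "w = x \<circ> y"
          "decreasing_below a b w \<longrightarrow> decreasing_below a (Suc P2) x" "\<And>i. a \<le> i \<Longrightarrow> i \<le> P2 \<Longrightarrow> x i = w i"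
          using split_good[OF w good k(1,2) sub] by metis
        have yp: "polished_on n (Suc P2) b y" by (rule IH) (use xy(3,4) r k in auto)
        have xp: "polished_on n a (Suc P2) x" by (rule IH) (use xy(1,2) r k in auto)
        have "polished_on n a b w" unfolding xy(5) by (rule polished_on_comp[OF xp yp]) (use k in auto)
        moreover have "strongly_polished_on n a b w" if "w (Suc a) + 1 = ?c"
        proof -
          have "x a = w a" "x (Suc a) = w (Suc a)" using xy(7) k pP2 p by auto
          then have "strongly_polished_on n a (Suc P2) x"
            by (intro IH') (use xy(1,2,6) r k 4 dec that in auto)
          then show ?thesis unfolding xy(5) by (rule strongly_polished_on_comp[OF _ yp]) (use k in auto)
        qed
        ultimately show ?thesis by blast
      next
        case P1S: True
        \<comment> \<open>Removing w0({a..p}) s_p turns the prefix into fixed points and the values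
          a + 1 and a into p + 1 and p, and it leaves all values above p + 1 alone. Thus y lives on
          {p..b} and has the same relative order as w there.\<close>
        define y where "y = transpose p (Suc p) \<circ> (interval_rev a (Suc p) \<circ> w)"
        have wy: "w = interval_rev a (Suc p) \<circ> transpose p (Suc p) \<circ> y"
          unfolding y_def by (simp add: fun_eq_iff interval_rev_involution)
        have yP2: "y P2 = Suc p" and yP1: "y P1 = p"
        proof -
          have "interval_rev a (Suc p) (Suc a) = p" "interval_rev a (Suc p) a = Suc p"
            using p by (auto simp: interval_rev_def)
          then show "y P2 = Suc p" "y P1 = p" unfolding y_def by (simp_all add: w12)
        qed
        have ybig: "y i = w i" if "Suc p < w i" for i
          unfolding y_def using that p by (auto simp: interval_rev_def)
        have yfix: "y i = i" if "i \<notin> {p..b}" for i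
        proof (cases "i \<in> {a..b}")
          case True
          then have i: "a \<le> i" "i < p" using that by auto
          then have "w i = a + Suc p - i" using pre[of i] p by simp
          then have "interval_rev a (Suc p) (w i) = i" using i by (auto simp: interval_rev_def)
          then show ?thesis unfolding y_def using i by simp
        next
          case False
          then have "w i = i" using permutes_not_in[OF w] by blast
          moreover have "interval_rev a (Suc p) i = i" "i \<noteq> p" "i \<noteq> Suc p"
            using False p cb by (auto simp: interval_rev_def)
          ultimately show ?thesis unfolding y_def by simp
        qed
        have bij: "bij y" unfolding y_def
          by (intro bij_comp permutes_bij[OF w] involuntory_imp_bij) (auto simp: interval_rev_involution)
        have yp: "y permutes {p..b}" unfolding permutes_def using yfix bij by (metis bij_pointE)
        have val: "(i = P2 \<and> y i = Suc p \<and> w i = Suc a) \<or> (i = P1 \<and> y i = p \<and> w i = a) \<or>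
           (i \<noteq> P2 \<and> i \<noteq> P1 \<and> y i = w i \<and> Suc p < w i)" if "p \<le> i" "i \<le> b" for i
          using large[of i] ybig[of i] that p yP1 yP2 w12 by auto
        have yw: "y i < y j \<longleftrightarrow> w i < w j" if "p \<le> i" "i \<le> b" "p \<le> j" "j \<le> b" for i j
          using val[OF that(1,2)] val[OF that(3,4)] p by auto
        have gy: "good p b y" using yw p by (intro good_mono[OF good]) auto
        let ?v = "inv' y"
        have yv: "y (?v i) = i" and vy: "?v (y i) = i" for i using permutes_inverses[OF yp] .
        have vp: "?v p = P1" "?v (Suc p) = P2" using vy[of P1] vy[of P2] yP1 yP2 by auto
        have vperm: "?v permutes {p..b}" using permutes_inv[OF yp] .
        have gv: "good p b ?v" using good_inv[OF yp gy] .
        \<comment> \<open>An increase before P2 would complete a 34521 whose 3 is the first entry of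
          w. As p + 1 and p stand at P2 and P1 = P2 + 1, the inverse of y is decreasing below its
          first value P1, and its second value is P1 - 1: this is what the strong induction
          hypothesis asks for.\<close>
        have ydec: "y j < y i" if ij: "p \<le> i" "i < j" "j \<le> P1" for i j
        proof -
          have jb: "j \<le> b" using ij P12r by simp
          show ?thesis
          proof (cases "j < P2")
            case True
            then have "w i \<noteq> w j \<and> ?c < w i \<and> ?c < w j" using large[of i] large[of j] ij jb P21 inj[of i j] by auto
            moreover have "\<not> w i < w j"
              using no_34521[OF good, of a i j P2 P1] True ij p P21 P12r w12 4 calculation by auto
            ultimately show ?thesis using ybig[of i] ybig[of j] p by auto
          next
            case False
            then have "j = P2 \<or> j = P1" using ij P1S by auto
            then show ?thesis using val[of i] ij jb yP1 yP2 P21 by auto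
          qed
        qed
        have dv: "decreasing_below p b ?v" unfolding decreasing_below_def
        proof (intro allI impI)
          fix i j assume ij: "p \<le> i" "i < j" "j \<le> b" "?v i \<le> ?v p" "?v j \<le> ?v p"
          have "p \<le> ?v i" "p \<le> ?v j" using permutes_in_image[OF vperm, of i] permutes_in_image[OF vperm, of j] ij by auto
          moreover have "?v i \<noteq> ?v j" using ij yv by (metis less_irrefl)
          ultimately show "?v j < ?v i"
            using ydec[of "?v i" "?v j"] ij vp yv[of i] yv[of j] by (cases "?v i < ?v j") auto
        qed
        have "strongly_polished_on n p b ?v"
          using vperm gv dv vp P1S pP2 r p cb by (intro IH') auto
        moreover have "p < b" using p cb by simp
        ultimately obtain Js J J' Js' where A: "polished_list (Js @ (J, J') # Js')" "support (Js @ (J, J') # Js') \<subseteq> {a..<b}"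
          "w = list_prod n (Js @ (J, J') # Js')" "{a..p} \<subseteq> J" "J' \<subseteq> {p..}"
          using attach_interval[OF _ bij r(1) p(2) _ r(2)] wy by metis
        have "polished_on n a b w" unfolding polished_on_def using A by blast
        moreover have "strongly_polished_on n a b w" if "w (Suc a) + 1 = ?c"
        proof -
          \<comment> \<open>For p = a + 1 the second entry would be w p, which exceeds w a. So a and
            a + 1 are both smaller than p, hence in J and not in J'.\<close>
          have "Suc a < p"
          proof (rule ccontr)
            assume "\<not> Suc a < p"
            then have "Suc a = p" using p by simp
            then show False using that yc by simp
          qed
          then have "a \<in> J" "Suc a \<in> J" "a \<notin> J'" "Suc a \<notin> J'" using A(4,5) by auto
          then show ?thesis unfolding strongly_polished_on_def using A by blast
        qed
        ultimately show ?thesis by blast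
      qed
    qed
  qed
qed

text \<open>If w is not decreasing below its first value, its inverse is, and polishedness passes
  back to w. The strong form is claimed in the decreasing case only, because inversion exchanges J
  and J'.\<close>

lemma good_polished_on:
  assumes "1 \<le> a" "b \<le> n" "w permutes {a..b}" "good a b w"
  shows "polished_on n a b w \<and>
    (decreasing_below a b w \<and> a + 2 \<le> w a \<and> w (Suc a) + 1 = w a \<longrightarrow> strongly_polished_on n a b w)"
  using assms
proof (induction "b - a" arbitrary: a b w rule: less_induct)
  case less
  have *: "polished_on n a b u \<and> (a + 2 \<le> u a \<and> u (Suc a) + 1 = u a \<longrightarrow> strongly_polished_on n a b u)"
    if "u permutes {a..b}" "good a b u" "decreasing_below a b u" for u
    by (rule polished_step) (use less that in auto)
  have "polished_on n a b w"
  proof (cases "decreasing_below a b w")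
    case False
    then have "decreasing_below a b (inv' w)" using decreasing_below_or_inv less.prems by blast
    then have "polished_on n a b (inv' w)"
      using *[of "inv' w"] permutes_inv[OF less.prems(3)] good_inv[OF less.prems(3,4)] by blast
    then have "polished_on n a b (inv' (inv' w))" using polished_on_inv less.prems by blast
    then show ?thesis using permutes_bij[OF less.prems(3)] by (simp add: inv_inv_eq)
  qed (use * less.prems in blast)
  then show ?case using * less.prems by blast
qed

lemma good_imp_polished:
  assumes "w permutes {1..n}" "good 1 n w" shows "polished n w"
  using good_polished_on[of 1 n n w] assms unfolding polished_on_def polished_iff by auto

section \<open>Self-duality and the two graphs\<close>

lemma unit_step_iff_less: "unit_step n u v \<longleftrightarrow> bruhat_less n u v \<and> perm_length n v = Suc (perm_length n u)"
proof
  assume u: "unit_step n u v"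
  then show "bruhat_less n u v \<and> perm_length n v = Suc (perm_length n u)"
    using unit_step_less[OF u] by (simp add: unit_step_def)
qed (simp add: bruhat_less_unit_step)

lemma cover_graph_edge_iff:
  "{u, v} \<in> snd (cover_graph n A B) \<longleftrightarrow>
     (u \<in> A \<and> v \<in> B \<or> v \<in> A \<and> u \<in> B) \<and> (unit_step n u v \<or> unit_step n v u)"
  unfolding cover_graph_def bruhat_covers_iff_unit_step by (auto simp: doubleton_eq_iff)

lemma fst_cover_graph [simp]: "fst (cover_graph n A B) = A \<union> B"
  unfolding cover_graph_def by simp

lemma lower_interval_trans:
  "bruhat_less n u v \<Longrightarrow> v \<in> lower_interval n w \<Longrightarrow> u \<in> lower_interval n w"
  unfolding lower_interval_less using bruhat_less_permutes bruhat_less_trans by blast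

lemma exists_upper_cover:
  assumes "u \<in> lower_interval n w" "u \<noteq> w"
  shows "\<exists>v\<in>lower_interval n w. unit_step n u v"
proof -
  have "(unit_step n)\<^sup>+\<^sup>+ u w" using assms unfolding lower_interval_less bruhat_less_unit_chain by blast
  from tranclpD[OF this] obtain v where v: "unit_step n u v" "(unit_step n)\<^sup>*\<^sup>* v w" by blast
  have "v = w \<or> bruhat_less n v w" using rtranclpD[OF v(2)] unfolding bruhat_less_unit_chain by blast
  moreover have "v permutes {1..n}" using unit_step_less[OF v(1)] bruhat_less_permutes by blast
  ultimately have "v \<in> lower_interval n w" unfolding lower_interval_less by blast
  then show ?thesis using v(1) by blast
qed

lemma exists_lower_cover:
  assumes "u permutes {1..n}" "u \<noteq> id"
  shows "\<exists>v. unit_step n v u"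
proof -
  have "(unit_step n)\<^sup>+\<^sup>+ id u" using bruhat_less_id[OF assms] unfolding bruhat_less_unit_chain .
  then show ?thesis by (cases rule: tranclp.cases) auto
qed

text \<open>An order-reversing bijection sends length k to l(w) - k. One inequality comes from
  climbing covers up to w, the other from descending to the identity: a cover changes the length by
  one, its image changes it by at least one in the opposite direction. Then levels 1 and 2 go to the
  two levels just below w, together with their covers.\<close>

lemma self_dual_graph_isomorphic:
  assumes w: "w permutes {1..n}" and sd: "self_dual (lower_interval n w) (bruhat_le n)"
  shows "graph_isomorphic (Gamma_lower n w) (Gamma_upper n w)"
proof -
  let ?Q = "lower_interval n w" and ?l = "perm_length n"
  obtain f where bij: "bij_betw f ?Q ?Q"
    and f: "\<And>x y. x \<in> ?Q \<Longrightarrow> y \<in> ?Q \<Longrightarrow> bruhat_le n x y \<longleftrightarrow> bruhat_le n (f y) (f x)"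
    using sd unfolding self_dual_def poset_isomorphic_def by blast
  have fQ: "f x \<in> ?Q" if "x \<in> ?Q" for x using bij that by (rule bij_betw_apply)
  have inj: "f x = f y \<longleftrightarrow> x = y" if "x \<in> ?Q" "y \<in> ?Q" for x y
    using bij that unfolding bij_betw_def inj_on_def by blast
  have le: "bruhat_less n x y \<longleftrightarrow> bruhat_le n x y \<and> x \<noteq> y" for x y
    unfolding bruhat_le_def using bruhat_less_length by blast
  have less: "bruhat_less n x y \<longleftrightarrow> bruhat_less n (f y) (f x)" if "x \<in> ?Q" "y \<in> ?Q" for x y
    unfolding le using f[OF that] inj[OF that] by metis
  have wQ: "w \<in> ?Q" using w unfolding lower_interval_less by simp
  have lw: "?l u \<le> ?l w" if "u \<in> ?Q" for u
    using that bruhat_less_length unfolding lower_interval_less by fastforce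
  have ge: "?l w \<le> ?l (f u) + ?l u" if "u \<in> ?Q" for u using that
  proof (induction "?l w - ?l u" arbitrary: u rule: less_induct)
    case less
    show ?case
    proof (cases "u = w")
      case False
      then obtain v where v: "v \<in> ?Q" "unit_step n u v" using exists_upper_cover less.prems by blast
      then have uv: "bruhat_less n u v" "?l v = Suc (?l u)" unfolding unit_step_iff_less by auto
      then have "?l w \<le> ?l (f v) + ?l v" using v lw[OF v(1)] by (intro less.hyps) auto
      moreover have "bruhat_less n (f v) (f u)"
        using uv(1) v(1) less.prems \<open>\<And>y x. x \<in> ?Q \<Longrightarrow> y \<in> ?Q \<Longrightarrow> bruhat_less n x y \<longleftrightarrow> bruhat_less n (f y) (f x)\<close> by blast
      ultimately show ?thesis using bruhat_less_length[of n "f v" "f u"] uv by simp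
    qed simp
  qed
  have ub: "?l (f u) + ?l u \<le> ?l w" if "u \<in> ?Q" for u using that
  proof (induction "?l u" arbitrary: u rule: less_induct)
    case less
    have up: "u permutes {1..n}" using less.prems unfolding lower_interval_less by blast
    show ?case
    proof (cases "u = id")
      case True
      then show ?thesis using lw[OF fQ[OF less.prems]] perm_length_0_iff[OF up] by simp
    next
      case False
      then obtain v where v: "unit_step n v u" using exists_lower_cover up by blast
      then have uv: "bruhat_less n v u" "?l u = Suc (?l v)" unfolding unit_step_iff_less by auto
      have vQ: "v \<in> ?Q" using lower_interval_trans[OF uv(1) less.prems] .
      have "?l (f v) + ?l v \<le> ?l w" using uv vQ by (intro less.hyps) auto
      moreover have "bruhat_less n (f u) (f v)"
        using uv(1) vQ less.prems \<open>\<And>y x. x \<in> ?Q \<Longrightarrow> y \<in> ?Q \<Longrightarrow> bruhat_less n x y \<longleftrightarrow> bruhat_less n (f y) (f x)\<close> by blast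
      ultimately show ?thesis using bruhat_less_length[of n "f u" "f v"] uv by simp
    qed
  qed
  have fl: "int (?l (f u)) = int (?l w) - int (?l u)" if "u \<in> ?Q" for u
    using ge[OF that] ub[OF that] by simp
  have us: "unit_step n x y \<longleftrightarrow> unit_step n (f y) (f x)" if "x \<in> ?Q" "y \<in> ?Q" for x y
    unfolding unit_step_iff_less using less[OF that] fl[OF that(1)] fl[OF that(2)] by auto
  have rank: "u \<in> rank_level n w k \<longleftrightarrow> f u \<in> rank_level n w (int (?l w) - k)" if "u \<in> ?Q" for u k
    using fl[OF that] fQ[OF that] that unfolding rank_level_def by auto
  have sub: "rank_level n w k \<subseteq> ?Q" for k unfolding rank_level_def by auto
  have img: "f ` rank_level n w k = rank_level n w (int (?l w) - k)" for k
  proof (intro equalityI subsetI)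
    fix v assume v: "v \<in> rank_level n w (int (?l w) - k)"
    then have "v \<in> f ` ?Q" using sub bij unfolding bij_betw_def by blast
    then show "v \<in> f ` rank_level n w k" using v rank by blast
  next
    fix v assume "v \<in> f ` rank_level n w k"
    then show "v \<in> rank_level n w (int (?l w) - k)" using rank sub by blast
  qed
  let ?V = "rank_level n w 1 \<union> rank_level n w 2"
  have V: "?V \<subseteq> ?Q" using sub by blast
  have "bij_betw f ?V (rank_level n w (int (?l w) - 1) \<union> rank_level n w (int (?l w) - 2))"
    using bij_betw_subset[OF bij V, of "f ` ?V"] img[of 1] img[of 2] by (simp add: image_Un)
  moreover have "{u, v} \<in> snd (Gamma_lower n w) \<longleftrightarrow> {f u, f v} \<in> snd (Gamma_upper n w)"
    if "u \<in> ?V" "v \<in> ?V" for u v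
  proof -
    have "u \<in> ?Q" "v \<in> ?Q" using that V by auto
    then show ?thesis unfolding Gamma_lower_def Gamma_upper_def cover_graph_edge_iff
      using rank[of u 1] rank[of u 2] rank[of v 1] rank[of v 2] us[of u v] us[of v u] by blast
  qed
  ultimately show ?thesis unfolding graph_isomorphic_def Gamma_lower_def Gamma_upper_def fst_cover_graph by blast
qed

section \<open>Counting atoms and coatoms\<close>

lemma graph_iso_card_edges:
  assumes bij: "bij_betw f V V'" and e: "\<And>u v. u \<in> V \<Longrightarrow> v \<in> V \<Longrightarrow> {u, v} \<in> E \<longleftrightarrow> {f u, f v} \<in> E'"
  shows "card {(u, v). u \<in> V \<and> v \<in> V \<and> {u, v} \<in> E} = card {(u, v). u \<in> V' \<and> v \<in> V' \<and> {u, v} \<in> E'}"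
proof (rule bij_betw_same_card)
  have "inj_on f V" "f ` V = V'" using bij unfolding bij_betw_def by auto
  then show "bij_betw (map_prod f f) {(u, v). u \<in> V \<and> v \<in> V \<and> {u, v} \<in> E} {(u, v). u \<in> V' \<and> v \<in> V' \<and> {u, v} \<in> E'}"
    using e by (fastforce simp: bij_betw_def inj_on_def)
qed

text \<open>Ordered pairs are counted because an isomorphism may mix the two sides; every edge then
  appears in both orientations.\<close>

lemma card_bipartite_pairs:
  assumes fin: "finite A" "finite B" and disj: "A \<inter> B = {}" and R: "\<And>u v. R u v \<longleftrightarrow> R v u"
  shows "card {(u, v). u \<in> A \<union> B \<and> v \<in> A \<union> B \<and> (u \<in> A \<and> v \<in> B \<or> v \<in> A \<and> u \<in> B) \<and> R u v}
       = 2 * (\<Sum>v\<in>B. card {u\<in>A. R u v})"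
proof -
  let ?P = "Sigma B (\<lambda>v. {u\<in>A. R u v})"
  have P: "card ?P = (\<Sum>v\<in>B. card {u\<in>A. R u v})" using fin by (intro card_SigmaI) auto
  have finP: "finite ?P" using fin by auto
  have "{(u, v). u \<in> A \<union> B \<and> v \<in> A \<union> B \<and> (u \<in> A \<and> v \<in> B \<or> v \<in> A \<and> u \<in> B) \<and> R u v} = ?P \<union> ?P\<inverse>"
    using R by auto
  moreover have "?P \<inter> ?P\<inverse> = {}" using disj by auto
  ultimately show ?thesis using finP P by (simp add: card_Un_disjoint card_inverse)
qed

definition preserves :: "(nat \<Rightarrow> nat) \<Rightarrow> nat \<Rightarrow> bool" where
  "preserves u k \<longleftrightarrow> (\<forall>i. 1 \<le> i \<longrightarrow> i \<le> k \<longrightarrow> u i \<le> k)"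

text \<open>For a permutation u of {1..n} these are the indices of the generators occurring in
  reduced words of u, expressed without words.\<close>

definition perm_support :: "nat \<Rightarrow> (nat \<Rightarrow> nat) \<Rightarrow> nat set" where
  "perm_support n u = {k. 1 \<le> k \<and> k < n \<and> \<not> preserves u k}"

text \<open>A descending step moves the larger of two values to the right, so it cannot bring a
  value beyond k into the first k positions.\<close>

lemma bruhat_step_preserves:
  assumes "bruhat_step n u v" "preserves v k" shows "preserves u k"
  unfolding preserves_def
proof (intro allI impI)
  fix r assume r: "1 \<le> r" "r \<le> k"
  obtain i j where ij: "1 \<le> i" "i < j" "v j < v i" "u = v \<circ> transpose i j"
    using assms(1) unfolding bruhat_step_down_iff by blast
  consider "r = i" | "r = j" | "r \<noteq> i" "r \<noteq> j" by blast
  then show "u r \<le> k"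
  proof cases
    case 1
    then have "v i \<le> k" using assms(2) r ij unfolding preserves_def by blast
    then show ?thesis using 1 ij by simp
  next
    case 2
    then have "v i \<le> k" using assms(2) r ij unfolding preserves_def by simp
    then show ?thesis using 2 ij by simp
  next
    case 3
    then show ?thesis using assms(2) r ij unfolding preserves_def by simp
  qed
qed

lemma bruhat_less_preserves: "bruhat_less n u v \<Longrightarrow> preserves v k \<Longrightarrow> preserves u k"
  unfolding bruhat_less_def by (induction rule: tranclp_induct) (auto dest: bruhat_step_preserves)

section \<open>Generators and elements of length two\<close>

lemma not_preserves_simple_refl: "1 \<le> i \<Longrightarrow> \<not> preserves (simple_refl i) i"
  unfolding preserves_def simple_refl_def by auto

lemma preserves_simple_refl: "i \<noteq> k \<Longrightarrow> preserves (simple_refl i) k"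
  unfolding preserves_def simple_refl_def Transposition.transpose_def by auto

lemma simple_refl_maps_positive: "1 \<le> i \<Longrightarrow> 1 \<le> r \<Longrightarrow> 1 \<le> simple_refl i r"
  unfolding simple_refl_def Transposition.transpose_def by auto

lemma preserves_simple_refl_comp:
  assumes "i \<noteq> k" "j \<noteq> k" "1 \<le> j" shows "preserves (simple_refl i \<circ> simple_refl j) k"
  unfolding preserves_def
proof (intro allI impI)
  fix r assume r: "1 \<le> r" "r \<le> k"
  then have "simple_refl j r \<le> k" "1 \<le> simple_refl j r"
    using preserves_simple_refl[OF assms(2)] simple_refl_maps_positive[OF assms(3)] unfolding preserves_def by auto
  then show "(simple_refl i \<circ> simple_refl j) r \<le> k"
    using preserves_simple_refl[OF assms(1)] unfolding preserves_def by simp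
qed

lemma simple_refl_inject: "simple_refl i = simple_refl j \<Longrightarrow> i = j"
  using preserves_simple_refl[of i j] not_preserves_simple_refl[of j]
  by (cases "j = 0") (force simp: simple_refl_def fun_eq_iff Transposition.transpose_def split: if_splits)+

lemma simple_refl_involution: "simple_refl i \<circ> simple_refl i = id"
  unfolding simple_refl_def by simp

lemma perm_length_id: "perm_length n id = 0"
  using perm_length_0_iff[of id n] permutes_id by blast

lemma simple_descent:
  assumes "u permutes {1..n}" "u \<noteq> id"
  obtains k where "1 \<le> k" "k < n" "u \<circ> simple_refl k permutes {1..n}"
    "perm_length n u = Suc (perm_length n (u \<circ> simple_refl k))" "u = (u \<circ> simple_refl k) \<circ> simple_refl k"
proof -
  obtain k where k: "1 \<le> k" "k < n" "u (Suc k) < u k" using exists_descent assms by blast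
  have "u \<circ> simple_refl k permutes {1..n}"
    using permutes_transpose_interval[of k "Suc k" n u] k assms(1) by (simp add: simple_refl_def)
  moreover have "perm_length n u = Suc (perm_length n (u \<circ> simple_refl k))"
    using perm_length_simple_down[of k n u] k by (simp add: simple_refl_def)
  moreover have "u = (u \<circ> simple_refl k) \<circ> simple_refl k" by (simp add: comp_assoc simple_refl_def)
  ultimately show ?thesis using k that by blast
qed

lemma length_1:
  assumes "u permutes {1..n}" "perm_length n u = 1"
  obtains k where "1 \<le> k" "k < n" "u = simple_refl k"
proof -
  have "u \<noteq> id" using assms perm_length_id by auto
  then obtain k where k: "1 \<le> k" "k < n" "u \<circ> simple_refl k permutes {1..n}"
    "perm_length n u = Suc (perm_length n (u \<circ> simple_refl k))" "u = (u \<circ> simple_refl k) \<circ> simple_refl k"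
    using simple_descent assms(1) by blast
  then have "u \<circ> simple_refl k = id" using perm_length_0_iff[OF k(3)] assms(2) by simp
  then have "u = id \<circ> simple_refl k" using k(5) by (simp only:)
  then show ?thesis using k that by simp
qed

lemma length_2:
  assumes "z permutes {1..n}" "perm_length n z = 2"
  obtains m k where "1 \<le> m" "m < n" "1 \<le> k" "k < n" "m \<noteq> k" "z = simple_refl m \<circ> simple_refl k"
    "perm_length n (simple_refl m) = 1" "simple_refl m permutes {1..n}"
proof -
  have "z \<noteq> id" using assms perm_length_id by auto
  then obtain k where k: "1 \<le> k" "k < n" "z \<circ> simple_refl k permutes {1..n}"
    "perm_length n z = Suc (perm_length n (z \<circ> simple_refl k))" "z = (z \<circ> simple_refl k) \<circ> simple_refl k"
    using simple_descent assms(1) by blast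
  then have l: "perm_length n (z \<circ> simple_refl k) = 1" using assms(2) by simp
  obtain m where m: "1 \<le> m" "m < n" "z \<circ> simple_refl k = simple_refl m" using length_1[OF k(3) l] by blast
  then have z: "z = simple_refl m \<circ> simple_refl k" using k(5) by (simp only:)
  then have "m \<noteq> k" using simple_refl_involution[of k] \<open>z \<noteq> id\<close> by auto
  then show ?thesis using that m k l z by auto
qed

lemma perm_length_simple_refl:
  assumes "1 \<le> k" "k < n" shows "perm_length n (simple_refl k) = 1"
  using perm_length_simple[of k n id] assms perm_length_id by (simp add: simple_refl_def)

lemma simple_refl_permutes: "1 \<le> k \<Longrightarrow> k < n \<Longrightarrow> simple_refl k permutes {1..n}"
  unfolding simple_refl_def by (intro permutes_swap_id) auto

text \<open>A product s_m s_k preserves {1..r} for every other r, and this property is inherited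
  downwards, so s_r cannot lie below it.\<close>

lemma length_2_lower_covers:
  assumes z: "z permutes {1..n}" "perm_length n z = 2"
    and i: "unit_step n (simple_refl i) z" "1 \<le> i" and j: "unit_step n (simple_refl j) z" "1 \<le> j" and ij: "i \<noteq> j"
  shows "z = simple_refl i \<circ> simple_refl j \<or> z = simple_refl j \<circ> simple_refl i"
proof -
  obtain m k where mk: "1 \<le> m" "m < n" "1 \<le> k" "k < n" "m \<noteq> k" "z = simple_refl m \<circ> simple_refl k"
    using length_2[OF z] by metis
  have "r = m \<or> r = k" if "unit_step n (simple_refl r) z" "1 \<le> r" for r
  proof (rule ccontr)
    assume "\<not> ?thesis"
    then have "preserves z r" using preserves_simple_refl_comp mk by auto
    then have "preserves (simple_refl r) r" using bruhat_less_preserves unit_step_less that(1) by blast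
    then show False using not_preserves_simple_refl that(2) by blast
  qed
  from this[OF i] this[OF j] show ?thesis using ij mk(6) by auto
qed

lemma length_2_covers_two:
  assumes z: "z permutes {1..n}" "perm_length n z = 2"
  obtains u v where "u \<noteq> v" "unit_step n u z" "unit_step n v z"
proof -
  obtain m k where mk: "1 \<le> m" "m < n" "1 \<le> k" "k < n" "m \<noteq> k" "z = simple_refl m \<circ> simple_refl k"
    using length_2[OF z] by metis
  note pm = simple_refl_permutes[OF mk(1,2)] and pk = simple_refl_permutes[OF mk(3,4)]
  have len: "perm_length n (simple_refl m) = 1" "perm_length n (simple_refl k) = 1"
    using perm_length_simple_refl mk by auto
  have "bruhat_step n (simple_refl m) z"
  proof -
    have "z = simple_refl m \<circ> transpose k (Suc k)" using mk(6) by (simp add: simple_refl_def)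
    moreover have "perm_length n (simple_refl m) < perm_length n z" using len z(2) by simp
    ultimately show ?thesis unfolding bruhat_step_def sym_group_carrier using pm mk(3,4) by (metis Suc_leI lessI)
  qed
  moreover have "bruhat_step n (simple_refl k) z"
  proof -
    \<comment> \<open>To find the right factor below z, s_m s_k is rewritten as s_k times the
      conjugate of s_m by s_k, which is again a transposition; min and max put its two points in
      order.\<close>
    let ?i = "simple_refl k m" and ?j = "simple_refl k (Suc m)"
    have bij: "bij (simple_refl k)" unfolding simple_refl_def by simp
    have inv: "inv' (simple_refl k) = simple_refl k" unfolding simple_refl_def by simp
    have "z = simple_refl k \<circ> transpose ?i ?j"
      unfolding mk(6) using transpose_comp_eq[OF bij, of m "Suc m"] unfolding inv by (simp add: simple_refl_def)
    then have eq: "z = simple_refl k \<circ> transpose (min ?i ?j) (max ?i ?j)"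
      by (auto simp: min_def max_def transpose_commute)
    have "?i \<in> {1..n}" "?j \<in> {1..n}"
      using permutes_in_image[OF pk, of m] permutes_in_image[OF pk, of "Suc m"] mk by auto
    moreover have "?i \<noteq> ?j" using bij by (metis bij_is_inj injD n_not_Suc_n)
    ultimately have r: "1 \<le> min ?i ?j" "min ?i ?j < max ?i ?j" "max ?i ?j \<le> n" by auto
    have "perm_length n (simple_refl k) < perm_length n z" using len z by simp
    then show ?thesis unfolding bruhat_step_def sym_group_carrier using pk eq r by blast
  qed
  ultimately have "unit_step n (simple_refl m) z" "unit_step n (simple_refl k) z"
    unfolding unit_step_def using len z(2) by auto
  moreover have "simple_refl m \<noteq> simple_refl k" using mk(5) simple_refl_inject by blast
  ultimately show ?thesis using that by blast
qed

lemma rank_level_iff: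
  "u \<in> rank_level n w (int k) \<longleftrightarrow> u permutes {1..n} \<and> (u = w \<or> bruhat_less n u w) \<and> perm_length n u = k"
  unfolding rank_level_def lower_interval_less by auto

lemma finite_rank_level: "finite (rank_level n w k)"
  by (rule finite_subset[OF _ finite_permutations[of "{1..n}"]]) (auto simp: rank_level_def lower_interval_less)

lemma card_atoms_le: "card (rank_level n w 1) \<le> card (perm_support n w)"
proof -
  have "rank_level n w 1 \<subseteq> simple_refl ` perm_support n w"
  proof
    fix u assume "u \<in> rank_level n w 1"
    then have u: "u permutes {1..n}" "u = w \<or> bruhat_less n u w" "perm_length n u = 1"
      using rank_level_iff[of u n w 1] by auto
    obtain k where k: "1 \<le> k" "k < n" "u = simple_refl k" using length_1[OF u(1,3)] .
    have "\<not> preserves w k"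
      using u(2) bruhat_less_preserves not_preserves_simple_refl[OF k(1)] unfolding k(3) by blast
    then show "u \<in> simple_refl ` perm_support n w" unfolding perm_support_def using k by blast
  qed
  moreover have "finite (perm_support n w)" by (rule finite_subset[of _ "{..n}"]) (auto simp: perm_support_def)
  ultimately show ?thesis by (meson card_image_le card_mono finite_imageI le_trans)
qed

text \<open>In the lower graph this relation is a linear forest on the simple reflections, together with a
  matching on the other side; it does not refer to the bipartition, so it is
  transported by every graph isomorphism.\<close>
definition doubly_adjacent :: "'a set \<times> 'a set set \<Rightarrow> 'a \<Rightarrow> 'a \<Rightarrow> bool" where
  "doubly_adjacent G u v \<longleftrightarrow> u \<noteq> v \<and> (\<exists>x\<in>fst G. \<exists>y\<in>fst G. x \<noteq> y \<and>
     {u, x} \<in> snd G \<and> {v, x} \<in> snd G \<and> {u, y} \<in> snd G \<and> {v, y} \<in> snd G)"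

lemma doubly_adjacent_iso:
  assumes bij: "bij_betw f (fst G) (fst H)"
    and e: "\<And>u v. u \<in> fst G \<Longrightarrow> v \<in> fst G \<Longrightarrow> {u, v} \<in> snd G \<longleftrightarrow> {f u, f v} \<in> snd H"
    and uv: "u \<in> fst G" "v \<in> fst G" and d: "doubly_adjacent H (f u) (f v)"
  shows "doubly_adjacent G u v"
proof -
  obtain x' y' where *: "x' \<in> fst H" "y' \<in> fst H" "x' \<noteq> y'"
    "{f u, x'} \<in> snd H" "{f v, x'} \<in> snd H" "{f u, y'} \<in> snd H" "{f v, y'} \<in> snd H" "f u \<noteq> f v"
    using d unfolding doubly_adjacent_def by blast
  obtain x y where xy: "x \<in> fst G" "x' = f x" "y \<in> fst G" "y' = f y"
    using bij *(1,2) unfolding bij_betw_def by blast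
  have "{u, x} \<in> snd G" "{v, x} \<in> snd G" "{u, y} \<in> snd G" "{v, y} \<in> snd G" "x \<noteq> y" "u \<noteq> v"
    using e[OF uv(1) xy(1)] e[OF uv(2) xy(1)] e[OF uv(1) xy(3)] e[OF uv(2) xy(3)] * unfolding xy by auto
  then show ?thesis unfolding doubly_adjacent_def using xy by blast
qed

abbreviation lower_adjacent :: "nat \<Rightarrow> (nat \<Rightarrow> nat) \<Rightarrow> (nat \<Rightarrow> nat) \<Rightarrow> (nat \<Rightarrow> nat) \<Rightarrow> bool" where
  "lower_adjacent n w \<equiv> doubly_adjacent (Gamma_lower n w)"

text \<open>The only possible common neighbours of the atoms s_i and s_j are s_i s_j and s_j s_i;
  two of them exist only if the generators do not commute. Likewise, two elements of length two
  above the same two atoms are these two products, which are inverse to each other.\<close>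

lemma doubly_adjacent_lower:
  assumes "lower_adjacent n w u v"
  shows "(perm_length n u = 1 \<and> (\<exists>i j. u = simple_refl i \<and> v = simple_refl j \<and> (j = Suc i \<or> i = Suc j))) \<or>
         (perm_length n u = 2 \<and> v = inv' u)"
proof -
  let ?A = "rank_level n w 1" and ?B = "rank_level n w 2"
  have A: "z permutes {1..n}" "perm_length n z = 1" if "z \<in> ?A" for z
    using that rank_level_iff[of z n w 1] by auto
  have B: "z permutes {1..n}" "perm_length n z = 2" if "z \<in> ?B" for z
    using that rank_level_iff[of z n w 2] by auto
  obtain x y where *: "u \<noteq> v" "x \<noteq> y"
    "{u, x} \<in> snd (Gamma_lower n w)" "{v, x} \<in> snd (Gamma_lower n w)"
    "{u, y} \<in> snd (Gamma_lower n w)" "{v, y} \<in> snd (Gamma_lower n w)"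
    using assms unfolding doubly_adjacent_def by blast
  have edge: "(a \<in> ?A \<and> b \<in> ?B \<and> unit_step n a b) \<or> (a \<in> ?B \<and> b \<in> ?A \<and> unit_step n b a)"
    if "{a, b} \<in> snd (Gamma_lower n w)" for a b
    using that A B unfolding Gamma_lower_def cover_graph_edge_iff unit_step_def by fastforce
  have AB: "z \<notin> ?B" if "z \<in> ?A" for z using A(2)[OF that] B(2)[of z] by auto
  show ?thesis
  proof (cases "u \<in> ?A")
    case True
    then have xy: "x \<in> ?B" "y \<in> ?B" "unit_step n u x" "unit_step n u y"
      using edge[OF *(3)] edge[OF *(5)] AB by auto
    then have v: "v \<in> ?A" "unit_step n v x" "unit_step n v y"
      using edge[OF *(4)] edge[OF *(6)] AB by auto
    obtain i where i: "1 \<le> i" "u = simple_refl i" using length_1[OF A[OF True]] by blast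
    obtain j where j: "1 \<le> j" "v = simple_refl j" using length_1[OF A[OF v(1)]] by blast
    have ij: "i \<noteq> j" using *(1) i j by auto
    have "simple_refl i \<circ> simple_refl j \<noteq> simple_refl j \<circ> simple_refl i"
      using length_2_lower_covers[OF B[OF xy(1)], of i j] length_2_lower_covers[OF B[OF xy(2)], of i j]
        xy v i j ij *(2) by metis
    moreover have "simple_refl i \<circ> simple_refl j = simple_refl j \<circ> simple_refl i" if "j \<noteq> Suc i" "i \<noteq> Suc j"
      using that ij by (auto simp: fun_eq_iff simple_refl_def Transposition.transpose_def)
    ultimately show ?thesis using i j A(2)[OF True] by blast
  next
    case False
    then have u: "u \<in> ?B" "x \<in> ?A" "y \<in> ?A" "unit_step n x u" "unit_step n y u"
      using edge[OF *(3)] edge[OF *(5)] by auto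
    then have v: "v \<in> ?B" "unit_step n x v" "unit_step n y v"
      using edge[OF *(4)] edge[OF *(6)] AB by auto
    obtain i where i: "1 \<le> i" "x = simple_refl i" using length_1[OF A[OF u(2)]] by blast
    obtain j where j: "1 \<le> j" "y = simple_refl j" using length_1[OF A[OF u(3)]] by blast
    have ij: "i \<noteq> j" using *(2) i j by auto
    have inv: "inv' (simple_refl i \<circ> simple_refl j) = simple_refl j \<circ> simple_refl i" for i j
      unfolding simple_refl_def by (simp add: o_inv_distrib)
    have "v = inv' u"
      using length_2_lower_covers[OF B[OF u(1)], of i j] length_2_lower_covers[OF B[OF v(1)], of i j]
        u v i j ij *(1) inv by metis
    then show ?thesis using B[OF u(1)] by blast
  qed
qed

text \<open>A generator has at most two Dynkin neighbours, and an element of length two has only its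
  inverse as a partner.\<close>

lemma lower_no_star:
  assumes d: "lower_adjacent n w u v1" "lower_adjacent n w u v2"
    "lower_adjacent n w u v3" and ne: "v1 \<noteq> v2" "v1 \<noteq> v3" "v2 \<noteq> v3"
  shows False
proof (cases "perm_length n u = 2")
  case True
  then show ?thesis using doubly_adjacent_lower[OF d(1)] doubly_adjacent_lower[OF d(2)] ne by auto
next
  case False
  then obtain i where i: "u = simple_refl i" using doubly_adjacent_lower[OF d(1)] by blast
  have "v = simple_refl (Suc i) \<or> (i \<noteq> 0 \<and> v = simple_refl (i - 1))" if "lower_adjacent n w u v" for v
    using doubly_adjacent_lower[OF that] i simple_refl_inject False by fastforce
  from this[OF d(1)] this[OF d(2)] this[OF d(3)] show False using ne by auto
qed

lemma doubly_adjacent_sym: "doubly_adjacent G u v \<longleftrightarrow> doubly_adjacent G v u"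
  unfolding doubly_adjacent_def by blast

text \<open>Every vertex of a square has two partners, which excludes length two; what remains would
  be a 4-cycle in the Dynkin path.\<close>

lemma lower_no_square:
  assumes d: "lower_adjacent n w a b" "lower_adjacent n w a d"
    "lower_adjacent n w b c" "lower_adjacent n w d c" and ne: "a \<noteq> c" "b \<noteq> d"
  shows False
proof -
  have adj: "\<exists>i j. x = simple_refl i \<and> y = simple_refl j \<and> (j = Suc i \<or> i = Suc j)"
    if "lower_adjacent n w x y" "lower_adjacent n w x z" "y \<noteq> z" for x y z
    using doubly_adjacent_lower[OF that(1)] doubly_adjacent_lower[OF that(2)] that(3) by auto
  note s = d(1,3)[THEN doubly_adjacent_sym[THEN iffD1]] d(2,4)[THEN doubly_adjacent_sym[THEN iffD1]]
  obtain i j where 1: "a = simple_refl i" "b = simple_refl j" "j = Suc i \<or> i = Suc j"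
    using adj[OF d(1,2) ne(2)] by blast
  obtain i' j' where 2: "a = simple_refl i'" "d = simple_refl j'" "j' = Suc i' \<or> i' = Suc j'"
    using adj[OF d(2,1)] ne(2) by blast
  obtain j1 m where 3: "b = simple_refl j1" "c = simple_refl m" "m = Suc j1 \<or> j1 = Suc m"
    using adj[OF d(3) s(1)] ne(1) by blast
  obtain j2 m' where 4: "d = simple_refl j2" "c = simple_refl m'" "m' = Suc j2 \<or> j2 = Suc m'"
    using adj[OF d(4) s(3)] ne(1) by blast
  have "i' = i" "j1 = j" "j2 = j'" "m' = m" using 1 2 3 4 simple_refl_inject by metis+
  moreover have "i \<noteq> m" "j \<noteq> j'" using ne 1 2 3 by auto
  ultimately show False using 1(3) 2(3) 3(3) 4(3) by auto
qed

text \<open>The two paths in a Bruhat interval of rank two either exchange the order of two disjoint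
  transpositions, or use two of the three transpositions of three points; the third one is excluded
  because it would lead through the minimum or the maximum of these three.\<close>
lemma at_most_two_between:
  "\<exists>p q. {x. unit_step n z x \<and> unit_step n x w} \<subseteq> {p, q}"
proof (cases "\<exists>x. unit_step n z x \<and> unit_step n x w")
  case False then show ?thesis by blast
next
  case True
  define T where "T x i j k m \<longleftrightarrow> i < j \<and> k < m \<and> w j < w i \<and> x m < x k \<and> x = w \<circ> transpose i j \<and> z = x \<circ> transpose k m"
    for x i j k m
  have wz: "w \<noteq> z" using True unfolding unit_step_def by auto
  obtain x0 where x0: "unit_step n z x0" "unit_step n x0 w" using True by blast
  then have "w permutes {1..n}" using unit_step_iff by blast
  then have inj: "w a = w b \<longleftrightarrow> a = b" for a b using permutes_inj by (metis injD)
  have ex: "\<exists>i j k m. T x i j k m" if "unit_step n z x" "unit_step n x w" for x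
    using that unfolding unit_step_iff T_def by blast
  \<comment> \<open>The positions where w and z differ do not depend on the path, and the
    transpositions of every path use exactly these: four points if the two are disjoint, three
    otherwise.\<close>
  define S where "S = {p. w p \<noteq> z p}"
  have S: "S = {i, j, k, m} \<and> (i \<noteq> k \<or> j \<noteq> m)" if "T x i j k m" for x i j k m
  proof -
    have zp: "z p = w (transpose i j (transpose k m p))" for p using that unfolding T_def by simp
    have ne: "i \<noteq> k \<or> j \<noteq> m"
    proof (rule ccontr)
      assume "\<not> ?thesis"
      then have "z p = w p" for p using zp by simp
      then show False using wz by (simp add: fun_eq_iff)
    qed
    have lt: "i < j" "k < m" using that unfolding T_def by auto
    have "p \<in> S \<longleftrightarrow> p \<in> {i, j, k, m}" for p
      unfolding S_def using lt ne by (auto simp: zp inj Transposition.transpose_def)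
    then show ?thesis using ne by blast
  qed
  obtain i j k m where r: "T x0 i j k m" using ex x0 by blast
  show ?thesis
  proof (cases "{i, j} \<inter> {k, m} = {}")
    case True
    have zr: "z i = w j" "z j = w i" "z k = w m" "z m = w k"
      using r True unfolding T_def by auto
    have "x = w \<circ> transpose i j \<or> x = w \<circ> transpose k m" if x: "T x i' j' k' m'" for x i' j' k' m'
    proof -
      have lt: "i' < j'" "k' < m'" "i < j" "k < m" using x r unfolding T_def by auto
      have "card {i, j, k, m} = 4" using True lt by auto
      then have "card {i', j', k', m'} = 4" using S[OF x] S[OF r] by simp
      then have dj: "i' \<notin> {k', m'}" "j' \<notin> {k', m'}" by (auto simp: card_insert_if split: if_splits)
      \<comment> \<open>On four points z determines the two pairs, as it exchanges the values within
        each of them; a path can only choose which pair comes first.\<close>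
      have "z i' = w j'" using x dj unfolding T_def by simp
      moreover have "i' \<in> {i, j, k, m}" using S[OF x] S[OF r] by blast
      ultimately have "transpose i' j' = transpose i j \<or> transpose i' j' = transpose k m"
        using zr inj transpose_commute[of k m] transpose_commute[of i j] by auto
      then show ?thesis using x unfolding T_def by auto
    qed
    then show ?thesis using ex by blast
  next
    case False
    then have "\<exists>a b c. a < b \<and> b < c \<and> S = {a, b, c}"
    proof -
      have lt: "i < j" "k < m" "i \<noteq> k \<or> j \<noteq> m" using r S[OF r] unfolding T_def by auto
      have sorted: "\<exists>a b c. a < b \<and> b < c \<and> {p, q, s} = {a, b, c}" if ne: "p \<noteq> q" "p \<noteq> s" "q \<noteq> s" for p q s :: nat
      proof -
        consider "p < q" "q < s" | "p < s" "s < q" | "q < p" "p < s" | "q < s" "s < p" | "s < p" "p < q" | "s < q" "q < p"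
          using ne by linarith
        then show ?thesis by cases (blast)+
      qed
      have "S = {i, j, k, m}" using S[OF r] by blast
      moreover have "\<exists>p q s. p \<noteq> q \<and> p \<noteq> s \<and> q \<noteq> s \<and> {i, j, k, m} = {p, q, s}"
      proof -
        consider "i = k" | "i = m" | "j = k" | "j = m" using False by auto
        then show ?thesis
        proof cases
          case 1 then show ?thesis using lt by (intro exI[of _ i] exI[of _ j] exI[of _ m]) auto
        next
          case 2 then show ?thesis using lt by (intro exI[of _ i] exI[of _ j] exI[of _ k]) auto
        next
          case 3 then show ?thesis using lt by (intro exI[of _ i] exI[of _ j] exI[of _ m]) auto
        next
          case 4 then show ?thesis using lt by (intro exI[of _ i] exI[of _ j] exI[of _ k]) auto
        qed
      qed
      ultimately show ?thesis using sorted by metis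
    qed
    then obtain a b c where abc: "a < b" "b < c" "S = {a, b, c}" by blast
    have pairs: "(i' = a \<and> j' = b) \<or> (i' = b \<and> j' = c) \<or> (i' = a \<and> j' = c)"
      if x: "T x i' j' k' m'" for x i' j' k' m'
    proof -
      have "i' \<in> {a, b, c}" "j' \<in> {a, b, c}" "i' < j'" using S[OF x] abc x unfolding T_def by auto
      then show ?thesis using abc by auto
    qed
    have no: "\<not> (w b < w a \<and> w c < w b)" if x: "T x a c k' m'" for x k' m'
    proof
      assume ww: "w b < w a \<and> w c < w b"
      have km: "k' \<in> {a, b, c}" "m' \<in> {a, b, c}" "k' < m'" "x m' < x k'" using S[OF x] abc x unfolding T_def by auto
      have "x a = w c" "x b = w b" "x c = w a" using x abc unfolding T_def by auto
      then show False using km ww abc by auto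
    qed
    let ?X = "{x. unit_step n z x \<and> unit_step n x w}"
    have cases3: "(x = w \<circ> transpose a b \<and> w b < w a) \<or> (x = w \<circ> transpose b c \<and> w c < w b) \<or>
       (x = w \<circ> transpose a c \<and> \<not> (w b < w a \<and> w c < w b))" if "x \<in> ?X" for x
    proof -
      obtain i' j' k' m' where x: "T x i' j' k' m'" using ex \<open>x \<in> ?X\<close> by blast
      have e: "x = w \<circ> transpose i' j'" "w j' < w i'" using x unfolding T_def by auto
      from pairs[OF x] show ?thesis
      proof (elim disjE conjE)
        assume "i' = a" "j' = c"
        then show ?thesis using e no[of x k' m'] x by simp
      qed (use e in simp_all)
    qed
    consider "w b < w a" "w c < w b" | "\<not> w b < w a" | "\<not> w c < w b" by blast
    then show ?thesis
    proof cases
      case 1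
      have "?X \<subseteq> {w \<circ> transpose a b, w \<circ> transpose b c}"
      proof
        fix x assume "x \<in> ?X"
        from cases3[OF this] 1 show "x \<in> {w \<circ> transpose a b, w \<circ> transpose b c}"
          by (elim disjE conjE) simp_all
      qed
      then show ?thesis by blast
    next
      case 2
      have "?X \<subseteq> {w \<circ> transpose b c, w \<circ> transpose a c}"
      proof
        fix x assume "x \<in> ?X"
        from cases3[OF this] 2 show "x \<in> {w \<circ> transpose b c, w \<circ> transpose a c}"
          by (elim disjE conjE) simp_all
      qed
      then show ?thesis by blast
    next
      case 3
      have "?X \<subseteq> {w \<circ> transpose a b, w \<circ> transpose a c}"
      proof
        fix x assume "x \<in> ?X"
        from cases3[OF this] 3 show "x \<in> {w \<circ> transpose a b, w \<circ> transpose a c}"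
          by (elim disjE conjE) simp_all
      qed
      then show ?thesis by blast
    qed
  qed
qed

lemma coatoms_iff:
  "x \<in> rank_level n w (int (perm_length n w) - 1) \<longleftrightarrow> unit_step n x w"
proof
  assume "x \<in> rank_level n w (int (perm_length n w) - 1)"
  then have x: "x = w \<or> bruhat_less n x w" "int (perm_length n x) = int (perm_length n w) - 1"
    unfolding rank_level_def lower_interval_less by auto
  then show "unit_step n x w" unfolding unit_step_iff_less by auto
next
  assume "unit_step n x w"
  then show "x \<in> rank_level n w (int (perm_length n w) - 1)"
    unfolding unit_step_iff_less rank_level_def lower_interval_less using bruhat_less_permutes by auto
qed

text \<open>Let A, B be the levels 1 and 2, and A', B' the two levels below w. Each element of B
  covers at least two atoms and each element of B' is covered by at most two coatoms. The numbers of
  edges agree, so card B \<le> card B'; the numbers of vertices agree as well, so card A' \<le> card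
  A.\<close>

lemma isomorphic_card_coatoms_le:
  assumes iso: "graph_isomorphic (Gamma_lower n w) (Gamma_upper n w)"
  shows "card {x. unit_step n x w} \<le> card (rank_level n w 1)"
proof -
  let ?l = "int (perm_length n w)"
  define A B A' B' where "A = rank_level n w 1" and "B = rank_level n w 2"
    and "A' = rank_level n w (?l - 1)" and "B' = rank_level n w (?l - 2)"
  have fin: "finite A" "finite B" "finite A'" "finite B'"
    unfolding A_def B_def A'_def B'_def by (rule finite_rank_level)+
  have disj: "A \<inter> B = {}" "A' \<inter> B' = {}" unfolding A_def B_def A'_def B'_def rank_level_def by auto
  define R where "R u v \<longleftrightarrow> unit_step n u v \<or> unit_step n v u" for u v
  have Rsym: "R u v \<longleftrightarrow> R v u" for u v unfolding R_def by blast
  have G: "fst (Gamma_lower n w) = A \<union> B" "fst (Gamma_upper n w) = A' \<union> B'"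
    unfolding Gamma_lower_def Gamma_upper_def A_def B_def A'_def B'_def by simp_all
  have E: "{u, v} \<in> snd (Gamma_lower n w) \<longleftrightarrow> (u \<in> A \<and> v \<in> B \<or> v \<in> A \<and> u \<in> B) \<and> R u v"
     "{u, v} \<in> snd (Gamma_upper n w) \<longleftrightarrow> (u \<in> A' \<and> v \<in> B' \<or> v \<in> A' \<and> u \<in> B') \<and> R u v" for u v
    unfolding Gamma_lower_def Gamma_upper_def A_def B_def A'_def B'_def R_def by (rule cover_graph_edge_iff)+
  obtain f where f: "bij_betw f (A \<union> B) (A' \<union> B')"
    "\<And>u v. u \<in> A \<union> B \<Longrightarrow> v \<in> A \<union> B \<Longrightarrow> {u, v} \<in> snd (Gamma_lower n w) \<longleftrightarrow> {f u, f v} \<in> snd (Gamma_upper n w)"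
    using iso unfolding graph_isomorphic_def G by blast
  have edges: "(\<Sum>v\<in>B. card {u\<in>A. R u v}) = (\<Sum>v\<in>B'. card {u\<in>A'. R u v})"
    using graph_iso_card_edges[OF f] card_bipartite_pairs[OF fin(1,2) disj(1) Rsym]
      card_bipartite_pairs[OF fin(3,4) disj(2) Rsym] unfolding E by simp
  have verts: "card A + card B = card A' + card B'"
    using bij_betw_same_card[OF f(1)] fin disj by (simp add: card_Un_disjoint)
  have "2 \<le> card {u\<in>A. R u z}" if "z \<in> B" for z
  proof -
    have z: "z permutes {1..n}" "perm_length n z = 2" "z = w \<or> bruhat_less n z w"
      using that rank_level_iff[of z n w 2] unfolding B_def by simp_all
    obtain u v where uv: "u \<noteq> v" "unit_step n u z" "unit_step n v z" using length_2_covers_two[OF z(1,2)] .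
    have "x \<in> A" if "unit_step n x z" for x
    proof -
      have "bruhat_less n x z" "perm_length n z = Suc (perm_length n x)" using that unfolding unit_step_iff_less by auto
      moreover have "bruhat_less n x w" using z(3) calculation(1) bruhat_less_trans[of n x z w] by blast
      ultimately have "x \<in> rank_level n w (int 1)"
        unfolding rank_level_iff using z(2) bruhat_less_permutes(1)[of n x z] by simp
      then show ?thesis unfolding A_def by simp
    qed
    then have "{u, v} \<subseteq> {u\<in>A. R u z}" using uv unfolding R_def by blast
    then have "card {u, v} \<le> card {u\<in>A. R u z}" using fin by (intro card_mono) auto
    then show ?thesis using uv(1) by simp
  qed
  then have "(\<Sum>v\<in>B. 2) \<le> (\<Sum>v\<in>B. card {u\<in>A. R u v})" by (rule sum_mono)
  then have lo: "2 * card B \<le> (\<Sum>v\<in>B. card {u\<in>A. R u v})" by (simp add: mult.commute)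
  have "card {x\<in>A'. R x z} \<le> 2" if "z \<in> B'" for z
  proof -
    have "{x\<in>A'. R x z} \<subseteq> {x. unit_step n z x \<and> unit_step n x w}"
    proof
      fix x assume x: "x \<in> {x\<in>A'. R x z}"
      then have "unit_step n x w" using coatoms_iff unfolding A'_def by blast
      moreover have "int (perm_length n x) = ?l - 1" "int (perm_length n z) = ?l - 2"
        using x that unfolding A'_def B'_def rank_level_def by auto
      then have "\<not> unit_step n x z" unfolding unit_step_def by auto
      then have "unit_step n z x" using x unfolding R_def by blast
      ultimately show "x \<in> {x. unit_step n z x \<and> unit_step n x w}" by blast
    qed
    then obtain p q where "{x\<in>A'. R x z} \<subseteq> {p, q}" using at_most_two_between[of n z w] by blast
    then have "card {x\<in>A'. R x z} \<le> card {p, q}" by (intro card_mono) auto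
    also have "\<dots> \<le> 2" by (simp add: card_insert_if)
    finally show ?thesis .
  qed
  then have "(\<Sum>v\<in>B'. card {u\<in>A'. R u v}) \<le> (\<Sum>v\<in>B'. 2)" by (rule sum_mono)
  then have "(\<Sum>v\<in>B'. card {u\<in>A'. R u v}) \<le> 2 * card B'" by (simp add: mult.commute)
  then have "card A' \<le> card A" using lo edges verts by linarith
  moreover have "A' = {x. unit_step n x w}" unfolding A'_def using coatoms_iff by blast
  ultimately show ?thesis unfolding A_def by simp
qed

section \<open>The Hasse diagram of the inversion order\<close>

text \<open>\<open>gt\<close> stands for the inversion order and \<open>E\<close> for its Hasse
  diagram. Each condition from \<open>in3\<close> to \<open>in2_out2\<close> forbids a configuration
  that would give a star or a square of consecutive edges. The setting is invariant under reversal,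
  so every result on merging also gives one on branching.\<close>

locale narrow_order =
  fixes gt E :: "nat \<Rightarrow> nat \<Rightarrow> bool"
  assumes trans: "gt a b \<Longrightarrow> gt b c \<Longrightarrow> gt a c"
    and irrefl: "\<not> gt a a"
    and first: "gt a b \<Longrightarrow> \<exists>c. E a c \<and> (c = b \<or> gt c b)"
    and last: "gt a b \<Longrightarrow> \<exists>c. E c b \<and> (a = c \<or> gt a c)"
    and edge: "E a b \<Longrightarrow> gt a b"
    and finite_up: "finite {b. gt b a}" and finite_down: "finite {b. gt a b}"
    and in3: "E a1 b \<Longrightarrow> E a2 b \<Longrightarrow> E a3 b \<Longrightarrow> E b c \<Longrightarrow> a1 \<noteq> a2 \<Longrightarrow> a1 \<noteq> a3 \<Longrightarrow> a2 \<noteq> a3 \<Longrightarrow> False"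
    and out3: "E b a1 \<Longrightarrow> E b a2 \<Longrightarrow> E b a3 \<Longrightarrow> E c b \<Longrightarrow> a1 \<noteq> a2 \<Longrightarrow> a1 \<noteq> a3 \<Longrightarrow> a2 \<noteq> a3 \<Longrightarrow> False"
    and in2: "E a1 b \<Longrightarrow> E a2 b \<Longrightarrow> a1 \<noteq> a2 \<Longrightarrow> E b c \<Longrightarrow> E c d \<Longrightarrow> False"
    and out2: "E b a1 \<Longrightarrow> E b a2 \<Longrightarrow> a1 \<noteq> a2 \<Longrightarrow> E c b \<Longrightarrow> E d c \<Longrightarrow> False"
    and in2_out2: "E a1 b \<Longrightarrow> E a2 b \<Longrightarrow> a1 \<noteq> a2 \<Longrightarrow> E b c1 \<Longrightarrow> E b c2 \<Longrightarrow> c1 \<noteq> c2 \<Longrightarrow> False"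
begin

lemma dual: "narrow_order (\<lambda>a b. gt b a) (\<lambda>a b. E b a)"
proof unfold_locales
  fix a b c assume "gt b a" "gt c b" then show "gt c a" using trans by blast
next
  fix a b assume "gt b a" then show "\<exists>c. E c a \<and> (c = b \<or> gt b c)" using last by blast
next
  fix a b assume "gt b a" then show "\<exists>c. E b c \<and> (a = c \<or> gt c a)" using first by blast
qed (fact irrefl edge finite_up finite_down in3 out3 in2 out2 | rule in2_out2; assumption)+

definition incomparable :: "nat \<Rightarrow> nat \<Rightarrow> bool" where
  "incomparable a b \<longleftrightarrow> a \<noteq> b \<and> \<not> gt a b \<and> \<not> gt b a"

text \<open>Take r maximal among the elements weakly above x and below both i1 and i2; maximality is
  reached by minimising the number of elements above r. The last edges of chains from i1 and from i2
  to r start at different vertices, since a common one would be a higher choice.\<close>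

lemma merge:
  assumes i: "gt i1 x" "gt i2 x" "incomparable i1 i2"
  shows "\<exists>r c1 c2. (r = x \<or> gt r x) \<and> E c1 r \<and> E c2 r \<and> c1 \<noteq> c2 \<and> (i1 = c1 \<or> gt i1 c1) \<and> (i2 = c2 \<or> gt i2 c2)"
proof -
  let ?R = "{r. (r = x \<or> gt r x) \<and> gt i1 r \<and> gt i2 r}"
  have "\<exists>r. r \<in> ?R \<and> (\<forall>s. s \<in> ?R \<longrightarrow> card {b. gt b r} \<le> card {b. gt b s})"
    by (rule ex_has_least_nat[of "\<lambda>r. r \<in> ?R" x]) (use i in blast)
  then obtain r where r: "r \<in> ?R" and least: "\<And>s. s \<in> ?R \<Longrightarrow> card {b. gt b r} \<le> card {b. gt b s}"
    by blast
  have max: "\<not> gt s r" if "s \<in> ?R" for s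
  proof
    assume sr: "gt s r"
    have "{b. gt b s} \<subset> {b. gt b r}" using trans sr irrefl by blast
    then have "card {b. gt b s} < card {b. gt b r}" using finite_up by (intro psubset_card_mono)
    then show False using least[OF that] by simp
  qed
  obtain c1 where c1: "E c1 r" "i1 = c1 \<or> gt i1 c1" using last r by blast
  obtain c2 where c2: "E c2 r" "i2 = c2 \<or> gt i2 c2" using last r by blast
  have "c1 \<noteq> c2"
  proof
    assume eq: "c1 = c2"
    then have "gt i1 c1" "gt i2 c1" using c1 c2 i(3) unfolding incomparable_def by auto
    moreover have "gt c1 r" using edge c1 by blast
    ultimately show False using max[of c1] r trans by blast
  qed
  then show ?thesis using c1 c2 r by blast
qed

text \<open>The merge takes place at some r weakly above x, and because of x, y, z at least two
  consecutive edges lead down from r, contrary to \<open>in2\<close>.\<close>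

lemma no_merge_over_chain:
  assumes i: "gt i1 x" "gt i2 x" "incomparable i1 i2" and xy: "gt x y" "gt y z"
  shows False
proof -
  obtain r c1 c2 where r: "r = x \<or> gt r x" "E c1 r" "E c2 r" "c1 \<noteq> c2" using merge[OF i] by blast
  obtain k where k: "E r k" "gt k z"
  proof (cases "r = x")
    case True
    obtain c where "E x c" "c = y \<or> gt c y" using first[OF xy(1)] by blast
    then show ?thesis using that[of c] True trans[of c y z] xy(2) by auto
  next
    case False
    then obtain c where "E r c" "c = x \<or> gt c x" using first[of r x] r(1) by blast
    then show ?thesis using that[of c] trans[of c x z] trans[OF xy] by auto
  qed
  then show False using first[OF k(2)] in2[OF r(2-4) k(1)] by blast
qed

text \<open>Two of the elements can merge only at x itself, since a higher merge would sit over a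
  chain. The same argument keeps the last edge from i3 apart from the other two, so three edges
  enter x and one leaves it.\<close>

lemma no_triple_merge:
  assumes i: "gt i1 x" "gt i2 x" "gt i3 x" "incomparable i1 i2" "incomparable i1 i3" "incomparable i2 i3" and xy: "gt x y"
  shows False
proof -
  obtain r c1 c2 where r: "r = x \<or> gt r x" "E c1 r" "E c2 r" "c1 \<noteq> c2" "i1 = c1 \<or> gt i1 c1" "i2 = c2 \<or> gt i2 c2"
    using merge[OF i(1,2,4)] by blast
  have "gt i1 r" "gt i2 r" using r edge trans by blast+
  then have rx: "r = x" using no_merge_over_chain[of i1 r i2 x y] i xy r(1) by blast
  obtain c3 where c3: "E c3 x" "i3 = c3 \<or> gt i3 c3" using last[OF i(3)] by blast
  obtain k where k: "E x k" using first[OF xy] by blast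
  have no: False if "c3 = c" "i = c \<or> gt i c" "incomparable i i3" "E c x" for c i
  proof -
    have "gt i c" "gt i3 c" using that c3 unfolding incomparable_def by auto
    then show False using no_merge_over_chain[of i c i3 x y] that(3) edge[OF that(4)] xy by blast
  qed
  have "c3 \<noteq> c1" "c3 \<noteq> c2" using no r i(5,6) rx by blast+
  then show False using in3[of c1 x c2 c3 k] r rx c3 k by auto
qed

text \<open>If the merge point and the branch point coincide, \<open>in2_out2\<close> applies;
  otherwise the merge point is the higher one and is followed by two consecutive edges.\<close>

lemma no_merge_and_branch:
  assumes i: "gt i1 x" "gt i2 x" "incomparable i1 i2" and j: "gt x j1" "gt x j2" "incomparable j1 j2"
  shows False
proof -
  interpret d: narrow_order "\<lambda>a b. gt b a" "\<lambda>a b. E b a" by (rule dual)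
  have "d.incomparable j1 j2" using j(3) unfolding d.incomparable_def incomparable_def by blast
  obtain r c1 c2 where r: "r = x \<or> gt r x" "E c1 r" "E c2 r" "c1 \<noteq> c2" using merge[OF i] by blast
  obtain s d1 d2 where s: "s = x \<or> gt x s" "E s d1" "E s d2" "d1 \<noteq> d2"
    using d.merge[OF j(1,2) \<open>d.incomparable j1 j2\<close>] by blast
  show False
  proof (cases "r = s")
    case True then show ?thesis using in2_out2 r s by blast
  next
    case False
    then have "gt r s" using r s trans by blast
    then obtain k where k: "E r k" "k = s \<or> gt k s" using first by blast
    then obtain m where "E k m" using s(2) first by blast
    then show ?thesis using in2 r k by blast
  qed
qed

end

text \<open>Labels play the role of connected components: adding an edge to F identifies at most two
  of them, so at least n - card F survive on {1..n}.\<close>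

lemma exists_label:
  assumes "finite F"
  shows "\<exists>f :: nat \<Rightarrow> nat. (\<forall>(a, b)\<in>F. f a = f b) \<and> n \<le> card (f ` {1..n}) + card F"
  using assms
proof (induction F)
  case empty then show ?case by (intro exI[of _ id]) simp
next
  case (insert e F)
  obtain a b where e: "e = (a, b)" by fastforce
  from insert.IH obtain f :: "nat \<Rightarrow> nat" where f0: "(\<forall>(a, b)\<in>F. f a = f b) \<and> n \<le> card (f ` {1..n}) + card F" ..
  note f = f0[THEN conjunct1] f0[THEN conjunct2]
  let ?g = "\<lambda>v. if f v = f b then f a else f v"
  have "f ` {1..n} - {f b} \<subseteq> ?g ` {1..n}" by auto
  then have "card (f ` {1..n} - {f b}) \<le> card (?g ` {1..n})" by (intro card_mono) auto
  moreover have "card (f ` {1..n}) \<le> Suc (card (f ` {1..n} - {f b}))"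
  proof -
    have "card (f ` {1..n}) - card {f b} \<le> card (f ` {1..n} - {f b})" by (rule diff_card_le_card_Diff) simp
    moreover have "card {f b} = 1" by simp
    ultimately show ?thesis by linarith
  qed
  moreover have "card (insert e F) = Suc (card F)" using insert by simp
  ultimately have "n \<le> card (?g ` {1..n}) + card (insert e F)" using f(2) by linarith
  moreover have "\<forall>(a, b)\<in>insert e F. ?g a = ?g b" using f(1) e by fastforce
  ultimately show ?case by (intro exI[of _ ?g] conjI)
qed

section \<open>Bridges in the Hasse diagram of w\<close>

locale permutation =
  fixes n :: nat and w :: "nat \<Rightarrow> nat"
  assumes w: "w permutes {1..n}"
begin

definition above :: "nat \<Rightarrow> nat \<Rightarrow> bool" where
  "above a b \<longleftrightarrow> 1 \<le> a \<and> a < b \<and> b \<le> n \<and> w b < w a"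

definition edge :: "nat \<Rightarrow> nat \<Rightarrow> bool" where
  "edge a b \<longleftrightarrow> above a b \<and> \<not> (\<exists>c. above a c \<and> above c b)"

lemma w_eq_iff: "w a = w b \<longleftrightarrow> a = b"
  using permutes_inj[OF w] by (auto dest: injD)

lemma above_trans: "above a b \<Longrightarrow> above b c \<Longrightarrow> above a c"
  unfolding above_def by auto

lemma above_irrefl: "\<not> above a a"
  unfolding above_def by simp

lemma edge_above: "edge a b \<Longrightarrow> above a b"
  unfolding edge_def by blast

lemma first_edge:
  assumes "above a b" shows "\<exists>c. edge a c \<and> (c = b \<or> above c b)"
  using assms
proof (induction "b - a" arbitrary: b rule: less_induct)
  case less
  show ?case
  proof (cases "edge a b")
    case False
    then obtain c where c: "above a c" "above c b" using less.prems unfolding edge_def by blast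
    then have "c - a < b - a" unfolding above_def by auto
    then obtain d where "edge a d" "d = c \<or> above d c" using less.hyps c(1) by blast
    then show ?thesis using c above_trans by blast
  qed blast
qed

lemma last_edge:
  assumes "above a b" shows "\<exists>c. edge c b \<and> (a = c \<or> above a c)"
  using assms
proof (induction "b - a" arbitrary: a rule: less_induct)
  case less
  show ?case
  proof (cases "edge a b")
    case False
    then obtain c where c: "above a c" "above c b" using less.prems unfolding edge_def by blast
    then have "b - c < b - a" unfolding above_def by auto
    then obtain d where "edge d b" "c = d \<or> above c d" using less.hyps c(2) by blast
    then show ?thesis using c above_trans by blast
  qed blast
qed

lemma finite_above: "finite {b. above b a}" "finite {b. above a b}"
  by (rule finite_subset[of _ "{1..n}"]; auto simp: above_def)+

lemma finite_edges: "finite {(a, b). edge a b}"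
  by (rule finite_subset[of _ "{1..n} \<times> {1..n}"]) (auto simp: edge_def above_def)

lemma coatom_iff: "unit_step n x w \<longleftrightarrow> (\<exists>a b. edge a b \<and> x = w \<circ> transpose a b)"
proof -
  have "edge a b \<longleftrightarrow> 1 \<le> a \<and> a < b \<and> b \<le> n \<and> w b < w a \<and> \<not> (\<exists>k. a < k \<and> k < b \<and> w b < w k \<and> w k < w a)" for a b
    unfolding edge_def above_def by (auto dest: less_imp_le)
  then show ?thesis unfolding unit_step_iff using w by blast
qed

lemma transpose_determined:
  assumes "w \<circ> transpose a b = w \<circ> transpose c d" "a < b" "c < d" shows "a = c \<and> b = d"
proof -
  have "transpose a b p = transpose c d p" for p
    using fun_cong[OF assms(1), of p] w_eq_iff by simp
  from this[of a] this[of b] show ?thesis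
    using assms(2,3) by (auto simp: Transposition.transpose_def split: if_splits)
qed

lemma card_edges: "card {(a, b). edge a b} = card {x. unit_step n x w}"
proof (rule bij_betw_same_card)
  show "bij_betw (\<lambda>(a, b). w \<circ> transpose a b) {(a, b). edge a b} {x. unit_step n x w}"
    unfolding bij_betw_def
  proof
    show "inj_on (\<lambda>(a, b). w \<circ> transpose a b) {(a, b). edge a b}"
    proof (rule inj_onI, clarify)
      fix a b c d assume "edge a b" "edge c d" and eq: "w \<circ> transpose a b = w \<circ> transpose c d"
      then have "a < b" "c < d" unfolding edge_def above_def by auto
      then show "a = c \<and> b = d" using transpose_determined[OF eq] by blast
    qed
  qed (auto simp: coatom_iff)
qed

text \<open>A comparable pair is refined to a chain of edges. This chain cannot contain (p, q), as p
  would then lie weakly below u and q weakly above v.\<close>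

lemma label_constant:
  assumes f: "\<And>a b. edge a b \<Longrightarrow> (a, b) \<noteq> (p, q) \<Longrightarrow> f a = f b" and uv: "above u v"
    and not_through: "\<not> ((u = p \<or> above u p) \<and> (q = v \<or> above q v))"
  shows "f u = f v"
  using uv not_through
proof (induction "v - u" arbitrary: u v rule: less_induct)
  case less
  show ?case
  proof (cases "edge u v")
    case True
    then show ?thesis using f[of u v] less.prems by blast
  next
    case False
    then obtain c where c: "above u c" "above c v" using less.prems unfolding edge_def by blast
    then have "c - u < v - u" "v - c < v - u" unfolding above_def by auto
    then have "f u = f c" "f c = f v" using less c above_trans by blast+
    then show ?thesis by simp
  qed
qed

text \<open>Removing an edge disconnects its endpoints: otherwise the remaining edges, fewer than the
  support has elements, would still connect every \<open>k\<close> in the support to \<open>k + 1\<close>.\<close>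
lemma edge_cut:
  assumes card: "card {(a, b). edge a b} \<le> card (perm_support n w)" and pq: "edge p q"
  shows "\<exists>f :: nat \<Rightarrow> nat. f p \<noteq> f q \<and>
    (\<forall>u v. above u v \<longrightarrow> \<not> ((u = p \<or> above u p) \<and> (q = v \<or> above q v)) \<longrightarrow> f u = f v)"
proof -
  let ?F = "{(a, b). edge a b} - {(p, q)}"
  from exists_label[OF finite_Diff[OF finite_edges, of "{(p, q)}"], of n]
  obtain f :: "nat \<Rightarrow> nat" where f0: "(\<forall>(a, b)\<in>?F. f a = f b) \<and> n \<le> card (f ` {1..n}) + card ?F" ..
  note f = f0[THEN conjunct1] f0[THEN conjunct2]
  have fe: "f a = f b" if "edge a b" "(a, b) \<noteq> (p, q)" for a b using f(1) that by auto
  have "f p \<noteq> f q"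
  proof
    assume eq: "f p = f q"
    have "f a = f b" if "edge a b" for a b using fe[OF that] eq by (cases "(a, b) = (p, q)") auto
    \<comment> \<open>n + 1 is not a vertex, so taking (n, n + 1) as the excluded edge excludes
      nothing.\<close>
    then have inv: "f u = f v" if "above u v" for u v
      using label_constant[of n "n + 1" f u v] that unfolding above_def by auto
    \<comment> \<open>For k in the support some i \<le> k has a value above k and, by counting, some
      j > k has a value at most k. Then i is above j, and each of k and k + 1 equals or is
      comparable to one of these two.\<close>
    have Suc: "f k = f (Suc k)" if k: "k \<in> perm_support n w" for k
    proof -
      have k1: "1 \<le> k" "k < n" "\<not> preserves w k" using k unfolding perm_support_def by auto
      then obtain i where i: "1 \<le> i" "i \<le> k" "k < w i" unfolding preserves_def by (auto simp: not_le)
      have "\<exists>j. k < j \<and> j \<le> n \<and> w j \<le> k"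
      proof (rule ccontr)
        assume n: "\<not> ?thesis"
        have "{1..k} \<subseteq> w ` ({1..k} - {i})"
        proof
          fix v assume v: "v \<in> {1..k}"
          then have "v \<in> w ` {1..n}" using permutes_image[OF w] k1 by auto
          then obtain r where r: "v = w r" "1 \<le> r" "r \<le> n" by auto
          then have "r \<le> k" using n v by (meson atLeastAtMost_iff not_le)
          moreover have "r \<noteq> i" using r v i by auto
          ultimately show "v \<in> w ` ({1..k} - {i})" using r by auto
        qed
        then have "card {1..k} \<le> card (w ` ({1..k} - {i}))" by (intro card_mono) auto
        also have "\<dots> \<le> card ({1..k} - {i})" by (rule card_image_le) simp
        also have "\<dots> < card {1..k}" using i by (intro card_Diff1_less) auto
        finally show False by simp
      qed
      then obtain j where j: "k < j" "j \<le> n" "w j \<le> k" by blast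
      have ij: "f i = f j" using inv[of i j] i j unfolding above_def by auto
      have 1: "f k = f i"
      proof (cases "k = i \<or> w j < w k")
        case True then show ?thesis using ij inv[of k j] j k1 unfolding above_def by auto
      next
        case False
        then have "w k < w i" "i < k" using i j by auto
        then show ?thesis using inv[of i k] i k1 unfolding above_def by auto
      qed
      have 2: "f (Suc k) = f i"
      proof (cases "w (Suc k) < w i")
        case True then show ?thesis using inv[of i "Suc k"] i k1 unfolding above_def by auto
      next
        case False
        then have "Suc k \<noteq> j" "w j < w (Suc k)" using i j by auto
        then show ?thesis using inv[of "Suc k" j] j ij unfolding above_def by auto
      qed
      show ?thesis using 1 2 by simp
    qed
    have sub: "perm_support n w \<subseteq> {1..<n}" unfolding perm_support_def by auto
    have n1: "1 \<le> n" using pq unfolding edge_def above_def by auto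
    \<comment> \<open>Every label already occurs at 1 or directly after an index outside the
      support, which leaves at most n - card (\<open>perm_support n w\<close>) labels. The diagram
      without (p, q) has at least n + 1 minus the number of all its edges, which is one
      more.\<close>
    have all: "f k \<in> f ` insert 1 (Suc ` ({1..<n} - perm_support n w))" if "1 \<le> k" "k \<le> n" for k using that
    proof (induction rule: dec_induct)
      case (step m)
      show ?case
      proof (cases "m \<in> perm_support n w")
        case True then show ?thesis using step Suc by auto
      next
        case False then show ?thesis using step by auto
      qed
    qed simp
    have "f ` {1..n} \<subseteq> f ` insert 1 (Suc ` ({1..<n} - perm_support n w))"
    proof (rule image_subsetI)
      fix k assume "k \<in> {1..n}"
      then show "f k \<in> f ` insert 1 (Suc ` ({1..<n} - perm_support n w))" by (intro all) auto
    qed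
    then have "card (f ` {1..n}) \<le> card (f ` insert 1 (Suc ` ({1..<n} - perm_support n w)))" by (intro card_mono) auto
    also have "\<dots> \<le> card (insert 1 (Suc ` ({1..<n} - perm_support n w)))" by (intro card_image_le) auto
    also have "\<dots> \<le> Suc (card (Suc ` ({1..<n} - perm_support n w)))" by (rule card_insert_le_m1) auto
    also have "\<dots> = Suc (card ({1..<n} - perm_support n w))" by (simp add: card_image)
    also have "\<dots> = Suc (n - 1 - card (perm_support n w))" using sub by (simp add: card_Diff_subset finite_subset)
    finally have c: "card (f ` {1..n}) \<le> Suc (n - 1 - card (perm_support n w))" .
    have "card (perm_support n w) \<le> n - 1" using card_mono[OF _ sub] by simp
    moreover have "card ?F < card {(a, b). edge a b}"
      using pq by (intro card_Diff1_less finite_edges) auto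
    ultimately show False using c card f(2) n1 by linarith
  qed
  moreover have "f u = f v" if "above u v" "\<not> ((u = p \<or> above u p) \<and> (q = v \<or> above q v))" for u v
    by (rule label_constant[OF fe that])
  ultimately show ?thesis by blast
qed

end

lemma unit_stepI:
  assumes "v permutes {1..n}" "1 \<le> i" "i < j" "j \<le> n" "v j < v i"
    "\<And>k. i < k \<Longrightarrow> k < j \<Longrightarrow> \<not> (v j < v k \<and> v k < v i)"
  shows "unit_step n (v \<circ> transpose i j) v"
  unfolding unit_step_iff using assms by blast

lemma bruhat_step_downI:
  assumes "v permutes {1..n}" "1 \<le> i" "i < j" "j \<le> n" "v j < v i"
  shows "bruhat_step n (v \<circ> transpose i j) v"
  unfolding bruhat_step_down_iff using assms by blast

section \<open>From isomorphic graphs to pattern avoidance\<close>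

locale isomorphic_graphs = permutation +
  assumes iso: "graph_isomorphic (Gamma_lower n w) (Gamma_upper n w)"
begin

lemma card_edges_le: "card {(a, b). edge a b} \<le> card (perm_support n w)"
  using card_edges isomorphic_card_coatoms_le[OF iso] card_atoms_le[of n w] by simp

lemmas cut = edge_cut[OF card_edges_le]

text \<open>Incomparable x and y between a and d would close a cycle: without the first edge from x
  towards d, its endpoints are still joined through a, y and d.\<close>

lemma interval_chain:
  assumes ax: "above a x" "above a y" and xd: "above x d" "above y d" and ne: "x \<noteq> y"
  shows "above x y \<or> above y x"
proof (rule ccontr)
  assume n: "\<not> ?thesis"
  obtain q where q: "edge x q" "q = d \<or> above q d" using first_edge[OF xd(1)] by blast
  have xq: "above x q" using edge_above[OF q(1)] .
  from cut[OF q(1)] obtain f :: "nat \<Rightarrow> nat" where f0: "f x \<noteq> f q \<and>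
      (\<forall>u v. above u v \<longrightarrow> \<not> ((u = x \<or> above u x) \<and> (q = v \<or> above q v)) \<longrightarrow> f u = f v)" ..
  note f = f0[THEN conjunct1] f0[THEN conjunct2, rule_format]
  have "f a = f y" using f(2)[OF ax(2)] n xq above_trans by blast
  moreover have "f y = f d" using f(2)[OF xd(2)] n ne by blast
  moreover have "f a = f x" using f(2)[OF ax(1)] xq above_trans above_irrefl by blast
  moreover have "f q = f d" using f(2)[of q d] q(2) xq above_trans above_irrefl by blast
  ultimately show False using f(1) by simp
qed

text \<open>Let r be a lowest element that is weakly below i1 and above both j1 and j2, and cut its
  first edge from r to b towards j1. Then j1 stays on the side of b, whereas j2 and with it i2 stay
  on the side of r. So the relation between i2 and j1 must use this edge, which puts i2 above
  r.\<close>

lemma merge_point: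
  assumes "above i1 j1" "above i1 j2" "above i2 j1" "above i2 j2"
    and i: "\<not> above i1 i2" "\<not> above i2 i1" "i1 \<noteq> i2" and j: "\<not> above j1 j2" "\<not> above j2 j1" "j1 \<noteq> j2"
  obtains r where "above i1 r" "above i2 r" "above r j1" "above r j2"
proof -
  let ?R = "{r. (r = i1 \<or> above i1 r) \<and> above r j1 \<and> above r j2}"
  have R: "finite ?R" by (rule finite_subset[OF _ finite_above(1)[of j1]]) blast
  have ne: "i1 \<in> ?R" using assms(1,2) by blast
  define r where "r = Max ?R"
  have r: "r \<in> ?R" unfolding r_def by (rule Max_in[OF R]) (use ne in blast)
  have max: "s \<le> r" if "s \<in> ?R" for s unfolding r_def using R that by simp
  obtain b where b: "edge r b" "b = j1 \<or> above b j1" using first_edge r by blast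
  have rb: "above r b" using edge_above[OF b(1)] .
  have nb: "\<not> (b = j2 \<or> above b j2)"
  proof
    assume a: "b = j2 \<or> above b j2"
    then have "above b j1" "above b j2" using b(2) j by auto
    then have "b \<in> ?R" using r rb above_trans by blast
    then show False using max[of b] rb unfolding above_def by auto
  qed
  from cut[OF b(1)] obtain f :: "nat \<Rightarrow> nat" where f0: "f r \<noteq> f b \<and>
      (\<forall>u v. above u v \<longrightarrow> \<not> ((u = r \<or> above u r) \<and> (b = v \<or> above b v)) \<longrightarrow> f u = f v)" ..
  note f = f0[THEN conjunct1] f0[THEN conjunct2, rule_format]
  have 1: "f b = f j1" using f(2)[of b j1] b(2) rb above_trans above_irrefl by blast
  have 2: "f r = f j2" using f(2)[of r j2] r nb by blast
  have 3: "f i2 = f j2" using f(2)[of i2 j2] assms(4) nb by blast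
  have "i2 = r \<or> above i2 r"
  proof (rule ccontr)
    assume "\<not> ?thesis"
    then have "f i2 = f j1" using f(2)[of i2 j1] assms(3) by blast
    then show False using 1 2 3 f(1) by simp
  qed
  then have "above i2 r" "above i1 r" using r i by auto
  then show ?thesis using that r by blast
qed

text \<open>The two common neighbours are w composed with the two 3-cycles on i, j, k. A value
  spoiling one of the covers would belong to some c between i and k; by
  \<open>interval_chain\<close> it is comparable to j, contradicting that (i, j) and (j, k) are
  edges.\<close>

lemma doubly_adjacent_upper:
  assumes ij: "edge i j" and jk: "edge j k"
  shows "doubly_adjacent (Gamma_upper n w) (w \<circ> transpose i j) (w \<circ> transpose j k)"
proof -
  let ?u = "w \<circ> transpose i j" and ?v = "w \<circ> transpose j k"
  let ?z1 = "?u \<circ> transpose j k" and ?z2 = "?v \<circ> transpose i j"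
  have r: "1 \<le> i" "i < j" "j < k" "k \<le> n" "w j < w i" "w k < w j" using ij jk unfolding edge_def above_def by auto
  have no: "\<not> (above i c \<and> above c j)" "\<not> (above j c \<and> above c k)" for c using ij jk unfolding edge_def by blast+
  have ui: "?u i = w j" "?u j = w i" "?u k = w k" and vi: "?v i = w i" "?v j = w k" "?v k = w j" using r by auto
  have u: "unit_step n ?u w" and v: "unit_step n ?v w" using coatom_iff ij jk by blast+
  have up: "?u permutes {1..n}" "?v permutes {1..n}" using u v unit_step_less bruhat_less_permutes by blast+
  have lu: "Suc (perm_length n ?u) = perm_length n w" "Suc (perm_length n ?v) = perm_length n w"
    using u v unfolding unit_step_def by auto
  have n1: "\<not> (?u k < ?u c \<and> ?u c < ?u j)" if c: "j < c" "c < k" for c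
  proof
    assume "?u k < ?u c \<and> ?u c < ?u j"
    then have wc: "w k < w c" "w c < w i" using ui c r by auto
    then have ic: "above i c" "above c k" using c r unfolding above_def by auto
    have "above j c \<or> above c j" using interval_chain[of i j c k] ic ij jk edge_above c by auto
    then show False using no(2) ic c unfolding above_def by auto
  qed
  have ord: "1 \<le> j" "j \<le> n" "i < k" "w k < w i" using r by auto
  have lt: "?u k < ?u j" "?u k < ?u i" "?v j < ?v i" "?v k < ?v i" unfolding ui vi using r ord by auto
  have z1u: "unit_step n ?z1 ?u" by (rule unit_stepI[OF up(1) ord(1) r(3,4) lt(1) n1])
  have n2: "\<not> (?v j < ?v c \<and> ?v c < ?v i)" if c: "i < c" "c < j" for c
  proof
    assume "?v j < ?v c \<and> ?v c < ?v i"
    then have wc: "w k < w c" "w c < w i" using vi c r by auto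
    then have ic: "above i c" "above c k" using c r unfolding above_def by auto
    have "above j c \<or> above c j" using interval_chain[of i j c k] ic ij jk edge_above c by auto
    then show False using no(1) ic c unfolding above_def by auto
  qed
  have z2v: "unit_step n ?z2 ?v" by (rule unit_stepI[OF up(2) r(1,2) ord(2) lt(3) n2])
  \<comment> \<open>Each 3-cycle is also reached from the other coatom, by exchanging i and k. The
    lengths are known from the first two covers, so these descents are covers too.\<close>
  have e1: "?z1 = ?v \<circ> transpose i k" and e2: "?z2 = ?u \<circ> transpose i k"
    using r by (auto simp: fun_eq_iff Transposition.transpose_def)
  have "bruhat_step n ?z1 ?v" "bruhat_step n ?z2 ?u"
    unfolding e1 e2
    by (rule bruhat_step_downI[OF up(2) r(1) ord(3) r(4) lt(4)], rule bruhat_step_downI[OF up(1) r(1) ord(3) r(4) lt(2)])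
  moreover have "perm_length n ?v = Suc (perm_length n ?z1)" "perm_length n ?u = Suc (perm_length n ?z2)"
    using z1u z2v lu unfolding unit_step_def by auto
  ultimately have z1v: "unit_step n ?z1 ?v" and z2u: "unit_step n ?z2 ?u" unfolding unit_step_def by auto
  let ?A = "rank_level n w (int (perm_length n w) - 1)" and ?B = "rank_level n w (int (perm_length n w) - 2)"
  have A: "?u \<in> ?A" "?v \<in> ?A" using u v coatoms_iff by blast+
  have B: "z \<in> ?B" if "unit_step n z x" "unit_step n x w" for z x
  proof -
    have "bruhat_less n z w" using that unit_step_less bruhat_less_trans by blast
    moreover have "perm_length n w = perm_length n z + 2" using that unfolding unit_step_def by simp
    ultimately show ?thesis unfolding rank_level_def lower_interval_less using bruhat_less_permutes by auto
  qed
  have zB: "?z1 \<in> ?B" "?z2 \<in> ?B" using B z1u z2v u v by blast+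
  have "?z1 i = w j" "?z2 i = w k" using r by auto
  then have "?z1 \<noteq> ?z2" using r by (metis less_irrefl)
  moreover have "?u \<noteq> ?v" using ui vi r by (metis less_irrefl)
  moreover have "{x, z} \<in> snd (Gamma_upper n w)" if "x \<in> ?A" "z \<in> ?B" "unit_step n z x" for x z
    unfolding Gamma_upper_def cover_graph_edge_iff using that by blast
  moreover have "?z1 \<in> fst (Gamma_upper n w)" "?z2 \<in> fst (Gamma_upper n w)"
    unfolding Gamma_upper_def fst_cover_graph using zB by blast+
  ultimately show ?thesis unfolding doubly_adjacent_def using A zB z1u z1v z2u z2v by blast
qed

definition coatom :: "nat \<times> nat \<Rightarrow> nat \<Rightarrow> nat" where
  "coatom e = w \<circ> transpose (fst e) (snd e)"

definition edges :: "(nat \<times> nat) set" where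
  "edges = {(a, b). edge a b}"

definition consecutive :: "nat \<times> nat \<Rightarrow> nat \<times> nat \<Rightarrow> bool" where
  "consecutive e e' \<longleftrightarrow> e \<in> edges \<and> e' \<in> edges \<and> (snd e = fst e' \<or> snd e' = fst e)"

text \<open>Edges of the diagram correspond to coatoms, and edges meeting head to tail to doubly
  adjacent coatoms. The isomorphism carries them back, one to one, to the lower graph, where double
  adjacency is known.\<close>

lemma consecutive_pull_back:
  obtains g where "inj_on g edges"
    "\<And>e e'. consecutive e e' \<Longrightarrow> lower_adjacent n w (g e) (g e')"
proof -
  let ?G = "Gamma_lower n w" and ?H = "Gamma_upper n w"
  obtain f where f: "bij_betw f (fst ?G) (fst ?H)"
    "\<And>u v. u \<in> fst ?G \<Longrightarrow> v \<in> fst ?G \<Longrightarrow> {u, v} \<in> snd ?G \<longleftrightarrow> {f u, f v} \<in> snd ?H"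
    using iso unfolding graph_isomorphic_def by blast
  have co: "coatom e \<in> fst ?H" if "e \<in> edges" for e
  proof -
    obtain a b where e: "e = (a, b)" "edge a b" using \<open>e \<in> edges\<close> unfolding edges_def by blast
    have "unit_step n (coatom e) w" unfolding coatom_iff unfolding coatom_def e(1) fst_conv snd_conv using e(2) by blast
    then show ?thesis using coatoms_iff unfolding Gamma_upper_def fst_cover_graph by blast
  qed
  have cinj: "e = e'" if "coatom e = coatom e'" "e \<in> edges" "e' \<in> edges" for e e'
    using that transpose_determined unfolding coatom_def edges_def edge_def above_def by (auto simp: prod_eq_iff)
  let ?g = "\<lambda>e. inv_into (fst ?G) f (coatom e)"
  have fg: "f (?g e) = coatom e" "?g e \<in> fst ?G" if "e \<in> edges" for e
    using co[OF that] f(1) by (auto simp: bij_betw_def f_inv_into_f inv_into_into)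
  have "inj_on ?g edges" by (rule inj_onI) (metis fg(1) cinj)
  moreover have "doubly_adjacent ?G (?g e) (?g e')" if c: "consecutive e e'" for e e'
  proof -
    have e: "e \<in> edges" "e' \<in> edges" using c unfolding consecutive_def by auto
    have "doubly_adjacent ?H (coatom e) (coatom e')"
    proof -
      obtain a b a' b' where ab: "e = (a, b)" "edge a b" "e' = (a', b')" "edge a' b'"
        using e unfolding edges_def by blast
      then have "b = a' \<or> b' = a" using c unfolding consecutive_def by simp
      then show ?thesis
        using doubly_adjacent_upper[of a b b'] doubly_adjacent_upper[of a' b' b] ab
          doubly_adjacent_sym[of ?H "coatom e"] unfolding coatom_def by auto
    qed
    then show ?thesis using doubly_adjacent_iso[OF f fg(2)[OF e(1)] fg(2)[OF e(2)]] fg(1) e by simp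
  qed
  ultimately show ?thesis using that by blast
qed

lemma no_star:
  assumes "consecutive e e1" "consecutive e e2" "consecutive e e3" "e1 \<noteq> e2" "e1 \<noteq> e3" "e2 \<noteq> e3"
  shows False
proof -
  obtain g where g: "inj_on g edges" "\<And>e e'. consecutive e e' \<Longrightarrow> lower_adjacent n w (g e) (g e')"
    using consecutive_pull_back by blast
  have "e1 \<in> edges" "e2 \<in> edges" "e3 \<in> edges" using assms unfolding consecutive_def by auto
  then have "g e1 \<noteq> g e2" "g e1 \<noteq> g e3" "g e2 \<noteq> g e3" using g(1) assms(4-6) by (auto dest: inj_onD)
  then show False using lower_no_star g(2) assms(1-3) by blast
qed

lemma no_square:
  assumes "consecutive a b" "consecutive a d" "consecutive b c" "consecutive d c" "a \<noteq> c" "b \<noteq> d"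
  shows False
proof -
  obtain g where g: "inj_on g edges" "\<And>e e'. consecutive e e' \<Longrightarrow> lower_adjacent n w (g e) (g e')"
    using consecutive_pull_back by blast
  have "a \<in> edges" "b \<in> edges" "c \<in> edges" "d \<in> edges" using assms unfolding consecutive_def by auto
  then have "g a \<noteq> g c" "g b \<noteq> g d" using g(1) assms(5,6) by (auto dest: inj_onD)
  then show False using lower_no_square g(2) assms(1-4) by blast
qed

text \<open>The degree conditions are stars centred at the edge (b, c) or (c, b), with neighbours
  taken from both ends. Two edges into b and two edges out of b form a square in which incoming and
  outgoing edges alternate.\<close>

sublocale narrow_order above edge
proof unfold_locales
  have lt: "a < b" if "edge a b" for a b using that unfolding edge_def above_def by auto
  fix a1 a2 a3 b c d c1 c2
  show False if "edge a1 b" "edge a2 b" "edge a3 b" "edge b c" "a1 \<noteq> a2" "a1 \<noteq> a3" "a2 \<noteq> a3"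
    using no_star[of "(b, c)" "(a1, b)" "(a2, b)" "(a3, b)"] that by (simp add: consecutive_def edges_def)
  show False if "edge b a1" "edge b a2" "edge b a3" "edge c b" "a1 \<noteq> a2" "a1 \<noteq> a3" "a2 \<noteq> a3"
    using no_star[of "(c, b)" "(b, a1)" "(b, a2)" "(b, a3)"] that by (simp add: consecutive_def edges_def)
  show False if "edge a1 b" "edge a2 b" "a1 \<noteq> a2" "edge b c" "edge c d"
    using no_star[of "(b, c)" "(a1, b)" "(a2, b)" "(c, d)"] that lt[of a1 b] lt[of a2 b] lt[of b c]
    by (auto simp: consecutive_def edges_def)
  show False if "edge b a1" "edge b a2" "a1 \<noteq> a2" "edge c b" "edge d c"
    using no_star[of "(c, b)" "(b, a1)" "(b, a2)" "(d, c)"] that lt[of b a1] lt[of b a2] lt[of c b]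
    by (auto simp: consecutive_def edges_def)
  show False if "edge a1 b" "edge a2 b" "a1 \<noteq> a2" "edge b c1" "edge b c2" "c1 \<noteq> c2"
    using no_square[of "(a1, b)" "(b, c1)" "(b, c2)" "(a2, b)"] that by (simp add: consecutive_def edges_def)
qed (use above_trans above_irrefl first_edge last_edge edge_above finite_above in blast)+

interpretation dual: narrow_order "\<lambda>a b. above b a" "\<lambda>a b. edge b a"
  by (rule dual)

lemma dual_incomparable: "dual.incomparable a b \<longleftrightarrow> incomparable a b"
  unfolding dual.incomparable_def incomparable_def by blast

lemma incomparableI: "a < b \<Longrightarrow> w a < w b \<Longrightarrow> incomparable a b"
  unfolding incomparable_def above_def by auto

text \<open>In 3412 the two upper and the two lower elements share a merge point, which is at the
  same time a branch point; 4231 puts two incomparable elements between two others; 34521 is a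
  triple merge and 45321 a merge over a chain. The duals of the last two give 54123 and
  54312.\<close>

lemma good: "good 1 n w"
  unfolding good_def
proof (intro conjI allI impI notI)
  fix i j k l assume *: "1 \<le> i \<and> i < j \<and> j < k \<and> k < l \<and> l \<le> n"
  {
    assume v: "w k < w l \<and> w l < w i \<and> w i < w j"
    have a: "above i k" "above i l" "above j k" "above j l" using * v unfolding above_def by auto
    have inc: "incomparable i j" "incomparable k l" using * v by (auto intro: incomparableI)
    then obtain r where "above i r" "above j r" "above r k" "above r l"
      using merge_point[OF a] unfolding incomparable_def by blast
    then show False using no_merge_and_branch[of i r j k l] inc by blast
  }
  {
    assume v: "w l < w j \<and> w j < w k \<and> w k < w i"
    have "above i j" "above i k" "above j l" "above k l" using * v unfolding above_def by auto
    moreover have "incomparable j k" using * v by (auto intro: incomparableI)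
    ultimately show False using interval_chain[of i j k l] unfolding incomparable_def by blast
  }
next
  fix i j k l m assume *: "1 \<le> i \<and> i < j \<and> j < k \<and> k < l \<and> l < m \<and> m \<le> n"
  {
    assume v: "w m < w l \<and> w l < w i \<and> w i < w j \<and> w j < w k"
    have "above i l" "above j l" "above k l" "above l m" using * v unfolding above_def by auto
    moreover have "incomparable i j" "incomparable i k" "incomparable j k" using * v by (auto intro: incomparableI)
    ultimately show False using no_triple_merge[of i l j k m] by blast
  }
  {
    assume v: "w m < w l \<and> w l < w k \<and> w k < w i \<and> w i < w j"
    have "above i k" "above j k" "above k l" "above l m" using * v unfolding above_def by auto
    moreover have "incomparable i j" using * v by (auto intro: incomparableI)
    ultimately show False using no_merge_over_chain[of i k j l m] by blast
  }
  {
    assume v: "w k < w l \<and> w l < w m \<and> w m < w j \<and> w j < w i"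
    have "above j k" "above j l" "above j m" "above i j" using * v unfolding above_def by auto
    moreover have "dual.incomparable k l" "dual.incomparable k m" "dual.incomparable l m"
      unfolding dual_incomparable using * v by (auto intro: incomparableI)
    ultimately show False using dual.no_triple_merge[of j k l m i] by blast
  }
  {
    assume v: "w l < w m \<and> w m < w k \<and> w k < w j \<and> w j < w i"
    have "above k l" "above k m" "above j k" "above i j" using * v unfolding above_def by auto
    moreover have "dual.incomparable l m" unfolding dual_incomparable using * v by (auto intro: incomparableI)
    ultimately show False using dual.no_merge_over_chain[of k l m j i] by blast
  }
qed

end

theorem theorem1p4:
  fixes n :: nat and w :: "nat \<Rightarrow> nat"
  assumes "w \<in> carrier (sym_group n)"
  shows "(graph_isomorphic (Gamma_lower n w) (Gamma_upper n w) \<longleftrightarrow>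
            (\<forall>p \<in> {[3,4,1,2], [4,2,3,1], [3,4,5,2,1], [4,5,3,2,1], [5,4,1,2,3], [5,4,3,1,2]}.
               avoids n w p)) \<and>
         ((\<forall>p \<in> {[3,4,1,2], [4,2,3,1], [3,4,5,2,1], [4,5,3,2,1], [5,4,1,2,3], [5,4,3,1,2]}.
               avoids n w p) \<longleftrightarrow> polished n w) \<and>
         (polished n w \<longleftrightarrow> self_dual (lower_interval n w) (bruhat_le n))"
proof -
  have w: "w permutes {1..n}" using assms unfolding sym_group_carrier .
  have "good 1 n w" if "graph_isomorphic (Gamma_lower n w) (Gamma_upper n w)"
  proof -
    interpret isomorphic_graphs n w by unfold_locales (use w that in auto)
    show ?thesis by (rule good)
  qed
  then show ?thesis
    unfolding good_iff_avoids[symmetric]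
    using good_imp_polished[OF w] polished_self_dual[of n w] self_dual_graph_isomorphic[OF w] by blast
qed

end
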